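(* In a plane fronted wave $\overline{M}^{n+2}$, the only codimension two parabolic extremal spacelike submanifolds $\psi:\Sigma^n\to\overline{M}^{n+2}$ with $\mu:=u\circ\psi$ and $\nu:=v\circ\psi$ bounded (either from above or below) are the (necessarily parabolic) wavefronts $u=u_0$, $v=v_0$, with $u_0,v_0\in\mathbb{R}$.
   Context: A plane fronted wave is a Lorentzian manifold $(\overline{M}^{n+2},\langle\ ,\ \rangle)$ with $\overline{M}^{n+2}=\mathbb{R}^2\times M^n$, where $(M^n,g_M)$ is a connected Riemannian manifold, and metric $\langle\ ,\ \rangle=\mathcal{H}(u,x)\,du\otimes du+du\otimes dv+dv\otimes du+g_M$, where $(u,v)$ are the natural coordinates on $\mathbb{R}^2$ and $\mathcal{H}(u,x)$ is a smooth function on $\mathbb{R}^2\times M^n$ independent of $v$. The wavefronts are the codimension two spacelike submanifolds given by $u=u_0$, $v=v_0$, for $u_0,v_0\in\mathbb{R}$, with the induced metric. A spacelike submanifold $\psi:\Sigma^k\to\overline{M}^{n+2}$ is an immersion of a connected $k$-dimensional manifold whose induced metric is Riemannian. Its mean curvature vector field is $\overrightarrow{H}=\frac1k\,\mathrm{trace}(\mathrm{II})$, the trace being taken with respect to the induced metric, where $\mathrm{II}$ is the second fundamental form, defined by $\overline{\nabla}_XY=\nabla_XY+\mathrm{II}(X,Y)$, with $\overline\nabla$, $\nabla$ the Levi-Civita connections of $\overline{M}^{n+2}$ and $\Sigma^k$. It is extremal if $\overrightarrow{H}=0$. A complete (non-compact) Riemannian manifold is parabolic if the only superharmonic functions ($\Delta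 f\le 0$, $\Delta=\mathrm{div}\,\nabla$) bounded from below that it admits are the constants. A spacelike submanifold is parabolic if it is so with its induced metric. *)

theory Defs
  imports "HOL-Analysis.Analysis"
begin

section \<open>Smooth manifolds and smooth maps\<close>

text \<open>
  On an open set \<open>S\<close>, \<open>f\<close> is of class \<open>C^(k+1)\<close> iff it is differentiable and all its directional
  derivatives are of class \<open>C^k\<close>.
\<close>

primrec Ck_on :: "nat \<Rightarrow> 'a::euclidean_space set \<Rightarrow> ('a \<Rightarrow> 'b::real_normed_vector) \<Rightarrow> bool" where
  "Ck_on 0 S f \<longleftrightarrow> continuous_on S f"
| "Ck_on (Suc k) S f \<longleftrightarrow>
     (\<forall>x\<in>S. f differentiable (at x)) \<and> (\<forall>v. Ck_on k S (\<lambda>x. frechet_derivative f (at x) v))"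

definition smooth_on :: "'a::euclidean_space set \<Rightarrow> ('a \<Rightarrow> 'b::real_normed_vector) \<Rightarrow> bool" where
  "smooth_on S f \<longleftrightarrow> (\<forall>k. Ck_on k S f)"

text \<open>
  The points of a manifold are all the elements of a type \<open>'a\<close>. An atlas is a family of charts,
  indexed by a type \<open>'i\<close>, with values in a Euclidean space \<open>'e\<close>, so the dimension is \<open>DIM('e)\<close>.
  A chart is a pair of a domain and a map which is meaningful on that domain only.
\<close>

type_synonym ('i, 'a, 'e) atlas = "'i \<Rightarrow> 'a set \<times> ('a \<Rightarrow> 'e)"

definition cdom :: "('i, 'a, 'e) atlas \<Rightarrow> 'i \<Rightarrow> 'a set" where
  "cdom A i = fst (A i)"

definition cmap :: "('i, 'a, 'e) atlas \<Rightarrow> 'i \<Rightarrow> 'a \<Rightarrow> 'e" where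
  "cmap A i = snd (A i)"

definition cimg :: "('i, 'a, 'e) atlas \<Rightarrow> 'i \<Rightarrow> 'e set" where
  "cimg A i = cmap A i ` cdom A i"

definition cinv :: "('i, 'a, 'e) atlas \<Rightarrow> 'i \<Rightarrow> 'e \<Rightarrow> 'a" where
  "cinv A i = inv_into (cdom A i) (cmap A i)"

definition chart_at :: "('i, 'a, 'e) atlas \<Rightarrow> 'a \<Rightarrow> 'i" where
  "chart_at A p = (SOME i. p \<in> cdom A i)"

text \<open>The expression of a map \<open>\<psi>\<close> in the charts \<open>i\<close> and \<open>j\<close>, and the set on which it is meaningful.\<close>

definition local_map ::
  "('i, 'a, 'e) atlas \<Rightarrow> ('j, 'b, 'f) atlas \<Rightarrow> ('a \<Rightarrow> 'b) \<Rightarrow> 'i \<Rightarrow> 'j \<Rightarrow> 'e \<Rightarrow> 'f" where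
  "local_map A B \<psi> i j = cmap B j \<circ> \<psi> \<circ> cinv A i"

definition local_dom ::
  "('i, 'a, 'e) atlas \<Rightarrow> ('j, 'b, 'f) atlas \<Rightarrow> ('a \<Rightarrow> 'b) \<Rightarrow> 'i \<Rightarrow> 'j \<Rightarrow> 'e set" where
  "local_dom A B \<psi> i j = cmap A i ` (cdom A i \<inter> \<psi> -` cdom B j)"

definition smooth_manifold ::
  "('i, 'a::{t2_space, second_countable_topology}, 'e::euclidean_space) atlas \<Rightarrow> bool" where
  "smooth_manifold A \<longleftrightarrow>
     (\<Union>i. cdom A i) = UNIV \<and>
     (\<forall>i. open (cdom A i) \<and> open (cimg A i) \<and>
          homeomorphism (cdom A i) (cimg A i) (cmap A i) (cinv A i)) \<and>
     (\<forall>i j. smooth_on (local_dom A A id i j) (local_map A A id i j))"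

definition connected_manifold ::
  "('i, 'a::{t2_space, second_countable_topology}, 'e::euclidean_space) atlas \<Rightarrow> bool" where
  "connected_manifold A \<longleftrightarrow> smooth_manifold A \<and> connected (UNIV :: 'a set)"

definition smooth_map ::
  "('i, 'a::topological_space, 'e::euclidean_space) atlas \<Rightarrow>
   ('j, 'b::topological_space, 'f::euclidean_space) atlas \<Rightarrow> ('a \<Rightarrow> 'b) \<Rightarrow> bool" where
  "smooth_map A B \<psi> \<longleftrightarrow>
     continuous_on UNIV \<psi> \<and> (\<forall>i j. smooth_on (local_dom A B \<psi> i j) (local_map A B \<psi> i j))"

definition smooth_fun :: "('i, 'a, 'e::euclidean_space) atlas \<Rightarrow> ('a \<Rightarrow> real) \<Rightarrow> bool" where
  "smooth_fun A f \<longleftrightarrow> (\<forall>i. smooth_on (cimg A i) (f \<circ> cinv A i))"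

definition immersion ::
  "('i, 'a::topological_space, 'e::euclidean_space) atlas \<Rightarrow>
   ('j, 'b::topological_space, 'f::euclidean_space) atlas \<Rightarrow> ('a \<Rightarrow> 'b) \<Rightarrow> bool" where
  "immersion A B \<psi> \<longleftrightarrow>
     smooth_map A B \<psi> \<and>
     (\<forall>i j. \<forall>x\<in>local_dom A B \<psi> i j. inj (frechet_derivative (local_map A B \<psi> i j) (at x)))"


section \<open>Local pseudo-Riemannian geometry\<close>

text \<open>
  Here \<open>g x v w\<close> is a metric in one chart, at the point with coordinates \<open>x\<close>. All notions
  of this section are those of the chart, for vector fields given by their coordinate expressions.
\<close>

type_synonym 'e local_metric = "'e \<Rightarrow> 'e \<Rightarrow> 'e \<Rightarrow> real"

definition nondegenerate :: "('e::real_vector \<Rightarrow> 'e \<Rightarrow> real) \<Rightarrow> bool" where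
  "nondegenerate b \<longleftrightarrow> (\<forall>v. (\<forall>w. b v w = 0) \<longrightarrow> v = 0)"

text \<open>
  The Levi-Civita connection is the unique connection that is torsion-free and compatible with the
  metric. In a chart it is \<open>\<nabla>\<^sub>X Y = DY(X) + \<Gamma>(X, Y)\<close>; being torsion-free means that the bilinear map
  \<open>\<Gamma>\<close> is symmetric, and compatibility is \<open>D\<^sub>z \<langle>v, w\<rangle> = \<langle>\<nabla>\<^sub>z v, w\<rangle> + \<langle>v, \<nabla>\<^sub>z w\<rangle>\<close> for constant \<open>v\<close> and \<open>w\<close>.
\<close>

definition is_levi_civita ::
  "'e::euclidean_space local_metric \<Rightarrow> 'e \<Rightarrow> ('e \<Rightarrow> 'e \<Rightarrow> 'e) \<Rightarrow> bool" where
  "is_levi_civita g x \<Gamma> \<longleftrightarrow>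
     bilinear \<Gamma> \<and>
     (\<forall>v w. \<Gamma> v w = \<Gamma> w v) \<and>
     (\<forall>z v w. frechet_derivative (\<lambda>y. g y v w) (at x) z = g x (\<Gamma> z v) w + g x v (\<Gamma> z w))"

definition christoffel :: "'e::euclidean_space local_metric \<Rightarrow> 'e \<Rightarrow> 'e \<Rightarrow> 'e \<Rightarrow> 'e" where
  "christoffel g x = (THE \<Gamma>. is_levi_civita g x \<Gamma>)"

text \<open>
  The covariant derivative along a map \<open>F\<close> into a chart with metric \<open>g\<close>, in the direction of a
  vector field \<open>X\<close> on the source of \<open>F\<close>, of a vector field \<open>W\<close> along \<open>F\<close>.
\<close>

definition cov_along ::
  "'f::euclidean_space local_metric \<Rightarrow> ('e::euclidean_space \<Rightarrow> 'f) \<Rightarrow>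
   ('e \<Rightarrow> 'e) \<Rightarrow> ('e \<Rightarrow> 'f) \<Rightarrow> 'e \<Rightarrow> 'f" where
  "cov_along g F X W x =
     frechet_derivative W (at x) (X x) +
     christoffel g (F x) (frechet_derivative F (at x) (X x)) (W x)"

definition cov ::
  "'e::euclidean_space local_metric \<Rightarrow> ('e \<Rightarrow> 'e) \<Rightarrow> ('e \<Rightarrow> 'e) \<Rightarrow> 'e \<Rightarrow> 'e" where
  "cov g X Y x = frechet_derivative Y (at x) (X x) + christoffel g x (X x) (Y x)"

text \<open>The vector that represents a linear form with respect to a nondegenerate bilinear form.\<close>

definition sharp :: "('e::euclidean_space \<Rightarrow> 'e \<Rightarrow> real) \<Rightarrow> ('e \<Rightarrow> real) \<Rightarrow> 'e" where
  "sharp b \<omega> = (THE v. \<forall>w. b v w = \<omega> w)"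

text \<open>
  Since \<open>sharp b (\<lambda>w. w \<bullet> e)\<close> is the \<open>b\<close>-dual of the basis vector \<open>e\<close>, this is the contraction
  \<open>\<Sum>\<^sub>i\<^sub>j b\<^sup>i\<^sup>j B(e\<^sub>i, e\<^sub>j)\<close>.
\<close>

definition metric_trace ::
  "('e::euclidean_space \<Rightarrow> 'e \<Rightarrow> real) \<Rightarrow> ('e \<Rightarrow> 'e \<Rightarrow> 'f::real_vector) \<Rightarrow> 'f" where
  "metric_trace b B = (\<Sum>e\<in>Basis. B (sharp b (\<lambda>w. w \<bullet> e)) e)"

definition grad :: "'e::euclidean_space local_metric \<Rightarrow> ('e \<Rightarrow> real) \<Rightarrow> 'e \<Rightarrow> 'e" where
  "grad g f x = sharp (g x) (frechet_derivative f (at x))"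

definition divergence :: "'e::euclidean_space local_metric \<Rightarrow> ('e \<Rightarrow> 'e) \<Rightarrow> 'e \<Rightarrow> real" where
  "divergence g X x = (\<Sum>e\<in>Basis. cov g (\<lambda>_. e) X x \<bullet> e)"

definition laplacian :: "'e::euclidean_space local_metric \<Rightarrow> ('e \<Rightarrow> real) \<Rightarrow> 'e \<Rightarrow> real" where
  "laplacian g f = divergence g (grad g f)"

text \<open>
  The Gauss formula \<open>\<nabla>'\<^sub>X Y = \<nabla>\<^sub>X Y + II(X, Y)\<close> for an immersion \<open>F\<close> from a chart with metric \<open>h\<close>
  into a chart with metric \<open>g\<close>.
\<close>

definition second_ff ::
  "'e::euclidean_space local_metric \<Rightarrow> 'f::euclidean_space local_metric \<Rightarrow> ('e \<Rightarrow> 'f) \<Rightarrow>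
   ('e \<Rightarrow> 'e) \<Rightarrow> ('e \<Rightarrow> 'e) \<Rightarrow> 'e \<Rightarrow> 'f" where
  "second_ff h g F X Y x =
     cov_along g F X (\<lambda>y. frechet_derivative F (at y) (Y y)) x -
     frechet_derivative F (at x) (cov h X Y x)"

text \<open>As \<open>II\<close> is tensorial, its values on vectors are computed from their constant extensions.\<close>

definition mean_curvature ::
  "'e::euclidean_space local_metric \<Rightarrow> 'f::euclidean_space local_metric \<Rightarrow> ('e \<Rightarrow> 'f) \<Rightarrow> 'e \<Rightarrow> 'f"
  where
  "mean_curvature h g F x =
     (1 / real DIM('e)) *\<^sub>R metric_trace (h x) (\<lambda>v w. second_ff h g F (\<lambda>_. v) (\<lambda>_. w) x)"


text \<open>The definite descriptions in \<open>sharp\<close> and \<open>christoffel\<close> are well-defined.\<close>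

lemma sharp_ex1:
  fixes b :: "'e::euclidean_space \<Rightarrow> 'e \<Rightarrow> real"
  assumes "bilinear b" "nondegenerate b" "linear \<omega>"
  shows "\<exists>!v. \<forall>w. b v w = \<omega> w"
proof -
  define L :: "'e \<Rightarrow> 'e" where "L v = (\<Sum>e\<in>Basis. b v e *\<^sub>R e)" for v
  have lin: "linear (\<lambda>v. b v w)" "linear (b v)" for v w
    using assms(1) by (auto simp: bilinear_def)
  have L_e: "L v \<bullet> e = b v e" if "e \<in> Basis" for v e
    using that by (simp add: L_def inner_sum_left_Basis)
  have linL: "linear L"
    by (rule linearI; rule euclidean_eqI)
      (simp_all add: L_e inner_add_left linear_add[OF lin(1)] linear_cmul[OF lin(1)])
  have ext: "f = h" if "linear f" "linear h" "\<And>e. e \<in> Basis \<Longrightarrow> f e = h e" for f h :: "'e \<Rightarrow> real"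
    using linear_eq_stdbasis[OF that] .
  have "inj L"
  proof (subst linear_injective_0[OF linL], intro allI impI)
    fix v assume "L v = 0"
    then have "b v e = 0" if "e \<in> Basis" for e
      using L_e[OF that, of v] by simp
    then have "b v = (\<lambda>_. 0)"
      by (intro ext lin) (auto simp: linear_zero)
    then show "v = 0"
      using assms(2) by (simp add: nondegenerate_def)
  qed
  then have "surj L"
    using linL linear_injective_imp_surjective by blast
  then obtain v where v: "L v = (\<Sum>e\<in>Basis. \<omega> e *\<^sub>R e)"
    by (metis surjD)
  have "b v e = \<omega> e" if "e \<in> Basis" for e
    using L_e[OF that, of v] that by (simp add: v inner_sum_left_Basis)
  then have bv: "b v = \<omega>"
    by (intro ext lin assms)
  moreover have "v' = v" if "\<forall>w. b v' w = \<omega> w" for v'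
  proof -
    have "b (v' - v) w = 0" for w
      using that bv by (simp add: linear_diff[OF lin(1)])
    then show ?thesis
      using assms(2) unfolding nondegenerate_def by (metis right_minus_eq)
  qed
  ultimately show ?thesis by auto
qed

lemma levi_civita_ex1:
  fixes g :: "'e::euclidean_space local_metric"
  assumes S: "open S" "x \<in> S"
    and bil: "\<And>y. y \<in> S \<Longrightarrow> bilinear (g y)"
    and sym: "\<And>y v w. y \<in> S \<Longrightarrow> g y v w = g y w v"
    and nd: "nondegenerate (g x)"
    and diff: "\<And>v w. (\<lambda>y. g y v w) differentiable (at x)"
  shows "\<exists>!\<Gamma>. is_levi_civita g x \<Gamma>"
proof -
  define D where "D z v w = frechet_derivative (\<lambda>y. g y v w) (at x) z" for z v w
  have hd: "((\<lambda>y. g y v w) has_derivative (\<lambda>z. D z v w)) (at x)" for v w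
    unfolding D_def using diff frechet_derivative_works by (metis (no_types, lifting) eta_contract_eq)
  have D1: "linear (\<lambda>z. D z v w)" for v w
    using hd has_derivative_linear by blast
  have uniq: "F' = G'" if "(f has_derivative F') (at x)" "(h has_derivative G') (at x)"
    "\<And>y. y \<in> S \<Longrightarrow> f y = h y" for f h :: "'e \<Rightarrow> real" and F' G'
    using that S by (metis has_derivative_transform_within_open has_derivative_unique)
  have lin: "linear (\<lambda>v. g y v w)" "linear (g y v)" if "y \<in> S" for y v w
    using bil[OF that] by (auto simp: bilinear_def)
  have Dsym: "D z v w = D z w v" for z v w
    using uniq[OF hd hd, of v w w v] sym by meson
  have D3: "linear (\<lambda>w. D z v w)" for z v
  proof (rule linearI)
    fix a b
    have "(\<lambda>z. D z v (a + b)) = (\<lambda>z. D z v a + D z v b)"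
      by (rule uniq[OF hd has_derivative_add[OF hd hd]]) (simp add: linear_add[OF lin(2)])
    then show "D z v (a + b) = D z v a + D z v b" by meson
  next
    fix c a
    have "(\<lambda>z. D z v (c *\<^sub>R a)) = (\<lambda>z. c *\<^sub>R D z v a)"
      by (rule uniq[OF hd has_derivative_scaleR_right[OF hd]]) (simp add: linear_cmul[OF lin(2)])
    then show "D z v (c *\<^sub>R a) = c *\<^sub>R D z v a" by meson
  qed
  have D2: "linear (\<lambda>v. D z v w)" for z w
    using D3[of z w] by (simp add: Dsym)
  note Dl = linear_add[OF D1] linear_add[OF D2] linear_add[OF D3]
    linear_cmul[OF D1] linear_cmul[OF D2] linear_cmul[OF D3]
  note gl = linear_add[OF lin(1)[OF S(2)]] linear_cmul[OF lin(1)[OF S(2)]]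
  define K where "K z v w = (D z v w + D v z w - D w z v) / 2" for z v w
  have K: "linear (K z v)" for z v
    by (rule linearI) (simp_all add: K_def Dl field_simps)
  define G where "G z v = (THE u. \<forall>w. g x u w = K z v w)" for z v
  have ex1: "\<exists>!u. \<forall>w. g x u w = K z v w" for z v
    by (rule sharp_ex1[OF bil[OF S(2)] nd K])
  have G: "g x (G z v) w = K z v w" for z v w
    using theI'[OF ex1[of z v]] by (simp add: G_def)
  have eqI: "u = u'" if "\<And>w. g x u w = g x u' w" for u u'
  proof -
    have "g x (u - u') w = 0" for w
      using that by (simp add: linear_diff[OF lin(1)[OF S(2)]])
    then show ?thesis using nd unfolding nondegenerate_def by (metis right_minus_eq)
  qed
  have "is_levi_civita g x G"
    unfolding is_levi_civita_def
  proof (intro conjI allI)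
    show "bilinear G"
      unfolding bilinear_def
      by (intro conjI allI linearI; rule eqI; simp add: G gl K_def Dl field_simps)
    show "G v w = G w v" for v w
      by (rule eqI) (simp add: G K_def Dsym[of _ v w])
    show "frechet_derivative (\<lambda>y. g y v w) (at x) z = g x (G z v) w + g x v (G z w)" for z v w
    proof -
      have "g x v (G z w) = K z w v"
        using sym[OF S(2)] G by metis
      then show ?thesis
        unfolding G K_def D_def[symmetric]
        using Dsym[of z v w] Dsym[of v z w] Dsym[of w z v] by (simp add: field_simps)
    qed
  qed
  moreover have "\<Gamma> = G" if "is_levi_civita g x \<Gamma>" for \<Gamma>
  proof (intro ext)
    fix z v
    have c: "D z v w = g x (\<Gamma> z v) w + g x (\<Gamma> z w) v" for z v w
      using that sym[OF S(2)] unfolding is_levi_civita_def D_def by metis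
    have s: "\<Gamma> v w = \<Gamma> w v" for v w
      using that unfolding is_levi_civita_def by blast
    show "\<Gamma> z v = G z v"
    proof (rule eqI)
      fix w
      show "g x (\<Gamma> z v) w = g x (G z v) w"
        unfolding G K_def c[of z v w] c[of v z w] c[of w z v]
        by (simp add: s[of v z] s[of w z] s[of w v])
    qed
  qed
  ultimately show ?thesis by blast
qed


section \<open>Metrics on manifolds\<close>

text \<open>
  A metric is given by its expressions \<open>g i\<close> in the charts of an atlas, which have to transform as
  the components of a covariant 2-tensor.
\<close>

type_synonym ('i, 'e) metric = "'i \<Rightarrow> 'e local_metric"

definition metric_tensor ::
  "('i, 'a, 'e::euclidean_space) atlas \<Rightarrow> ('i, 'e) metric \<Rightarrow> bool" where
  "metric_tensor A g \<longleftrightarrow>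
     (\<forall>i. \<forall>x\<in>cimg A i. bilinear (g i x) \<and> (\<forall>v w. g i x v w = g i x w v) \<and> nondegenerate (g i x)) \<and>
     (\<forall>i v w. smooth_on (cimg A i) (\<lambda>x. g i x v w)) \<and>
     (\<forall>i j. \<forall>x\<in>local_dom A A id i j. \<forall>v w.
        g i x v w =
        g j (local_map A A id i j x)
          (frechet_derivative (local_map A A id i j) (at x) v)
          (frechet_derivative (local_map A A id i j) (at x) w))"

definition riemannian_metric ::
  "('i, 'a, 'e::euclidean_space) atlas \<Rightarrow> ('i, 'e) metric \<Rightarrow> bool" where
  "riemannian_metric A g \<longleftrightarrow>
     metric_tensor A g \<and> (\<forall>i. \<forall>x\<in>cimg A i. \<forall>v. v \<noteq> 0 \<longrightarrow> g i x v v > 0)"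

text \<open>If \<open>g\<close> is a metric tensor on \<open>B\<close>, the choice of the chart of \<open>B\<close> is immaterial.\<close>

definition induced_metric ::
  "('i, 'a, 'e::euclidean_space) atlas \<Rightarrow> ('j, 'b, 'f::euclidean_space) atlas \<Rightarrow> ('j, 'f) metric \<Rightarrow>
   ('a \<Rightarrow> 'b) \<Rightarrow> ('i, 'e) metric" where
  "induced_metric A B g \<psi> i x v w =
     (let j = chart_at B (\<psi> (cinv A i x));
          D = frechet_derivative (local_map A B \<psi> i j) (at x)
      in g j (local_map A B \<psi> i j x) (D v) (D w))"

definition spacelike_submanifold ::
  "('i, 'a::{t2_space, second_countable_topology}, 'e::euclidean_space) atlas \<Rightarrow>
   ('j, 'b::topological_space, 'f::euclidean_space) atlas \<Rightarrow> ('j, 'f) metric \<Rightarrow> ('a \<Rightarrow> 'b) \<Rightarrow> bool"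
  where
  "spacelike_submanifold A B g \<psi> \<longleftrightarrow>
     connected_manifold A \<and> immersion A B \<psi> \<and> riemannian_metric A (induced_metric A B g \<psi>)"

definition extremal ::
  "('i, 'a, 'e::euclidean_space) atlas \<Rightarrow> ('j, 'b, 'f::euclidean_space) atlas \<Rightarrow> ('j, 'f) metric \<Rightarrow>
   ('a \<Rightarrow> 'b) \<Rightarrow> bool" where
  "extremal A B g \<psi> \<longleftrightarrow>
     (\<forall>i j. \<forall>x\<in>local_dom A B \<psi> i j.
        mean_curvature (induced_metric A B g \<psi> i) (g j) (local_map A B \<psi> i j) x = 0)"


section \<open>Completeness and parabolicity\<close>

definition C1_curve_on ::
  "('i, 'a::topological_space, 'e::euclidean_space) atlas \<Rightarrow> real \<Rightarrow> real \<Rightarrow> (real \<Rightarrow> 'a) \<Rightarrow> bool" where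
  "C1_curve_on A a b \<gamma> \<longleftrightarrow>
     continuous_on {a..b} \<gamma> \<and>
     (\<forall>i. \<exists>D. continuous_on {t\<in>{a..b}. \<gamma> t \<in> cdom A i} D \<and>
        (\<forall>t\<in>{a..b}. \<gamma> t \<in> cdom A i \<longrightarrow>
           ((cmap A i \<circ> \<gamma>) has_vector_derivative D t) (at t within {a..b})))"

text \<open>
  Each piece is \<open>C^1\<close> on a closed interval, with one-sided derivatives at the end points. (The
  library's \<open>piecewise_C1_differentiable_on\<close> allows an unbounded derivative near the corners.)
\<close>

definition piecewise_C1_curve ::
  "('i, 'a::topological_space, 'e::euclidean_space) atlas \<Rightarrow> (real \<Rightarrow> 'a) \<Rightarrow> bool" where
  "piecewise_C1_curve A \<gamma> \<longleftrightarrow>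
     (\<exists>S. finite S \<and>
        (\<forall>a b. 0 \<le> a \<and> a < b \<and> b \<le> 1 \<and> S \<inter> {a<..<b} = {} \<longrightarrow> C1_curve_on A a b \<gamma>))"

definition curve_speed ::
  "('i, 'a, 'e::euclidean_space) atlas \<Rightarrow> ('i, 'e) metric \<Rightarrow> (real \<Rightarrow> 'a) \<Rightarrow> real \<Rightarrow> real" where
  "curve_speed A g \<gamma> t =
     (let i = chart_at A (\<gamma> t);
          w = vector_derivative (cmap A i \<circ> \<gamma>) (at t within {0..1})
      in sqrt (g i (cmap A i (\<gamma> t)) w w))"

definition riemannian_dist ::
  "('i, 'a::topological_space, 'e::euclidean_space) atlas \<Rightarrow> ('i, 'e) metric \<Rightarrow> 'a \<Rightarrow> 'a \<Rightarrow> real" where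
  "riemannian_dist A g p q =
     Inf {integral {0..1} (curve_speed A g \<gamma>) | \<gamma>. piecewise_C1_curve A \<gamma> \<and> \<gamma> 0 = p \<and> \<gamma> 1 = q}"

definition complete_riemannian ::
  "('i, 'a::topological_space, 'e::euclidean_space) atlas \<Rightarrow> ('i, 'e) metric \<Rightarrow> bool" where
  "complete_riemannian A g \<longleftrightarrow> Metric_space.mcomplete UNIV (riemannian_dist A g)"

definition superharmonic ::
  "('i, 'a, 'e::euclidean_space) atlas \<Rightarrow> ('i, 'e) metric \<Rightarrow> ('a \<Rightarrow> real) \<Rightarrow> bool" where
  "superharmonic A g f \<longleftrightarrow>
     smooth_fun A f \<and> (\<forall>i. \<forall>x\<in>cimg A i. laplacian (g i) (f \<circ> cinv A i) x \<le> 0)"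

text \<open>
  Complete non-compact manifolds are the case of interest. Complete compact ones are not
  excluded: on a connected one, all superharmonic functions are constant anyway.
\<close>

definition parabolic ::
  "('i, 'a::topological_space, 'e::euclidean_space) atlas \<Rightarrow> ('i, 'e) metric \<Rightarrow> bool" where
  "parabolic A g \<longleftrightarrow>
     complete_riemannian A g \<and>
     (\<forall>f. superharmonic A g f \<and> bdd_below (range f) \<longrightarrow> (\<exists>c. \<forall>p. f p = c))"


section \<open>Plane fronted waves\<close>

text \<open>The points of the plane fronted wave are the triples \<open>(u, v, x)\<close> with \<open>x\<close> in \<open>M\<close>.\<close>

definition pfw_atlas ::
  "('i, 'm, 'e) atlas \<Rightarrow> ('i, real \<times> real \<times> 'm, real \<times> real \<times> 'e) atlas" where
  "pfw_atlas A i = (UNIV \<times> UNIV \<times> cdom A i, \<lambda>(u, v, x). (u, v, cmap A i x))"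

definition pfw_metric ::
  "('i, 'm, 'e) atlas \<Rightarrow> ('i, 'e) metric \<Rightarrow> (real \<Rightarrow> 'm \<Rightarrow> real) \<Rightarrow>
   ('i, real \<times> real \<times> 'e) metric" where
  "pfw_metric A g H i = (\<lambda>(u, v, y) (a, b, w) (a', b', w').
     H u (cinv A i y) * a * a' + a * b' + b * a' + g i y w w')"

definition plane_fronted_wave ::
  "('i, 'm::{t2_space, second_countable_topology}, 'e::euclidean_space) atlas \<Rightarrow> ('i, 'e) metric \<Rightarrow>
   (real \<Rightarrow> 'm \<Rightarrow> real) \<Rightarrow> bool" where
  "plane_fronted_wave A g H \<longleftrightarrow>
     connected_manifold A \<and> riemannian_metric A g \<and>
     smooth_fun (pfw_atlas A) (\<lambda>(u, v, x). H u x)"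

definition u_coord :: "real \<times> real \<times> 'm \<Rightarrow> real" where
  "u_coord = (\<lambda>(u, v, x). u)"

definition v_coord :: "real \<times> real \<times> 'm \<Rightarrow> real" where
  "v_coord = (\<lambda>(u, v, x). v)"

definition wavefront :: "real \<Rightarrow> real \<Rightarrow> (real \<times> real \<times> 'm) set" where
  "wavefront u\<^sub>0 v\<^sub>0 = {p. u_coord p = u\<^sub>0 \<and> v_coord p = v\<^sub>0}"

text \<open>The wavefront as an immersed submanifold parametrized by \<open>M\<close>.\<close>

definition wavefront_incl :: "real \<Rightarrow> real \<Rightarrow> 'm \<Rightarrow> real \<times> real \<times> 'm" where
  "wavefront_incl u\<^sub>0 v\<^sub>0 x = (u\<^sub>0, v\<^sub>0, x)"

definition bounded_above_or_below :: "('a \<Rightarrow> real) \<Rightarrow> bool" where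
  "bounded_above_or_below f \<longleftrightarrow> bdd_above (range f) \<or> bdd_below (range f)"

end

theory Submission
  imports Defs
begin

text \<open>
  On a plane fronted wave the coordinate field \<open>\<partial>\<^sub>v\<close> is parallel and null, and \<open>u\<close> is a potential of
  it, so the Hessian of \<open>u\<close> vanishes. For a map \<open>\<psi>\<close> into the wave, the Gauss formula turns the
  Hessian of \<open>u \<circ> \<psi>\<close> for the induced metric into \<open>du(II)\<close>, and the Laplacian into a multiple of
  \<open>du(H)\<close>: on an extremal submanifold \<open>u \<circ> \<psi>\<close> is harmonic. Being bounded from one side it is constant
  when the submanifold is parabolic. Once \<open>u\<close> is constant along \<open>\<psi>\<close>, the tangent vectors have no
  \<open>\<partial>\<^sub>u\<close>-component, and the Hessian of \<open>v\<close> vanishes on such vectors; the same argument makes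
  \<open>v \<circ> \<psi>\<close> constant. Hence \<open>\<psi> = (u\<^sub>0, v\<^sub>0, \<phi>)\<close> (\<open>contained_in_wavefront\<close>), and \<open>\<phi>\<close> is a local isometry
  into \<open>M\<close>, because the metric of the wave restricts to that of \<open>M\<close> on a wavefront.

  It remains to see that a local isometry \<open>\<phi>\<close> from a complete manifold to a connected one is onto, and
  that parabolicity passes to its target (\<open>parabolic_target\<close>). Both follow from one lifting property
  (\<open>curve_lift\<close>): a curve of length \<open>L\<close> that starts at \<open>\<phi> p\<close> ends at a point with a preimage at
  distance at most \<open>L\<close> from \<open>p\<close>. The end point of the lift is constructed directly, by a maximality
  argument in which completeness provides the limit points and the inverse function theorem the next
  step. The property gives surjectivity as any two points of a connected manifold are joined by a curve,
  and it gives completeness of the target because it lifts a Cauchy sequence, up to a subsequence, to a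
  Cauchy sequence. Superharmonic functions on the target pull back to superharmonic ones, as isometric
  maps between manifolds of the same dimension are totally geodesic.

  Conversely, the inclusion of a wavefront is totally geodesic, because in the charts of the wave its
  second fundamental form is that of a transition map of \<open>M\<close>, which is isometric.

  The length distance of a Riemannian manifold is shown to be a metric (\<open>Metric_space\<close>) on the way,
  since the completeness of a manifold speaks about this metric.
\<close>

section \<open>Calculus of differentiable maps\<close>

abbreviation fd :: "('a::real_normed_vector \<Rightarrow> 'b::real_normed_vector) \<Rightarrow> 'a \<Rightarrow> 'a \<Rightarrow> 'b" where
  "fd F x \<equiv> frechet_derivative F (at x)"

lemma fd_cong_open:
  assumes "open S" "x \<in> S" "\<And>y. y \<in> S \<Longrightarrow> f y = g y"
  shows "fd f x = fd g x"
proof -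
  have "(f has_derivative F) (at x) \<longleftrightarrow> (g has_derivative F) (at x)" for F
    using assms has_derivative_transform_within_open[of f F x UNIV S g]
      has_derivative_transform_within_open[of g F x UNIV S f] by auto
  then show ?thesis by (simp add: frechet_derivative_def)
qed

lemma fd_works: "f differentiable (at x) \<Longrightarrow> (f has_derivative fd f x) (at x)"
  by (simp add: frechet_derivative_works)

lemma fd_eqI: "(f has_derivative F) (at x) \<Longrightarrow> fd f x = F"
  by (rule frechet_derivative_at[symmetric])

lemma differentiable_cong_open:
  assumes "open S" "x \<in> S" "\<And>y. y \<in> S \<Longrightarrow> f y = g y" "f differentiable (at x)"
  shows "g differentiable (at x)"
  using assms has_derivative_transform_within_open[of f _ x UNIV S g]
  unfolding differentiable_def by auto

lemma Ck_on_cong: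
  assumes "open S" "\<And>y. y \<in> S \<Longrightarrow> f y = g y" "Ck_on k S f"
  shows "Ck_on k S g"
  using assms(2,3)
proof (induction k arbitrary: f g)
  case 0
  then show ?case by (simp cong: continuous_on_cong)
next
  case (Suc k)
  have "g differentiable (at x)" if "x \<in> S" for x
    using Suc.prems differentiable_cong_open[OF assms(1) that, of f g] that by auto
  moreover have "Ck_on k S (\<lambda>x. fd g x v)" for v
    by (rule Suc.IH[of "\<lambda>x. fd f x v"])
      (use Suc.prems fd_cong_open[OF assms(1), of _ f g] in auto)
  ultimately show ?case by simp
qed

lemma Ck_on_subset: "Ck_on k S f \<Longrightarrow> T \<subseteq> S \<Longrightarrow> Ck_on k T f"
proof (induction k arbitrary: f)
  case 0 then show ?case using continuous_on_subset by auto
qed auto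

lemma Ck_on_local:
  assumes "\<And>x. x \<in> S \<Longrightarrow> \<exists>U. open U \<and> x \<in> U \<and> Ck_on k U f"
  shows "Ck_on k S f"
  using assms
proof (induction k arbitrary: f)
  case 0
  have "continuous (at x) f" if "x \<in> S" for x
    using 0[OF that] by (auto simp: continuous_on_eq_continuous_at)
  then show ?case by (simp add: continuous_at_imp_continuous_on)
next
  case (Suc k)
  then show ?case by (simp; meson)
qed

lemma Ck_on_SucD: "Ck_on (Suc k) S f \<Longrightarrow> Ck_on k S f"
proof (induction k arbitrary: f)
  case 0
  then show ?case
    by (auto intro!: continuous_at_imp_continuous_on dest: differentiable_imp_continuous_within)
next
  case (Suc k)
  from Suc.prems have "Ck_on k S (\<lambda>x. fd f x v)" for v
    by (intro Suc.IH) simp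
  with Suc.prems show ?case by simp
qed

lemma Ck_on_const: "Ck_on k S (\<lambda>_. c)"
  by (induction k arbitrary: c) auto

lemma Ck_on_linear_compose:
  assumes "open S" "bounded_linear l" "Ck_on k S f"
  shows "Ck_on k S (\<lambda>x. l (f x))"
  using assms(3)
proof (induction k arbitrary: f)
  case 0
  then show ?case using assms(2) by (auto intro: linear_continuous_on_compose bounded_linear.continuous_on)
next
  case (Suc k)
  have d: "((\<lambda>x. l (f x)) has_derivative (\<lambda>v. l (fd f x v))) (at x)" if "x \<in> S" for x
    using Suc.prems that by (intro bounded_linear.has_derivative[OF assms(2)] fd_works) auto
  have "Ck_on k S (\<lambda>x. fd (\<lambda>x. l (f x)) x v)" for v
    by (rule Ck_on_cong[OF assms(1) _ Suc.IH[of "\<lambda>x. fd f x v"]])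
      (use Suc.prems fd_eqI[OF d] in auto)
  with d show ?case by (auto simp: differentiable_def)
qed

lemma Ck_on_add:
  assumes "open S" "Ck_on k S f" "Ck_on k S g"
  shows "Ck_on k S (\<lambda>x. f x + g x)"
  using assms(2,3)
proof (induction k arbitrary: f g)
  case 0
  then show ?case by (auto intro: continuous_intros)
next
  case (Suc k)
  have d: "((\<lambda>x. f x + g x) has_derivative (\<lambda>v. fd f x v + fd g x v)) (at x)" if "x \<in> S" for x
    using Suc.prems that by (intro has_derivative_add fd_works) auto
  have "Ck_on k S (\<lambda>x. fd (\<lambda>x. f x + g x) x v)" for v
    by (rule Ck_on_cong[OF assms(1) _ Suc.IH[of "\<lambda>x. fd f x v" "\<lambda>x. fd g x v"]])
      (use Suc.prems fd_eqI[OF d] in auto)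
  with d show ?case by (auto simp: differentiable_def)
qed

lemma Ck_on_sum:
  assumes "open S" "finite I" "\<And>i. i \<in> I \<Longrightarrow> Ck_on k S (f i)"
  shows "Ck_on k S (\<lambda>x. \<Sum>i\<in>I. f i x)"
  using assms(2,3)
  by (induction I rule: finite_induct) (auto intro: Ck_on_const Ck_on_add[OF assms(1)])

lemma Ck_on_scaleR:
  assumes "open S" "Ck_on k S f" "Ck_on k S g"
  shows "Ck_on k S (\<lambda>x. f x *\<^sub>R g x)"
  using assms(2,3)
proof (induction k arbitrary: f g)
  case 0
  then show ?case by (auto intro: continuous_intros)
next
  case (Suc k)
  have d: "((\<lambda>x. f x *\<^sub>R g x) has_derivative (\<lambda>v. f x *\<^sub>R fd g x v + fd f x v *\<^sub>R g x)) (at x)"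
    if "x \<in> S" for x
    using Suc.prems that by (intro has_derivative_scaleR fd_works) auto
  have "Ck_on k S (\<lambda>x. fd (\<lambda>x. f x *\<^sub>R g x) x v)" for v
    by (rule Ck_on_cong[OF assms(1) _ Ck_on_add[OF assms(1)
        Suc.IH[of f "\<lambda>x. fd g x v"] Suc.IH[of "\<lambda>x. fd f x v" g]]])
      (use Suc.prems fd_eqI[OF d] Ck_on_SucD in auto)
  with d show ?case by (auto simp: differentiable_def)
qed

lemma linear_fd: "f differentiable (at x) \<Longrightarrow> linear (fd f x)"
  by (rule linear_frechet_derivative)

lemma linear_expand:
  fixes L :: "'a::euclidean_space \<Rightarrow> 'b::real_vector"
  assumes "linear L"
  shows "L v = (\<Sum>e\<in>Basis. (v \<bullet> e) *\<^sub>R L e)"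
proof -
  have "L v = L (\<Sum>e\<in>Basis. (v \<bullet> e) *\<^sub>R e)" by (simp add: euclidean_representation)
  then show ?thesis using assms by (simp add: linear_sum linear_cmul)
qed

text \<open>
  The derivative of \<open>g \<circ> f\<close> in the direction \<open>v\<close> is a sum, over the basis, of products of a component
  of the derivative of \<open>f\<close> with a directional derivative of \<open>g\<close> along \<open>f\<close>. Both factors have one degree
  of smoothness less, which is what the induction needs.
\<close>

lemma Ck_on_compose:
  fixes f :: "'a::euclidean_space \<Rightarrow> 'b::euclidean_space" and g :: "'b \<Rightarrow> 'c::real_normed_vector"
  assumes "open S" "open T" "f ` S \<subseteq> T" "Ck_on k S f" "Ck_on k T g"
  shows "Ck_on k S (\<lambda>x. g (f x))"
  using assms(4,5)
proof (induction k arbitrary: g)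
  case 0
  then show ?case using assms(3) by (auto intro: continuous_on_compose2)
next
  case (Suc k)
  have d: "((\<lambda>x. g (f x)) has_derivative (\<lambda>v. fd g (f x) (fd f x v))) (at x)" if "x \<in> S" for x
    using Suc.prems that assms(3) by (intro has_derivative_compose[of f _ x UNIV g] fd_works) auto
  have "Ck_on k S (\<lambda>x. fd (\<lambda>x. g (f x)) x v)" for v
  proof (rule Ck_on_cong[OF assms(1)])
    show "Ck_on k S (\<lambda>x. \<Sum>e\<in>Basis. (fd f x v \<bullet> e) *\<^sub>R fd g (f x) e)"
      using Suc Ck_on_SucD[OF Suc.prems(1)]
      by (intro Ck_on_sum Ck_on_scaleR Ck_on_linear_compose[where l="\<lambda>x. x \<bullet> _"] assms(1)
          bounded_linear_inner_left Suc.IH) auto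
    show "(\<Sum>e\<in>Basis. (fd f x v \<bullet> e) *\<^sub>R fd g (f x) e) = fd (\<lambda>x. g (f x)) x v" if "x \<in> S" for x
      using Suc.prems that assms(3) linear_expand[OF linear_fd, of g "f x" "fd f x v"]
      by (auto simp: fd_eqI[OF d[OF that]] image_subset_iff)
  qed
  with d show ?case by (auto simp: differentiable_def)
qed

lemma continuous_on_fd_apply:
  fixes f :: "'a::euclidean_space \<Rightarrow> 'b::real_normed_vector"
  assumes C: "Ck_on (Suc 0) S f" "continuous_on T c" "continuous_on T w" "c ` T \<subseteq> S"
  shows "continuous_on T (\<lambda>t. fd f (c t) (w t))"
proof -
  have "fd f (c t) (w t) = (\<Sum>e\<in>Basis. (w t \<bullet> e) *\<^sub>R fd f (c t) e)" if "t \<in> T" for t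
    using C that linear_expand[OF linear_fd, of f "c t" "w t"] by auto
  moreover have "continuous_on T (\<lambda>t. \<Sum>e\<in>Basis. (w t \<bullet> e) *\<^sub>R fd f (c t) e)"
  proof (intro continuous_on_sum continuous_on_scaleR continuous_on_inner continuous_on_const C)
    show "continuous_on T (\<lambda>t. fd f (c t) e)" for e
      using C by (intro continuous_on_compose2[of S "\<lambda>y. fd f y e" T c]) auto
  qed
  ultimately show ?thesis by (metis (no_types, lifting) continuous_on_cong)
qed

text \<open>
  How the independence of the metric of a coordinate enters the computation of Christoffel symbols.
\<close>

lemma fd_zero_direction:
  fixes f :: "'a::real_normed_vector \<Rightarrow> real"
  assumes "f differentiable (at p)" "\<And>t. f (p + t *\<^sub>R z) = f p"
  shows "fd f p z = 0"
proof -
  have "((\<lambda>t. p + t *\<^sub>R z) has_derivative (\<lambda>h. h *\<^sub>R z)) (at (0::real))"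
    by (auto intro!: derivative_eq_intros)
  from has_derivative_compose[OF this, of f "fd f p"] fd_works[OF assms(1)]
  have "((\<lambda>t. f (p + t *\<^sub>R z)) has_derivative (\<lambda>h. fd f p (h *\<^sub>R z))) (at 0)" by simp
  moreover have "((\<lambda>t::real. f (p + t *\<^sub>R z)) has_derivative (\<lambda>h. 0)) (at 0)"
    by (simp add: assms(2))
  ultimately have "(\<lambda>h. fd f p (h *\<^sub>R z)) = (\<lambda>h. 0)" by (rule has_derivative_unique)
  from fun_cong[OF this, of 1] show ?thesis by simp
qed

text \<open>
  Schwarz's theorem: the mean value theorem, applied once in each direction, writes the second
  difference as \<open>t\<^sup>2\<close> times an iterated derivative at a point close to \<open>x\<close>. The quotient is
  symmetric in \<open>v\<close> and \<open>w\<close>, so its limit is symmetric as well.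
\<close>

lemma second_difference_limit:
  fixes f :: "'a::euclidean_space \<Rightarrow> real"
  assumes S: "open S" "x \<in> S" and C: "Ck_on (Suc (Suc 0)) S f"
  shows "((\<lambda>t. (f (x + t *\<^sub>R v + t *\<^sub>R w) - f (x + t *\<^sub>R v) - f (x + t *\<^sub>R w) + f x) / t\<^sup>2)
           \<longlongrightarrow> fd (\<lambda>y. fd f y v) x w) (at_right 0)"
proof -
  let ?h = "\<lambda>y. fd (\<lambda>y. fd f y v) y w"
  define Q where "Q t = (f (x + t *\<^sub>R v + t *\<^sub>R w) - f (x + t *\<^sub>R v) - f (x + t *\<^sub>R w) + f x) / t\<^sup>2" for t
  have cont: "continuous_on S ?h" using C by simp
  obtain r where r: "r > 0" "ball x r \<subseteq> S" using S open_contains_ball by blast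
  define N where "N = norm v + norm w + 1"
  have N: "N > 0" unfolding N_def by (simp add: add_nonneg_pos)
  have in_ball: "x + a *\<^sub>R v + b *\<^sub>R w \<in> ball x (t * N)" if "0 \<le> a" "a \<le> t" "0 \<le> b" "b \<le> t" "t > 0" for a b t
  proof -
    have "norm (a *\<^sub>R v + b *\<^sub>R w) \<le> norm (a *\<^sub>R v) + norm (b *\<^sub>R w)" by (rule norm_triangle_ineq)
    also have "\<dots> \<le> t * norm v + t * norm w"
      using that by (intro add_mono) (auto intro: mult_right_mono)
    also have "\<dots> < t * N" using that by (simp add: N_def algebra_simps)
    finally have "norm (a *\<^sub>R v + b *\<^sub>R w) < t * N" .
    moreover have "dist x (x + a *\<^sub>R v + b *\<^sub>R w) = norm (a *\<^sub>R v + b *\<^sub>R w)"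
      by (metis add.assoc add_diff_cancel_left' dist_commute dist_norm)
    ultimately show ?thesis by simp
  qed
  have key: "\<exists>y\<in>ball x (t * N). Q t = ?h y" if t: "t > 0" "t * N < r" for t
  proof -
    have inS: "x + a *\<^sub>R v + b *\<^sub>R w \<in> S" if "0 \<le> a" "a \<le> t" "0 \<le> b" "b \<le> t" for a b
      using in_ball[OF that t(1)] r t by auto
    have inS': "x + a *\<^sub>R v \<in> S" if "0 \<le> a" "a \<le> t" for a
      using inS[OF that, of 0] t by auto
    have df: "(f has_derivative fd f y) (at y)" if "y \<in> S" for y
      using C that by (auto intro: fd_works)
    have ddf: "((\<lambda>y. fd f y v) has_derivative fd (\<lambda>y. fd f y v) y) (at y)" if "y \<in> S" for y
      using C that by (auto intro: fd_works)
    have line1: "((\<lambda>s. x + s *\<^sub>R v + t *\<^sub>R w) has_derivative (\<lambda>h. h *\<^sub>R v)) (at s)" for s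
      by (auto intro!: derivative_eq_intros)
    have line2: "((\<lambda>s. x + s *\<^sub>R v) has_derivative (\<lambda>h. h *\<^sub>R v)) (at s)" for s
      by (auto intro!: derivative_eq_intros)
    have line3: "((\<lambda>b. x + s *\<^sub>R v + b *\<^sub>R w) has_derivative (\<lambda>h. h *\<^sub>R w)) (at b)" for s b
      by (auto intro!: derivative_eq_intros)
    let ?G = "\<lambda>s. f (x + s *\<^sub>R v + t *\<^sub>R w) - f (x + s *\<^sub>R v)"
    have "\<exists>s. 0 < s \<and> s < t \<and> ?G t - ?G 0 = (t - 0) * (fd f (x + s *\<^sub>R v + t *\<^sub>R w) v - fd f (x + s *\<^sub>R v) v)"
    proof (rule MVT2[OF t(1)])
      fix s assume s: "0 \<le> s" "s \<le> t"
      have 1: "((\<lambda>s. f (x + s *\<^sub>R v + t *\<^sub>R w)) has_derivative (\<lambda>h. fd f (x + s *\<^sub>R v + t *\<^sub>R w) (h *\<^sub>R v))) (at s)"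
        by (rule has_derivative_compose[OF line1 df[OF inS]]) (use s t in auto)
      have 2: "((\<lambda>s. f (x + s *\<^sub>R v)) has_derivative (\<lambda>h. fd f (x + s *\<^sub>R v) (h *\<^sub>R v))) (at s)"
        by (rule has_derivative_compose[OF line2 df[OF inS']]) (use s t in auto)
      have l: "linear (fd f (x + s *\<^sub>R v + t *\<^sub>R w))" "linear (fd f (x + s *\<^sub>R v))"
        using df[OF inS[of s t]] df[OF inS'[of s]] s t by (auto dest: has_derivative_linear)
      show "(?G has_real_derivative fd f (x + s *\<^sub>R v + t *\<^sub>R w) v - fd f (x + s *\<^sub>R v) v) (at s)"
        unfolding has_field_derivative_def
      proof (rule has_derivative_eq_rhs[OF has_derivative_diff[OF 1 2]])
        show "(\<lambda>h. fd f (x + s *\<^sub>R v + t *\<^sub>R w) (h *\<^sub>R v) - fd f (x + s *\<^sub>R v) (h *\<^sub>R v)) =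
            (*) (fd f (x + s *\<^sub>R v + t *\<^sub>R w) v - fd f (x + s *\<^sub>R v) v)"
          unfolding linear_cmul[OF l(1)] linear_cmul[OF l(2)]
          by (simp add: fun_eq_iff mult.commute right_diff_distrib)
      qed
    qed
    then obtain s where s: "0 < s" "s < t"
      "?G t - ?G 0 = t * (fd f (x + s *\<^sub>R v + t *\<^sub>R w) v - fd f (x + s *\<^sub>R v) v)" by auto
    have "\<exists>b. 0 < b \<and> b < t \<and> fd f (x + s *\<^sub>R v + t *\<^sub>R w) v - fd f (x + s *\<^sub>R v + 0 *\<^sub>R w) v
        = (t - 0) * ?h (x + s *\<^sub>R v + b *\<^sub>R w)"
    proof (rule MVT2[OF t(1)])
      fix b assume b: "0 \<le> b" "b \<le> t"
      have 1: "((\<lambda>b. fd f (x + s *\<^sub>R v + b *\<^sub>R w) v) has_derivative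
          (\<lambda>k. fd (\<lambda>y. fd f y v) (x + s *\<^sub>R v + b *\<^sub>R w) (k *\<^sub>R w))) (at b)"
        by (rule has_derivative_compose[OF line3 ddf[OF inS]]) (use s b in auto)
      have l: "linear (fd (\<lambda>y. fd f y v) (x + s *\<^sub>R v + b *\<^sub>R w))"
        using ddf[OF inS[of s b]] s b by (auto dest: has_derivative_linear)
      show "((\<lambda>b. fd f (x + s *\<^sub>R v + b *\<^sub>R w) v) has_real_derivative ?h (x + s *\<^sub>R v + b *\<^sub>R w)) (at b)"
        unfolding has_field_derivative_def using 1
        by (simp add: linear_cmul[OF l] mult_commute_abs)
    qed
    then obtain b where b: "0 < b" "b < t"
      "fd f (x + s *\<^sub>R v + t *\<^sub>R w) v - fd f (x + s *\<^sub>R v) v = t * ?h (x + s *\<^sub>R v + b *\<^sub>R w)" by auto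
    have "Q t = ?h (x + s *\<^sub>R v + b *\<^sub>R w)"
      using s(3) b(3) t(1) by (simp add: Q_def power2_eq_square field_simps)
    then show ?thesis using in_ball[of s t b] s b t by auto
  qed
  have "(Q \<longlongrightarrow> ?h x) (at_right 0)"
    unfolding tendsto_iff
  proof (intro allI impI)
    fix e :: real assume e: "e > 0"
    have "isCont ?h x" using cont S by (simp add: continuous_on_eq_continuous_at)
    then obtain d where d: "d > 0" "\<And>y. dist y x < d \<Longrightarrow> dist (?h y) (?h x) < e"
      using e unfolding continuous_at_eps_delta by blast
    define T where "T = min d r / N"
    have T: "T > 0" using N d r by (simp add: T_def)
    have "dist (Q t) (?h x) < e" if "0 < t" "t < T" for t
    proof -
      have tN: "t * N < min d r" using that N by (simp add: T_def pos_less_divide_eq)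
      have "t * N < r" using tN by simp
      from key[OF that(1) this] obtain y where "y \<in> ball x (t * N)" "Q t = ?h y" by blast
      then show ?thesis using d(2)[of y] tN by (simp add: dist_commute)
    qed
    then show "\<forall>\<^sub>F t in at_right 0. dist (Q t) (?h x) < e"
      unfolding eventually_at_right_field using T by blast
  qed
  then show ?thesis unfolding Q_def .
qed

lemma fd_inner:
  assumes "f differentiable (at x)"
  shows "fd (\<lambda>y. f y \<bullet> e) x v = fd f x v \<bullet> e"
  using fd_eqI[OF has_derivative_inner_left[OF fd_works[OF assms]]] by metis

theorem second_derivative_symmetric:
  fixes f :: "'a::euclidean_space \<Rightarrow> 'b::euclidean_space"
  assumes S: "open S" "x \<in> S" and C: "Ck_on (Suc (Suc 0)) S f"
  shows "fd (\<lambda>y. fd f y v) x w = fd (\<lambda>y. fd f y w) x v"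
proof (rule euclidean_eqI)
  fix e :: 'b assume "e \<in> Basis"
  have Ce: "Ck_on (Suc (Suc 0)) S (\<lambda>y. f y \<bullet> e)"
    by (rule Ck_on_linear_compose[OF S(1) bounded_linear_inner_left C])
  have *: "fd (\<lambda>y. fd (\<lambda>y. f y \<bullet> e) y v) x w = fd (\<lambda>y. fd f y v) x w \<bullet> e" for v w
  proof -
    have "fd (\<lambda>y. fd (\<lambda>y. f y \<bullet> e) y v) x = fd (\<lambda>y. fd f y v \<bullet> e) x"
      by (rule fd_cong_open[OF S]) (use C in \<open>auto simp: fd_inner\<close>)
    then show ?thesis using C S fd_inner[of "\<lambda>y. fd f y v" x] by simp
  qed
  let ?Q = "\<lambda>v w t. (f (x + t *\<^sub>R v + t *\<^sub>R w) \<bullet> e - f (x + t *\<^sub>R v) \<bullet> e - f (x + t *\<^sub>R w) \<bullet> e + f x \<bullet> e) / t\<^sup>2"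
  have "?Q v w = ?Q w v" by (auto simp: add.assoc add.commute[of "_ *\<^sub>R v"])
  then have lim: "(?Q v w \<longlongrightarrow> fd (\<lambda>y. fd (\<lambda>y. f y \<bullet> e) y w) x v) (at_right 0)"
    using second_difference_limit[OF S Ce, of w v] by simp
  have "fd (\<lambda>y. fd (\<lambda>y. f y \<bullet> e) y v) x w = fd (\<lambda>y. fd (\<lambda>y. f y \<bullet> e) y w) x v"
    by (rule tendsto_unique[OF _ second_difference_limit[OF S Ce] lim]) simp
  then show "fd (\<lambda>y. fd f y v) x w \<bullet> e = fd (\<lambda>y. fd f y w) x v \<bullet> e" unfolding * .
qed

section \<open>Linear systems with parameters\<close>

text \<open>
  By Cramer's rule the solution of a linear system is a rational function of its entries, and so it
  depends on a parameter as regularly as they do. This makes gradients differentiable and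
  derivatives of local inverses continuous.
\<close>

lemma cramer_solution:
  fixes L :: "real ^ 'n \<Rightarrow> real ^ 'n"
  assumes "linear L" "inj L" "L s = b"
  shows "det (\<chi> i j. L (axis j 1) $ i) \<noteq> 0"
    and "s = (\<chi> k. det (\<chi> i j. if j = k then b $ i else L (axis j 1) $ i) / det (\<chi> i j. L (axis j 1) $ i))"
proof -
  have M: "matrix L = (\<chi> i j. L (axis j 1) $ i)" by (simp add: matrix_def)
  have "det (matrix L) \<noteq> 0" using assms by (simp add: det_nz_iff_inj)
  then show "det (\<chi> i j. L (axis j 1) $ i) \<noteq> 0" unfolding M .
  have "matrix L *v s = b" using assms by (simp add: matrix_works)
  then show "s = (\<chi> k. det (\<chi> i j. if j = k then b $ i else L (axis j 1) $ i) / det (\<chi> i j. L (axis j 1) $ i))"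
    using cramer[of "matrix L" s b] \<open>det (matrix L) \<noteq> 0\<close>
    by (simp add: M cong: if_cong)
qed

lemma continuous_on_det:
  fixes A :: "'a::topological_space \<Rightarrow> 'n::finite \<Rightarrow> 'n \<Rightarrow> real"
  assumes "\<And>i j. continuous_on S (\<lambda>y. A y i j)"
  shows "continuous_on S (\<lambda>y. det (\<chi> i j. A y i j))"
  unfolding det_def by (auto intro!: continuous_intros assms)

lemma linear_system_solution_continuous:
  fixes L :: "'x::topological_space \<Rightarrow> real ^ 'n \<Rightarrow> real ^ 'n"
  assumes L: "\<And>y. y \<in> S \<Longrightarrow> linear (L y)" "\<And>y. y \<in> S \<Longrightarrow> inj (L y)"
    and sol: "\<And>y. y \<in> S \<Longrightarrow> L y (s y) = b y"
    and cL: "\<And>v. continuous_on S (\<lambda>y. L y v)" and cb: "continuous_on S b"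
  shows "continuous_on S s"
proof -
  let ?c = "\<lambda>k y. det (\<chi> i j. if j = k then b y $ i else L y (axis j 1) $ i) / det (\<chi> i j. L y (axis j 1) $ i)"
  have cL': "continuous_on S (\<lambda>y. L y v $ i)" for v i by (intro continuous_intros cL)
  have cb': "continuous_on S (\<lambda>y. b y $ i)" for i by (intro continuous_intros cb)
  have c: "continuous_on S (?c k)" for k
  proof (rule continuous_on_divide[OF continuous_on_det continuous_on_det])
    show "continuous_on S (\<lambda>y. if j = k then b y $ i else L y (axis j 1) $ i)" for i j
      using cL' cb' by (cases "j = k") auto
    show "\<forall>y\<in>S. det (\<chi> i j. L y (axis j 1) $ i) \<noteq> 0"
      using cramer_solution(1)[OF L sol] by blast
  qed (rule cL')
  have "s y = (\<chi> k. ?c k y)" if "y \<in> S" for y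
    by (rule cramer_solution(2)[OF L[OF that] sol[OF that]])
  moreover have "continuous_on S (\<lambda>y. \<chi> k. ?c k y)" by (intro continuous_on_vec_lambda c)
  ultimately show ?thesis by (metis (no_types, lifting) continuous_on_cong)
qed

lemma differentiable_det:
  fixes A :: "'a::real_normed_vector \<Rightarrow> 'n::finite \<Rightarrow> 'n \<Rightarrow> real"
  assumes "\<And>i j. (\<lambda>y. A y i j) differentiable (at x)"
  shows "(\<lambda>y. det (\<chi> i j. A y i j)) differentiable (at x)"
proof -
  have "(\<lambda>y. \<Prod>i\<in>I. A y i (p i)) differentiable (at x)" if "finite I" for I p
    using that by induction (auto intro: assms differentiable_mult)
  then show ?thesis unfolding det_def
    by (auto intro!: differentiable_sum differentiable_mult)
qed

lemma linear_system_solution_differentiable: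
  fixes L :: "'x::real_normed_vector \<Rightarrow> real ^ 'n \<Rightarrow> real ^ 'n"
  assumes S: "open S" "x \<in> S" and L: "\<And>y. y \<in> S \<Longrightarrow> linear (L y)" "\<And>y. y \<in> S \<Longrightarrow> inj (L y)"
    and sol: "\<And>y. y \<in> S \<Longrightarrow> L y (s y) = b y"
    and dL: "\<And>i j. (\<lambda>y. L y (axis j 1) $ i) differentiable (at x)"
    and db: "\<And>i. (\<lambda>y. b y $ i) differentiable (at x)"
  shows "s differentiable (at x)"
proof -
  let ?c = "\<lambda>k y. det (\<chi> i j. if j = k then b y $ i else L y (axis j 1) $ i) / det (\<chi> i j. L y (axis j 1) $ i)"
  have d: "(?c k) differentiable (at x)" for k
  proof (rule differentiable_divide[OF differentiable_det differentiable_det])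
    show "(\<lambda>y. if j = k then b y $ i else L y (axis j 1) $ i) differentiable at x" for i j
      using dL db by (cases "j = k") auto
    show "det (\<chi> i j. L x (axis j 1) $ i) \<noteq> 0"
      by (rule cramer_solution(1)[OF L[OF S(2)] sol[OF S(2)]])
  qed (rule dL)
  have "(\<lambda>y. \<Sum>k\<in>UNIV. ?c k y *\<^sub>R axis k 1) differentiable (at x)"
    by (intro differentiable_sum differentiable_scaleR d ballI) auto
  moreover have "(\<Sum>k\<in>UNIV. ?c k y *\<^sub>R axis k 1) = s y" if "y \<in> S" for y
    using cramer_solution(2)[OF L[OF that] sol[OF that]]
    by (simp add: vec_eq_iff axis_def if_distrib cong: if_cong)
  ultimately show ?thesis by (rule differentiable_cong_open[OF S, rotated 1])
qed

section \<open>Metrics, Hessians and Laplacians in a chart\<close>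

definition C1_metric_on :: "'e::euclidean_space set \<Rightarrow> 'e local_metric \<Rightarrow> bool" where
  "C1_metric_on S g \<longleftrightarrow> open S \<and>
     (\<forall>x\<in>S. bilinear (g x) \<and> (\<forall>v w. g x v w = g x w v) \<and> nondegenerate (g x)) \<and>
     (\<forall>v w. Ck_on (Suc 0) S (\<lambda>x. g x v w))"

lemma C1_metric_onD:
  assumes "C1_metric_on S g"
  shows "open S" "\<And>x. x \<in> S \<Longrightarrow> bilinear (g x)" "\<And>x v w. x \<in> S \<Longrightarrow> g x v w = g x w v"
    "\<And>x. x \<in> S \<Longrightarrow> nondegenerate (g x)" "\<And>x v w. x \<in> S \<Longrightarrow> (\<lambda>x. g x v w) differentiable (at x)"
  using assms by (auto simp: C1_metric_on_def)

lemma C1_metric_on_subset: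
  assumes "C1_metric_on S g" "open T" "T \<subseteq> S"
  shows "C1_metric_on T g"
proof -
  have "Ck_on (Suc 0) T (\<lambda>x. g x v w)" for v w
    by (rule Ck_on_subset[OF _ assms(3)]) (use assms(1) in \<open>simp add: C1_metric_on_def del: Ck_on.simps\<close>)
  then show ?thesis using assms by (auto simp: C1_metric_on_def simp del: Ck_on.simps)
qed

lemma bilinear_expand:
  fixes b :: "'a::euclidean_space \<Rightarrow> 'b::euclidean_space \<Rightarrow> real"
  assumes "bilinear b"
  shows "b v w = (\<Sum>e\<in>Basis. \<Sum>e'\<in>Basis. (v \<bullet> e) * (w \<bullet> e') * b e e')"
proof -
  have l: "linear (\<lambda>v. b v w)" "linear (b v)" for v w
    using assms by (auto simp: bilinear_def)
  have "b v w = (\<Sum>e\<in>Basis. (v \<bullet> e) * b e w)" using linear_expand[OF l(1), of v w] by simp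
  also have "\<dots> = (\<Sum>e\<in>Basis. (v \<bullet> e) * (\<Sum>e'\<in>Basis. (w \<bullet> e') * b e e'))"
    using linear_expand[OF l(2), of _ w] by simp
  finally show ?thesis by (simp add: sum_distrib_left mult.assoc)
qed

lemma nondegenerate_eqI:
  assumes "bilinear b" "nondegenerate b" "\<And>w. b u w = b u' w"
  shows "u = u'"
proof -
  have "b (u - u') w = 0" for w using assms by (simp add: bilinear_lsub)
  then show ?thesis using assms(2) unfolding nondegenerate_def by (metis right_minus_eq)
qed

text \<open>
  The product rule for a bilinear form that varies along \<open>F\<close>. The arguments may lie in different
  spaces: besides metrics, this covers \<open>y \<mapsto> Df(F y)(V y)\<close>, which is the case of a constant second
  argument in \<open>\<real>\<close>.
\<close>

lemma bilinear_derivative_along: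
  fixes g :: "'f::euclidean_space \<Rightarrow> 'a::euclidean_space \<Rightarrow> 'b::euclidean_space \<Rightarrow> real"
    and F :: "'e::real_normed_vector \<Rightarrow> 'f"
  assumes T: "open T" "F x \<in> T" and bil: "\<And>z. z \<in> T \<Longrightarrow> bilinear (g z)"
    and dg: "\<And>v w. (\<lambda>z. g z v w) differentiable (at (F x))"
    and dF: "F differentiable (at x)" and dV: "V differentiable (at x)" and dW: "W differentiable (at x)"
  shows "((\<lambda>y. g (F y) (V y) (W y)) has_derivative
    (\<lambda>h. fd (\<lambda>z. g z (V x) (W x)) (F x) (fd F x h) + g (F x) (fd V x h) (W x) + g (F x) (V x) (fd W x h)))
    (at x)"
proof -
  note hF = fd_works[OF dF] and hV = fd_works[OF dV] and hW = fd_works[OF dW]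
  have hg: "((\<lambda>z. g z v w) has_derivative fd (\<lambda>z. g z v w) (F x)) (at (F x))" for v w
    by (rule fd_works[OF dg])
  have hgF: "((\<lambda>y. g (F y) v w) has_derivative (\<lambda>h. fd (\<lambda>z. g z v w) (F x) (fd F x h))) (at x)" for v w
    by (rule has_derivative_compose[OF hF hg])
  let ?\<phi> = "\<lambda>y. \<Sum>e\<in>Basis. \<Sum>e'\<in>Basis. (V y \<bullet> e) * (W y \<bullet> e') * g (F y) e e'"
  have d: "(?\<phi> has_derivative (\<lambda>h. \<Sum>e\<in>Basis. \<Sum>e'\<in>Basis.
      (V x \<bullet> e) * (W x \<bullet> e') * fd (\<lambda>z. g z e e') (F x) (fd F x h) +
      ((V x \<bullet> e) * (fd W x h \<bullet> e') + (fd V x h \<bullet> e) * (W x \<bullet> e')) * g (F x) e e')) (at x)"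
    by (intro has_derivative_sum has_derivative_mult has_derivative_inner_left hV hW hgF)
  have D: "fd (\<lambda>z. g z v w) (F x) k = (\<Sum>e\<in>Basis. \<Sum>e'\<in>Basis. (v \<bullet> e) * (w \<bullet> e') * fd (\<lambda>z. g z e e') (F x) k)" for v w k
  proof -
    have "((\<lambda>z. \<Sum>e\<in>Basis. \<Sum>e'\<in>Basis. (v \<bullet> e) * (w \<bullet> e') * g z e e') has_derivative
        (\<lambda>k. \<Sum>e\<in>Basis. \<Sum>e'\<in>Basis. (v \<bullet> e) * (w \<bullet> e') * fd (\<lambda>z. g z e e') (F x) k)) (at (F x))"
      by (intro has_derivative_sum has_derivative_mult_right hg)
    moreover have "fd (\<lambda>z. g z v w) (F x) =
        fd (\<lambda>z. \<Sum>e\<in>Basis. \<Sum>e'\<in>Basis. (v \<bullet> e) * (w \<bullet> e') * g z e e') (F x)"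
      by (rule fd_cong_open[OF T]) (rule bilinear_expand[OF bil])
    ultimately show ?thesis by (simp add: fd_eqI)
  qed
  have eq: "(\<lambda>h. fd (\<lambda>z. g z (V x) (W x)) (F x) (fd F x h) + g (F x) (fd V x h) (W x) + g (F x) (V x) (fd W x h))
    = (\<lambda>h. \<Sum>e\<in>Basis. \<Sum>e'\<in>Basis.
      (V x \<bullet> e) * (W x \<bullet> e') * fd (\<lambda>z. g z e e') (F x) (fd F x h) +
      ((V x \<bullet> e) * (fd W x h \<bullet> e') + (fd V x h \<bullet> e) * (W x \<bullet> e')) * g (F x) e e')"
    unfolding D[of "V x" "W x"] bilinear_expand[OF bil[OF T(2)], of "V x"] bilinear_expand[OF bil[OF T(2)], of "fd V x _"]
    by (simp add: fun_eq_iff sum.distrib algebra_simps)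
  have ev: "\<forall>\<^sub>F y in nhds x. F y \<in> T"
    using topological_tendstoD[OF _ T, of F "nhds x"] differentiable_imp_continuous_within[OF dF]
    by (simp add: continuous_at tendsto_nhds_iff)
  have "\<forall>\<^sub>F y in at x. ?\<phi> y = g (F y) (V y) (W y)"
    using ev unfolding eventually_nhds_conv_at
    by (auto elim!: eventually_mono simp: bilinear_expand[OF bil, symmetric])
  with d show ?thesis unfolding eq
    by (rule has_derivative_transform_eventually) (simp_all add: T bilinear_expand[OF bil, symmetric])
qed

lemma christoffel_levi_civita:
  assumes "C1_metric_on S g" "x \<in> S"
  shows "is_levi_civita g x (christoffel g x)"
  unfolding christoffel_def
  by (rule theI'[OF levi_civita_ex1[of S x g]]) (use assms C1_metric_onD[OF assms(1)] in auto)

lemma christoffel_eqI: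
  assumes "C1_metric_on S g" "x \<in> S" "is_levi_civita g x \<Gamma>"
  shows "christoffel g x = \<Gamma>"
  unfolding christoffel_def
  by (rule the1_equality[OF levi_civita_ex1[of S x g]]) (use assms C1_metric_onD[OF assms(1)] in auto)

lemma christoffel_rules:
  assumes "C1_metric_on S g" "x \<in> S"
  shows "bilinear (christoffel g x)" "christoffel g x v w = christoffel g x w v"
    "fd (\<lambda>y. g y v w) x z = g x (christoffel g x z v) w + g x v (christoffel g x z w)"
  using christoffel_levi_civita[OF assms] unfolding is_levi_civita_def by blast+

lemma koszul_formula:
  assumes "C1_metric_on S g" "x \<in> S"
  shows "2 * g x (christoffel g x v w) z =
    fd (\<lambda>y. g y w z) x v + fd (\<lambda>y. g y v z) x w - fd (\<lambda>y. g y v w) x z"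
proof -
  note p = christoffel_rules[OF assms] and s = C1_metric_onD(3)[OF assms(1,2)]
  show ?thesis unfolding p(3)
    using p(2)[of v w] p(2)[of v z] p(2)[of w z] s[of w "christoffel g x v z"] s[of v "christoffel g x w z"]
      s[of v "christoffel g x z w"] by simp
qed

lemma metric_compatible_along:
  assumes g: "C1_metric_on T g" "F x \<in> T"
    and "F differentiable (at x)" "V differentiable (at x)" "W differentiable (at x)"
  shows "fd (\<lambda>y. g (F y) (V y) (W y)) x h =
    g (F x) (fd V x h + christoffel g (F x) (fd F x h) (V x)) (W x) +
    g (F x) (V x) (fd W x h + christoffel g (F x) (fd F x h) (W x))"
proof -
  note m = C1_metric_onD[OF g(1)] and b = C1_metric_onD(2)[OF g]
  have d: "((\<lambda>y. g (F y) (V y) (W y)) has_derivative (\<lambda>h. fd (\<lambda>z. g z (V x) (W x)) (F x) (fd F x h) +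
      g (F x) (fd V x h) (W x) + g (F x) (V x) (fd W x h))) (at x)"
    using m(1) g(2) m(2) m(5)[OF g(2)] assms(3-5) by (rule bilinear_derivative_along)
  show ?thesis
    unfolding fd_eqI[OF d] using b
    by (simp add: christoffel_rules(3)[OF g] bilinear_ladd bilinear_radd)
qed

lemma sharp_works:
  assumes "bilinear b" "nondegenerate b" "linear \<omega>"
  shows "b (sharp b \<omega>) w = \<omega> w"
  using theI'[OF sharp_ex1[OF assms]] unfolding sharp_def by blast

lemma sharp_eqI:
  assumes "bilinear b" "nondegenerate b" "linear \<omega>" "\<And>w. b v w = \<omega> w"
  shows "sharp b \<omega> = v"
  by (rule nondegenerate_eqI[OF assms(1,2)]) (simp add: sharp_works assms)

lemma linear_inner_left: "linear (\<lambda>w. w \<bullet> e)"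
  by (simp add: bounded_linear.linear bounded_linear_inner_left)

text \<open>
  The trace puts the dual of each basis vector first. The matrix \<open>b\<^sup>i\<^sup>j\<close> is symmetric, so
  the order is immaterial for every bilinear \<open>B\<close>.
\<close>

lemma metric_trace_swap:
  fixes b :: "'e::euclidean_space \<Rightarrow> 'e \<Rightarrow> real" and B :: "'e \<Rightarrow> 'e \<Rightarrow> 'f::real_vector"
  assumes b: "bilinear b" "nondegenerate b" "\<And>v w. b v w = b w v" and B: "bilinear B"
  shows "(\<Sum>e\<in>Basis. B e (sharp b (\<lambda>w. w \<bullet> e))) = metric_trace b B"
proof -
  let ?s = "\<lambda>e. sharp b (\<lambda>w. w \<bullet> e)"
  have l: "linear (\<lambda>v. B v w)" "linear (B v)" for v w using B by (auto simp: bilinear_def)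
  have c: "?s e \<bullet> f = b (?s e) (?s f)" for e f
    using sharp_works[OF b(1,2) linear_inner_left, of f "?s e"] b(3) by simp
  have "(\<Sum>e\<in>Basis. B e (?s e)) = (\<Sum>e\<in>Basis. \<Sum>f\<in>Basis. b (?s e) (?s f) *\<^sub>R B e f)"
    using linear_expand[OF l(2), of _ "?s _"] by (simp add: c)
  also have "\<dots> = (\<Sum>f\<in>Basis. \<Sum>e\<in>Basis. b (?s f) (?s e) *\<^sub>R B e f)"
    by (subst sum.swap) (simp add: b(3))
  also have "\<dots> = (\<Sum>f\<in>Basis. B (?s f) f)"
    using linear_expand[OF l(1), of "?s _"] by (simp add: c)
  finally show ?thesis by (simp add: metric_trace_def)
qed

text \<open>
  The images under \<open>L\<close> of a basis and of its \<open>h\<close>-dual basis are \<open>b\<close>-dual to each other, and the trace can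
  be computed from any pair of dual bases.
\<close>

lemma metric_trace_pullback:
  fixes L :: "'e::euclidean_space \<Rightarrow> 'e" and B :: "'e \<Rightarrow> 'e \<Rightarrow> 'f::real_vector"
  assumes b: "bilinear b" "nondegenerate b" and h: "bilinear h" "nondegenerate h"
    and L: "linear L" "surj L" and hb: "\<And>v w. h v w = b (L v) (L w)" and B: "bilinear B"
  shows "metric_trace h (\<lambda>v w. B (L v) (L w)) = metric_trace b B"
proof -
  define a where "a e = L (sharp h (\<lambda>w. w \<bullet> e))" for e
  have a: "b (a e) (L w) = w \<bullet> e" for e w
    unfolding a_def hb[symmetric] by (simp add: sharp_works[OF h linear_inner_left])
  have l: "linear (\<lambda>v. B v w)" "linear (B v)" for v w using B by (auto simp: bilinear_def)
  have s: "sharp b (\<lambda>w. w \<bullet> f) = (\<Sum>e\<in>Basis. (L e \<bullet> f) *\<^sub>R a e)" for f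
  proof (rule sharp_eqI[OF b linear_inner_left])
    fix w
    obtain w' where w: "w = L w'" using L(2) by (metis surjD)
    have lb: "linear (\<lambda>v. b v u)" for u using b by (auto simp: bilinear_def)
    have "w \<bullet> f = (\<Sum>e\<in>Basis. (w' \<bullet> e) *\<^sub>R L e) \<bullet> f"
      using linear_expand[OF L(1), of w'] w by simp
    then show "b (\<Sum>e\<in>Basis. (L e \<bullet> f) *\<^sub>R a e) w = w \<bullet> f"
      unfolding w by (simp add: linear_sum[OF lb] linear_cmul[OF lb] a inner_sum_left mult.commute)
  qed
  have "metric_trace h (\<lambda>v w. B (L v) (L w)) = (\<Sum>e\<in>Basis. B (a e) (L e))"
    by (simp add: metric_trace_def a_def)
  also have "\<dots> = (\<Sum>e\<in>Basis. \<Sum>f\<in>Basis. (L e \<bullet> f) *\<^sub>R B (a e) f)"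
    using linear_expand[OF l(2), of _ "L _"] by simp
  also have "\<dots> = (\<Sum>f\<in>Basis. B (\<Sum>e\<in>Basis. (L e \<bullet> f) *\<^sub>R a e) f)"
    by (subst sum.swap) (simp add: linear_sum[OF l(1)] linear_cmul[OF l(1)])
  finally show ?thesis by (simp add: metric_trace_def s)
qed

lemma laplacian_cong_open:
  assumes "open S" "x \<in> S" "\<And>y. y \<in> S \<Longrightarrow> f y = f' y"
  shows "laplacian g f x = laplacian g f' x"
proof -
  have "fd f y = fd f' y" if "y \<in> S" for y by (rule fd_cong_open[OF assms(1) that assms(3)])
  then have gr: "grad g f y = grad g f' y" if "y \<in> S" for y using that by (simp add: grad_def)
  show ?thesis
    by (simp add: laplacian_def divergence_def cov_def gr[OF assms(2)] fd_cong_open[OF assms(1,2) gr])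
qed

text \<open>
  The components of the gradient solve a linear system whose coefficients are those of the metric.
\<close>

lemma grad_differentiable:
  fixes g :: "(real ^ 'n) local_metric"
  assumes g: "C1_metric_on S g" and x: "x \<in> S" and f: "Ck_on (Suc (Suc 0)) S f"
  shows "grad g f differentiable (at x)"
proof (rule linear_system_solution_differentiable[OF C1_metric_onD(1)[OF g] x])
  let ?L = "\<lambda>y v. (\<chi> i. g y v (axis i 1)) :: real ^ 'n"
  fix y assume y: "y \<in> S"
  note m = C1_metric_onD[OF g] and b = C1_metric_onD(2)[OF g y]
  show l: "linear (?L y)"
    by (rule linearI) (simp_all add: vec_eq_iff bilinear_ladd[OF b] bilinear_lmul[OF b])
  show "inj (?L y)"
  proof (subst linear_injective_0[OF l], intro allI impI)
    fix v assume "?L y v = 0"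
    then have z: "g y v (axis i 1) = 0" for i by (simp add: vec_eq_iff)
    have lin: "linear (g y v)" using b by (auto simp: bilinear_def)
    have "g y v w = 0" for w
      using linear_expand[OF lin, of w] z by (auto simp: Basis_vec_def intro!: sum.neutral)
    then show "v = 0" using m(4)[OF y] by (auto simp: nondegenerate_def)
  qed
  have "linear (fd f y)" using f y by (auto intro: linear_fd)
  then show "?L y (grad g f y) = (\<chi> i. fd f y (axis i 1))"
    by (simp add: grad_def sharp_works[OF b m(4)[OF y]])
next
  fix i j
  show "(\<lambda>y. (\<chi> i. g y (axis j 1) (axis i 1)) $ i) differentiable at x"
    using C1_metric_onD(5)[OF g x] by simp
  show "(\<lambda>y. (\<chi> i. fd f y (axis i 1)) $ i) differentiable at x"
    using f x by simp
qed

definition hess :: "'e::euclidean_space local_metric \<Rightarrow> ('e \<Rightarrow> real) \<Rightarrow> 'e \<Rightarrow> 'e \<Rightarrow> 'e \<Rightarrow> real" where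
  "hess g f x v w = fd (\<lambda>y. fd f y w) x v - fd f x (christoffel g x v w)"

text \<open>
  Differentiate \<open>g(grad f, w) = Df(w)\<close> with the compatibility of the connection and the metric.
\<close>

lemma hess_eq_cov_grad:
  fixes g :: "(real ^ 'n) local_metric"
  assumes g: "C1_metric_on S g" and x: "x \<in> S" and f: "Ck_on (Suc (Suc 0)) S f"
  shows "g x (cov g (\<lambda>_. z) (grad g f) x) w = hess g f x z w"
proof -
  note m = C1_metric_onD[OF g]
  have gr: "g y (grad g f y) w = fd f y w" if y: "y \<in> S" for y w
  proof -
    have "linear (fd f y)" using f y by (auto intro: linear_fd)
    then show ?thesis by (simp add: grad_def sharp_works[OF m(2,4)[OF y]])
  qed
  have "fd (\<lambda>y. fd f y w) x z = fd (\<lambda>y. g y (grad g f y) w) x z"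
    by (rule fun_cong[OF fd_cong_open[OF m(1) x]]) (simp add: gr)
  also have "\<dots> = g x (cov g (\<lambda>_. z) (grad g f) x) w + g x (grad g f x) (christoffel g x z w)"
    using metric_compatible_along[OF g, of "\<lambda>y. y" x "grad g f" "\<lambda>_. w" z] x grad_differentiable[OF assms]
    by (simp add: cov_def)
  finally show ?thesis by (simp add: hess_def gr[OF x])
qed

lemma bilinear_hess:
  fixes g :: "(real ^ 'n) local_metric"
  assumes g: "C1_metric_on S g" and x: "x \<in> S" and f: "Ck_on (Suc (Suc 0)) S f"
  shows "bilinear (hess g f x)"
proof -
  note b = C1_metric_onD(2)[OF g x] and c = christoffel_rules(1)[OF g x]
  have l: "linear (fd (grad g f) x)" by (rule linear_fd[OF grad_differentiable[OF assms]])
  show ?thesis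
    unfolding bilinear_def hess_eq_cov_grad[OF assms, symmetric]
    by (intro conjI allI linearI)
      (simp_all add: hess_eq_cov_grad[OF assms, symmetric] cov_def bilinear_ladd[OF b] bilinear_radd[OF b] bilinear_lmul[OF b] bilinear_rmul[OF b]
        bilinear_ladd[OF c] bilinear_lmul[OF c] linear_add[OF l] linear_cmul[OF l] algebra_simps)
qed

lemma laplacian_eq_trace_hess:
  fixes g :: "(real ^ 'n) local_metric"
  assumes g: "C1_metric_on S g" and x: "x \<in> S" and f: "Ck_on (Suc (Suc 0)) S f"
  shows "laplacian g f x = metric_trace (g x) (hess g f x)"
proof -
  note m = C1_metric_onD[OF g]
  have "cov g (\<lambda>_. e) (grad g f) x \<bullet> e = hess g f x e (sharp (g x) (\<lambda>w. w \<bullet> e))" for e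
    unfolding hess_eq_cov_grad[OF assms, symmetric] m(3)[OF x, of "cov g _ _ _"]
    by (rule sharp_works[OF m(2,4)[OF x] linear_inner_left, symmetric])
  then show ?thesis
    by (simp add: laplacian_def divergence_def metric_trace_swap[OF m(2,4,3)[OF x] bilinear_hess[OF assms], symmetric])
qed

lemma second_ff_constant:
  "second_ff h g F (\<lambda>_. v) (\<lambda>_. w) x =
    fd (\<lambda>y. fd F y w) x v + christoffel g (F x) (fd F x v) (fd F x w) - fd F x (christoffel h x v w)"
  by (simp add: second_ff_def cov_along_def cov_def)

text \<open>
  For a linear coordinate \<open>l\<close> on the target, the Hessian of \<open>l \<circ> F\<close> is \<open>l(II) - l(\<Gamma>(DF, DF))\<close>: the
  Christoffel symbols of the source cancel. The second term, with its sign, is the Hessian of \<open>l\<close> on the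
  target; where it vanishes on the image of \<open>DF\<close>, the coordinate \<open>l \<circ> F\<close> of an extremal \<open>F\<close> is harmonic.
\<close>

lemma laplacian_linear_of_map:
  fixes h :: "(real ^ 'n) local_metric" and F :: "real ^ 'n \<Rightarrow> 'f::euclidean_space"
  assumes h: "C1_metric_on S h" and x: "x \<in> S" and F: "Ck_on (Suc (Suc 0)) S F"
    and l: "bounded_linear l"
  shows "laplacian h (\<lambda>y. l (F y)) x =
    l (metric_trace (h x) (\<lambda>v w. second_ff h g F (\<lambda>_. v) (\<lambda>_. w) x)) -
    metric_trace (h x) (\<lambda>v w. l (christoffel g (F x) (fd F x v) (fd F x w)))"
proof -
  note S = C1_metric_onD(1)[OF h]
  have d: "fd (\<lambda>y. l (F y)) y v = l (fd F y v)" if "y \<in> S" for y v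
    using fd_eqI[OF bounded_linear.has_derivative[OF l fd_works[of F y]]] F that by auto
  have dd: "fd (\<lambda>y. l (fd F y w)) x v = l (fd (\<lambda>y. fd F y w) x v)" for v w
    using fd_eqI[OF bounded_linear.has_derivative[OF l fd_works[of "\<lambda>y. fd F y w" x]]] F x by auto
  have "fd (\<lambda>y. fd (\<lambda>y. l (F y)) y w) x = fd (\<lambda>y. l (fd F y w)) x" for w
    by (rule fd_cong_open[OF S x d])
  then have "hess h (\<lambda>y. l (F y)) x v w =
      l (second_ff h g F (\<lambda>_. v) (\<lambda>_. w) x) - l (christoffel g (F x) (fd F x v) (fd F x w))" for v w
    using bounded_linear.linear[OF l]
    by (simp add: hess_def dd d[OF x] second_ff_constant linear_add linear_diff)
  then show ?thesis
    unfolding laplacian_eq_trace_hess[OF h x Ck_on_linear_compose[OF S l F]]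
    using bounded_linear.linear[OF l] by (simp add: metric_trace_def linear_sum sum_subtractf)
qed

section \<open>Isometric maps between charts of the same dimension\<close>

definition isometric_on :: "'e::euclidean_space set \<Rightarrow> 'e local_metric \<Rightarrow> 'e local_metric \<Rightarrow> ('e \<Rightarrow> 'e) \<Rightarrow> bool" where
  "isometric_on S h g F \<longleftrightarrow> (\<forall>y\<in>S. \<forall>v w. h y v w = g (F y) (fd F y v) (fd F y w))"

lemma isometric_deriv_inj:
  fixes F :: "'e::euclidean_space \<Rightarrow> 'e"
  assumes h: "C1_metric_on S h" and g: "C1_metric_on T g" and x: "x \<in> S" "F x \<in> T" and F: "F differentiable (at x)"
    and iso: "isometric_on S h g F"
  shows "inj (fd F x)" "surj (fd F x)"
proof -
  have l: "linear (fd F x)" by (rule linear_fd[OF F])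
  show "inj (fd F x)"
  proof (subst linear_injective_0[OF l], intro allI impI)
    fix v assume "fd F x v = 0"
    then have "h x v w = 0" for w
      using iso x by (simp add: isometric_on_def bilinear_lzero[OF C1_metric_onD(2)[OF g x(2)]])
    then show "v = 0" using C1_metric_onD(4)[OF h x(1)] by (auto simp: nondegenerate_def)
  qed
  then show "surj (fd F x)" using l linear_injective_imp_surjective by blast
qed

text \<open>
  An isometric map is totally geodesic. As \<open>DF\<close> is bijective, \<open>D\<^sup>2F + \<Gamma>\<^sub>g(DF, DF)\<close> equals \<open>DF \<circ> \<Gamma>\<close> for some
  \<open>\<Gamma>\<close>, which is symmetric by Schwarz's theorem and compatible with \<open>h\<close> because \<open>h\<close> is the pullback of
  \<open>g\<close>. By uniqueness \<open>\<Gamma>\<close> is the Levi-Civita connection of \<open>h\<close>, which says that \<open>II = 0\<close>.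
\<close>

lemma isometric_second_ff_zero:
  fixes F :: "'e::euclidean_space \<Rightarrow> 'e"
  assumes h: "C1_metric_on S h" and g: "C1_metric_on T g" and x: "x \<in> S" and FT: "F ` S \<subseteq> T"
    and F: "Ck_on (Suc (Suc 0)) S F" and iso: "isometric_on S h g F"
  shows "second_ff h g F (\<lambda>_. v) (\<lambda>_. w) x = 0"
proof -
  note S = C1_metric_onD(1)[OF h]
  have Fx: "F x \<in> T" using FT x by auto
  have dF: "F differentiable (at y)" if "y \<in> S" for y using F that by auto
  have ddF: "(\<lambda>y. fd F y w) differentiable (at x)" for w using F x by auto
  note inj = isometric_deriv_inj[OF h g x Fx dF[OF x] iso]
  have l: "linear (fd F x)" by (rule linear_fd[OF dF[OF x]])
  have ll: "linear (fd (\<lambda>y. fd F y w) x)" for w by (rule linear_fd[OF ddF])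
  note c = christoffel_rules[OF g Fx] and gb = C1_metric_onD(2)[OF g Fx]
  define N where "N v w = fd (\<lambda>y. fd F y w) x v + christoffel g (F x) (fd F x v) (fd F x w)" for v w
  define \<Gamma> where "\<Gamma> v w = inv (fd F x) (N v w)" for v w
  have \<Gamma>: "fd F x (\<Gamma> v w) = N v w" for v w unfolding \<Gamma>_def by (rule surj_f_inv_f[OF inj(2)])
  have Nsym: "N v w = N w v" for v w
    unfolding N_def using second_derivative_symmetric[OF S x F] c(2) by metis
  have sym: "\<Gamma> v w = \<Gamma> w v" for v w unfolding \<Gamma>_def using Nsym by metis
  have lin1: "linear (\<lambda>v. \<Gamma> v w)" for w
    by (rule linearI; rule injD[OF inj(1)])
      (simp_all add: linear_add[OF l] linear_cmul[OF l] \<Gamma> N_def linear_add[OF ll] linear_cmul[OF ll]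
        bilinear_ladd[OF c(1)] bilinear_lmul[OF c(1)] algebra_simps)
  have "is_levi_civita h x \<Gamma>"
    unfolding is_levi_civita_def
  proof (intro conjI allI)
    show "bilinear \<Gamma>"
      using lin1 unfolding bilinear_def by (simp add: sym[of _ "_ :: 'e"] fun_eq_iff)
    show "\<Gamma> v w = \<Gamma> w v" for v w by (rule sym)
    show "fd (\<lambda>y. h y v w) x z = h x (\<Gamma> z v) w + h x v (\<Gamma> z w)" for z v w
    proof -
      have "fd (\<lambda>y. h y v w) x z = fd (\<lambda>y. g (F y) (fd F y v) (fd F y w)) x z"
        by (rule fun_cong[OF fd_cong_open[OF S x]]) (use iso in \<open>simp add: isometric_on_def\<close>)
      also have "\<dots> = g (F x) (N z v) (fd F x w) + g (F x) (fd F x v) (N z w)"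
        unfolding N_def by (rule metric_compatible_along[OF g Fx dF[OF x] ddF ddF])
      finally show ?thesis using iso x by (simp add: isometric_on_def \<Gamma>)
    qed
  qed
  then have "christoffel h x = \<Gamma>" by (rule christoffel_eqI[OF h x])
  then show ?thesis by (simp add: second_ff_constant \<Gamma>) (simp add: N_def)
qed

text \<open>
  As \<open>II = 0\<close>, the Hessian of \<open>f \<circ> F\<close> is the pullback of the Hessian of \<open>f\<close>; then take traces.
\<close>

lemma laplacian_isometric:
  fixes F :: "real ^ 'n \<Rightarrow> real ^ 'n"
  assumes h: "C1_metric_on S h" and g: "C1_metric_on T g" and x: "x \<in> S" and FT: "F ` S \<subseteq> T"
    and F: "Ck_on (Suc (Suc 0)) S F" and iso: "isometric_on S h g F" and f: "Ck_on (Suc (Suc 0)) T f"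
  shows "laplacian h (\<lambda>y. f (F y)) x = laplacian g f (F x)"
proof -
  note S = C1_metric_onD(1)[OF h] and T = C1_metric_onD(1)[OF g]
  have Fx: "F x \<in> T" using FT x by auto
  have dF: "F differentiable (at y)" if "y \<in> S" for y using F that by auto
  have ddF: "(\<lambda>y. fd F y w) differentiable (at x)" for w using F x by auto
  have df: "f differentiable (at z)" if "z \<in> T" for z using f that by auto
  have lf: "linear (fd f z)" if "z \<in> T" for z by (rule linear_fd[OF df[OF that]])
  note inj = isometric_deriv_inj[OF h g x Fx dF[OF x] iso]
  have "hess h (\<lambda>y. f (F y)) x v w = hess g f (F x) (fd F x v) (fd F x w)" for v w
  proof -
    have d: "fd (\<lambda>y. f (F y)) y u = fd f (F y) (fd F y u)" if "y \<in> S" for y u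
      using fd_eqI[OF has_derivative_compose[OF fd_works[OF dF[OF that]] fd_works[OF df]]] FT that
      by (auto simp: image_subset_iff)
    have "fd (\<lambda>y. fd (\<lambda>y. f (F y)) y w) x v = fd (\<lambda>y. fd f (F y) (fd F y w) * (1::real)) x v"
      by (rule fun_cong[OF fd_cong_open[OF S x]]) (simp add: d)
    also have "\<dots> = fd (\<lambda>z. fd f z (fd F x w)) (F x) (fd F x v) + fd f (F x) (fd (\<lambda>y. fd F y w) x v)"
    proof -
      \<comment> \<open>\<open>Df\<close> as a bilinear form in a vector and a scalar, so that the product rule applies\<close>
      have bil: "bilinear (\<lambda>u c. fd f z u * c)" if "z \<in> T" for z
        unfolding bilinear_def
        by (intro conjI allI linearI)
          (simp_all add: linear_add[OF lf[OF that]] linear_cmul[OF lf[OF that]] algebra_simps)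
      have dd: "(\<lambda>z. fd f z u * c) differentiable (at (F x))" for u c
        using f Fx by (intro differentiable_mult) auto
      show ?thesis
        using fd_eqI[OF bilinear_derivative_along[of T F x "\<lambda>z u c. fd f z u * c" "\<lambda>y. fd F y w" "\<lambda>_. 1",
              OF T Fx bil dd dF[OF x] ddF]]
        by simp
    qed
    finally have "fd (\<lambda>y. fd (\<lambda>y. f (F y)) y w) x v =
        fd (\<lambda>z. fd f z (fd F x w)) (F x) (fd F x v) + fd f (F x) (fd (\<lambda>y. fd F y w) x v)" .
    moreover have "fd f (F x) (fd F x (christoffel h x v w)) =
        fd f (F x) (fd (\<lambda>y. fd F y w) x v) + fd f (F x) (christoffel g (F x) (fd F x v) (fd F x w))"
      using isometric_second_ff_zero[OF h g x FT F iso, of v w]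
      by (simp add: second_ff_constant linear_add[OF lf[OF Fx], symmetric])
    ultimately show ?thesis by (simp add: hess_def d[OF x])
  qed
  then have hh: "hess h (\<lambda>y. f (F y)) x = (\<lambda>v w. hess g f (F x) (fd F x v) (fd F x w))" by blast
  show ?thesis
    unfolding laplacian_eq_trace_hess[OF h x Ck_on_compose[OF S T FT F f]] laplacian_eq_trace_hess[OF g Fx f] hh
    by (rule metric_trace_pullback[OF C1_metric_onD(2,4)[OF g Fx] C1_metric_onD(2,4)[OF h x]
          linear_fd[OF dF[OF x]] inj(2) _ bilinear_hess[OF g Fx f]])
      (use iso x in \<open>simp add: isometric_on_def\<close>)
qed

section \<open>Curves in a manifold\<close>

lemma smooth_manifoldD:
  assumes "smooth_manifold A"
  shows "open (cdom A i)" "open (cimg A i)" "continuous_on (cdom A i) (cmap A i)"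
    "continuous_on (cimg A i) (cinv A i)"
    "p \<in> cdom A i \<Longrightarrow> cinv A i (cmap A i p) = p" "y \<in> cimg A i \<Longrightarrow> cmap A i (cinv A i y) = y"
    "p \<in> cdom A i \<Longrightarrow> cmap A i p \<in> cimg A i" "y \<in> cimg A i \<Longrightarrow> cinv A i y \<in> cdom A i"
    "q \<in> cdom A (chart_at A q)"
    "smooth_on (local_dom A A id i j) (local_map A A id i j)"
proof -
  have h: "homeomorphism (cdom A i) (cimg A i) (cmap A i) (cinv A i)" and U: "(\<Union>i. cdom A i) = UNIV"
    using assms by (auto simp: smooth_manifold_def)
  show "open (cdom A i)" "open (cimg A i)" "smooth_on (local_dom A A id i j) (local_map A A id i j)"
    using assms by (auto simp: smooth_manifold_def)
  show "continuous_on (cdom A i) (cmap A i)" "continuous_on (cimg A i) (cinv A i)"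
    "p \<in> cdom A i \<Longrightarrow> cinv A i (cmap A i p) = p" "y \<in> cimg A i \<Longrightarrow> cmap A i (cinv A i y) = y"
    "p \<in> cdom A i \<Longrightarrow> cmap A i p \<in> cimg A i" "y \<in> cimg A i \<Longrightarrow> cinv A i y \<in> cdom A i"
    using h by (auto simp: homeomorphism_def)
  have "\<exists>i. q \<in> cdom A i" using U by auto
  then show "q \<in> cdom A (chart_at A q)" unfolding chart_at_def by (rule someI_ex)
qed

lemma local_dom_iff:
  assumes "smooth_manifold A"
  shows "y \<in> local_dom A B \<psi> i j \<longleftrightarrow> y \<in> cimg A i \<and> \<psi> (cinv A i y) \<in> cdom B j"
  using smooth_manifoldD[OF assms] by (force simp: local_dom_def cimg_def)

lemma open_local_dom:
  assumes "smooth_manifold A" "continuous_on UNIV \<psi>" "open (cdom B j)"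
  shows "open (local_dom A B \<psi> i j)"
proof -
  have "local_dom A B \<psi> i j = cimg A i \<inter> (\<psi> \<circ> cinv A i) -` cdom B j"
    by (auto simp: local_dom_iff[OF assms(1)])
  moreover have "continuous_on (cimg A i) (\<psi> \<circ> cinv A i)"
    by (intro continuous_on_compose smooth_manifoldD[OF assms(1)] continuous_on_subset[OF assms(2)]) auto
  ultimately show ?thesis
    using continuous_open_preimage[OF _ smooth_manifoldD(2)[OF assms(1)] assms(3)] by metis
qed

lemma open_chart_preimage:
  assumes "smooth_manifold A" "open V"
  shows "open {p \<in> cdom A i. cmap A i p \<in> V}"
  using continuous_open_preimage[OF smooth_manifoldD(3,1)[OF assms(1)] assms(2)]
  by (simp add: vimage_def Int_def)

lemma local_map_apply: "local_map A B \<psi> i j y = cmap B j (\<psi> (cinv A i y))"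
  by (simp add: local_map_def)

lemma smooth_onD: "smooth_on S f \<Longrightarrow> Ck_on k S f"
  by (simp add: smooth_on_def)

lemma smooth_on_differentiable: "smooth_on S f \<Longrightarrow> x \<in> S \<Longrightarrow> f differentiable (at x)"
  using smooth_onD[of S f "Suc 0"] by auto

lemma velocity_image:
  assumes A: "smooth_manifold A" and X: "continuous (at t within X) \<gamma>" and i: "\<gamma> t \<in> cdom A i"
    and d: "((cmap A i \<circ> \<gamma>) has_vector_derivative w) (at t within X)" and t: "t \<in> X"
    and F: "local_map A B \<psi> i j differentiable (at (cmap A i (\<gamma> t)))"
  shows "((cmap B j \<circ> (\<psi> \<circ> \<gamma>)) has_vector_derivative fd (local_map A B \<psi> i j) (cmap A i (\<gamma> t)) w) (at t within X)"
proof -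
  let ?F = "local_map A B \<psi> i j"
  have l: "linear (fd ?F (cmap A i (\<gamma> t)))" by (rule linear_fd[OF F])
  have "((\<lambda>s. ?F ((cmap A i \<circ> \<gamma>) s)) has_derivative (\<lambda>h. fd ?F (cmap A i (\<gamma> t)) (h *\<^sub>R w))) (at t within X)"
    by (rule has_derivative_compose[of "cmap A i \<circ> \<gamma>"])
      (use d fd_works[OF F] in \<open>simp_all add: has_vector_derivative_def\<close>)
  then have 1: "((\<lambda>s. ?F ((cmap A i \<circ> \<gamma>) s)) has_vector_derivative fd ?F (cmap A i (\<gamma> t)) w) (at t within X)"
    by (simp add: has_vector_derivative_def linear_cmul[OF l])
  have "\<forall>\<^sub>F s in at t within X. \<gamma> s \<in> cdom A i"
    using X i smooth_manifoldD(1)[OF A] by (auto simp: continuous_within dest: topological_tendstoD)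
  then have 2: "\<forall>\<^sub>F s in at t within X. (cmap B j \<circ> (\<psi> \<circ> \<gamma>)) s = ?F ((cmap A i \<circ> \<gamma>) s)"
    by (auto elim!: eventually_mono simp: local_map_apply smooth_manifoldD(5)[OF A])
  show ?thesis
    using 1 unfolding has_vector_derivative_def
    by (rule has_derivative_transform_eventually)
      (use 2 t i in \<open>auto elim!: eventually_mono simp: local_map_apply smooth_manifoldD(5)[OF A]\<close>)
qed

lemma velocity_change_chart:
  assumes A: "smooth_manifold A" and "continuous (at t within X) \<gamma>" "\<gamma> t \<in> cdom A i" "\<gamma> t \<in> cdom A j"
    and "((cmap A i \<circ> \<gamma>) has_vector_derivative w) (at t within X)" and "t \<in> X"
  shows "((cmap A j \<circ> \<gamma>) has_vector_derivative fd (local_map A A id i j) (cmap A i (\<gamma> t)) w) (at t within X)"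
proof -
  have "local_map A A id i j differentiable (at (cmap A i (\<gamma> t)))"
    by (rule smooth_on_differentiable[OF smooth_manifoldD(10)[OF A]])
      (use assms smooth_manifoldD[OF A] in \<open>auto simp: local_dom_iff[OF A]\<close>)
  from velocity_image[OF A assms(2,3,5,6) this] show ?thesis unfolding id_o .
qed

lemma continuous_on_locally:
  fixes S :: "'a::t2_space set"
  assumes "\<And>x. x \<in> S \<Longrightarrow> \<exists>U. open U \<and> x \<in> U \<and> continuous_on (S \<inter> U) f"
  shows "continuous_on S f"
  unfolding continuous_on_eq_continuous_within
proof
  fix x assume x: "x \<in> S"
  then obtain U where U: "open U" "x \<in> U" "continuous_on (S \<inter> U) f" using assms by blast
  have "at x within S \<inter> U = at x within S"
    by (rule at_within_nhd[OF U(2,1)]) auto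
  moreover have "continuous (at x within S \<inter> U) f"
    using U x by (simp add: continuous_on_eq_continuous_within)
  ultimately show "continuous (at x within S) f" by simp
qed

lemma at_within_Icc_neq_bot:
  fixes a b t :: real
  assumes "a < b" "t \<in> {a..b}"
  shows "at t within {a..b} \<noteq> bot"
  using assms by (simp add: trivial_limit_within)

text \<open>
  It is enough to look, around each parameter, at a single chart: in the other charts the velocity is the
  image of the one in that chart under the derivative of a transition map.
\<close>

lemma C1_curve_onI:
  assumes A: "smooth_manifold A" and ab: "a < b" and c: "continuous_on {a..b} \<gamma>"
    and loc: "\<And>t. t \<in> {a..b} \<Longrightarrow> \<exists>i D U. open U \<and> t \<in> U \<and> continuous_on ({a..b} \<inter> U) D \<and>
      (\<forall>s\<in>{a..b} \<inter> U. \<gamma> s \<in> cdom A i \<and> ((cmap A i \<circ> \<gamma>) has_vector_derivative D s) (at s within {a..b}))"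
  shows "C1_curve_on A a b \<gamma>"
  unfolding C1_curve_on_def
proof (intro conjI allI)
  fix j
  let ?D = "\<lambda>t. vector_derivative (cmap A j \<circ> \<gamma>) (at t within {a..b})"
  let ?S = "{t \<in> {a..b}. \<gamma> t \<in> cdom A j}"
  have nb: "at t within {a..b} \<noteq> bot" if "t \<in> {a..b}" for t by (rule at_within_Icc_neq_bot[OF ab that])
  have key: "\<exists>U. open U \<and> t \<in> U \<and> continuous_on (?S \<inter> U) ?D \<and>
      (\<forall>s\<in>?S \<inter> U. ((cmap A j \<circ> \<gamma>) has_vector_derivative ?D s) (at s within {a..b}))" if t: "t \<in> ?S" for t
  proof -
    obtain i D U where U: "open U" "t \<in> U" "continuous_on ({a..b} \<inter> U) D"
      "\<And>s. s \<in> {a..b} \<inter> U \<Longrightarrow> \<gamma> s \<in> cdom A i"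
      "\<And>s. s \<in> {a..b} \<inter> U \<Longrightarrow> ((cmap A i \<circ> \<gamma>) has_vector_derivative D s) (at s within {a..b})"
      using loc[of t] t by blast
    let ?T = "local_map A A id i j"
    have d: "((cmap A j \<circ> \<gamma>) has_vector_derivative fd ?T (cmap A i (\<gamma> s)) (D s)) (at s within {a..b})"
      if "s \<in> ?S \<inter> U" for s
      using that c U by (intro velocity_change_chart[OF A]) (auto simp: continuous_on_eq_continuous_within)
    have D: "?D s = fd ?T (cmap A i (\<gamma> s)) (D s)" if "s \<in> ?S \<inter> U" for s
      using vector_derivative_within[OF nb d[OF that]] that by simp
    have "continuous_on (?S \<inter> U) (\<lambda>s. fd ?T (cmap A i (\<gamma> s)) (D s))"
    proof (rule continuous_on_fd_apply[OF smooth_onD[OF smooth_manifoldD(10)[OF A]]])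
      show "continuous_on (?S \<inter> U) (\<lambda>s. cmap A i (\<gamma> s))"
        by (rule continuous_on_compose2[OF smooth_manifoldD(3)[OF A] continuous_on_subset[OF c]])
          (use U in auto)
      show "continuous_on (?S \<inter> U) D" by (rule continuous_on_subset[OF U(3)]) auto
      show "(\<lambda>s. cmap A i (\<gamma> s)) ` (?S \<inter> U) \<subseteq> local_dom A A id i j"
        using U smooth_manifoldD[OF A] by (auto simp: local_dom_iff[OF A])
    qed
    then have "continuous_on (?S \<inter> U) ?D"
      using D by (metis (no_types, lifting) continuous_on_cong)
    moreover have "((cmap A j \<circ> \<gamma>) has_vector_derivative ?D s) (at s within {a..b})" if "s \<in> ?S \<inter> U" for s
      using d[OF that] unfolding D[OF that] .
    ultimately show ?thesis using U(1,2) by blast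
  qed
  show "\<exists>D. continuous_on ?S D \<and> (\<forall>t\<in>{a..b}. \<gamma> t \<in> cdom A j \<longrightarrow>
      ((cmap A j \<circ> \<gamma>) has_vector_derivative D t) (at t within {a..b}))"
  proof (intro exI conjI ballI impI)
    show "continuous_on ?S ?D" by (rule continuous_on_locally) (use key in blast)
    show "((cmap A j \<circ> \<gamma>) has_vector_derivative ?D t) (at t within {a..b})"
      if "t \<in> {a..b}" "\<gamma> t \<in> cdom A j" for t
      using key[of t] that by blast
  qed
qed (rule c)

lemma C1_curve_onD:
  assumes "C1_curve_on A a b \<gamma>" "a < b"
  shows "continuous_on {a..b} \<gamma>"
    "t \<in> {a..b} \<Longrightarrow> \<gamma> t \<in> cdom A i \<Longrightarrow>
      ((cmap A i \<circ> \<gamma>) has_vector_derivative vector_derivative (cmap A i \<circ> \<gamma>) (at t within {a..b})) (at t within {a..b})"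
    "continuous_on {t \<in> {a..b}. \<gamma> t \<in> cdom A i} (\<lambda>t. vector_derivative (cmap A i \<circ> \<gamma>) (at t within {a..b}))"
proof -
  show c: "continuous_on {a..b} \<gamma>" using assms by (simp add: C1_curve_on_def)
  obtain D where D: "continuous_on {t \<in> {a..b}. \<gamma> t \<in> cdom A i} D"
    "\<And>t. t \<in> {a..b} \<Longrightarrow> \<gamma> t \<in> cdom A i \<Longrightarrow> ((cmap A i \<circ> \<gamma>) has_vector_derivative D t) (at t within {a..b})"
    using assms unfolding C1_curve_on_def by blast
  have eq: "vector_derivative (cmap A i \<circ> \<gamma>) (at t within {a..b}) = D t"
    if "t \<in> {a..b}" "\<gamma> t \<in> cdom A i" for t
    using vector_derivative_within[OF at_within_Icc_neq_bot[OF assms(2) that(1)] D(2)[OF that]] .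
  show "t \<in> {a..b} \<Longrightarrow> \<gamma> t \<in> cdom A i \<Longrightarrow>
      ((cmap A i \<circ> \<gamma>) has_vector_derivative vector_derivative (cmap A i \<circ> \<gamma>) (at t within {a..b})) (at t within {a..b})"
    using D(2) eq by metis
  show "continuous_on {t \<in> {a..b}. \<gamma> t \<in> cdom A i} (\<lambda>t. vector_derivative (cmap A i \<circ> \<gamma>) (at t within {a..b}))"
    using D(1) eq by (metis (no_types, lifting) continuous_on_cong mem_Collect_eq)
qed

text \<open>
  Localizes a curve to one chart, in the form in which \<open>C1_curve_onI\<close> asks for it.
\<close>

lemma C1_curve_on_local:
  assumes A: "smooth_manifold A" and "C1_curve_on A a b \<gamma>" "a < b" "t \<in> {a..b}" "\<gamma> t \<in> cdom A i"
  obtains U where "open U" "t \<in> U" "\<And>s. s \<in> {a..b} \<inter> U \<Longrightarrow> \<gamma> s \<in> cdom A i"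
    "continuous_on ({a..b} \<inter> U) (\<lambda>s. vector_derivative (cmap A i \<circ> \<gamma>) (at s within {a..b}))"
    "continuous_on ({a..b} \<inter> U) (\<lambda>s. cmap A i (\<gamma> s))"
proof -
  note C = C1_curve_onD[OF assms(2,3)]
  obtain U where U: "open U" "U \<inter> {a..b} = \<gamma> -` cdom A i \<inter> {a..b}"
    using C(1) smooth_manifoldD(1)[OF A] unfolding continuous_on_open_invariant by blast
  have *: "{t \<in> {a..b}. \<gamma> t \<in> cdom A i} = {a..b} \<inter> U" using U(2) by blast
  have "continuous_on ({a..b} \<inter> U) (\<lambda>s. cmap A i (\<gamma> s))"
    by (rule continuous_on_compose2[OF smooth_manifoldD(3)[OF A, of i] continuous_on_subset[OF C(1)]])
      (use * in auto)
  moreover have "continuous_on ({a..b} \<inter> U) (\<lambda>s. vector_derivative (cmap A i \<circ> \<gamma>) (at s within {a..b}))"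
    using C(3)[of i] unfolding * .
  moreover have "\<gamma> s \<in> cdom A i" if "s \<in> {a..b} \<inter> U" for s using that * by blast
  moreover have "t \<in> U" using assms(4,5) * by blast
  ultimately show thesis using U(1) that by blast
qed

lemma C1_curve_on_subset:
  assumes A: "smooth_manifold A" and C: "C1_curve_on A a b \<gamma>" and "a \<le> c" "c < d" "d \<le> b"
  shows "C1_curve_on A c d \<gamma>"
proof (rule C1_curve_onI[OF A assms(4)])
  have ab: "a < b" and sub: "{c..d} \<subseteq> {a..b}" using assms by auto
  show "continuous_on {c..d} \<gamma>" using C1_curve_onD(1)[OF C ab] sub continuous_on_subset by blast
  fix t assume t: "t \<in> {c..d}"
  let ?i = "chart_at A (\<gamma> t)"
  let ?D = "\<lambda>s. vector_derivative (cmap A ?i \<circ> \<gamma>) (at s within {a..b})"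
  obtain U where U: "open U" "t \<in> U" "\<And>s. s \<in> {a..b} \<inter> U \<Longrightarrow> \<gamma> s \<in> cdom A ?i"
    "continuous_on ({a..b} \<inter> U) ?D" "continuous_on ({a..b} \<inter> U) (\<lambda>s. cmap A ?i (\<gamma> s))"
    by (rule C1_curve_on_local[OF A C ab _ smooth_manifoldD(9)[OF A], of t]) (use t sub in auto)
  have "continuous_on ({c..d} \<inter> U) ?D" by (rule continuous_on_subset[OF U(4)]) (use sub in auto)
  moreover have "((cmap A ?i \<circ> \<gamma>) has_vector_derivative ?D s) (at s within {c..d})" if "s \<in> {c..d} \<inter> U" for s
    by (rule has_vector_derivative_within_subset[OF C1_curve_onD(2)[OF C ab] sub]) (use U sub that in auto)
  ultimately show "\<exists>i D U. open U \<and> t \<in> U \<and> continuous_on ({c..d} \<inter> U) D \<and>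
      (\<forall>s\<in>{c..d} \<inter> U. \<gamma> s \<in> cdom A i \<and> ((cmap A i \<circ> \<gamma>) has_vector_derivative D s) (at s within {c..d}))"
    using U sub by (intro exI[of _ ?i] exI[of _ ?D] exI[of _ U]) auto
qed

lemma C1_curve_on_cong:
  assumes A: "smooth_manifold A" and C: "C1_curve_on A a b \<gamma>" and ab: "a < b" and eq: "\<And>t. t \<in> {a..b} \<Longrightarrow> \<gamma>' t = \<gamma> t"
  shows "C1_curve_on A a b \<gamma>'"
  unfolding C1_curve_on_def
proof (intro conjI allI)
  show "continuous_on {a..b} \<gamma>'" using C1_curve_onD(1)[OF C ab] eq by (metis continuous_on_cong)
  fix i
  have "((cmap A i \<circ> \<gamma>') has_vector_derivative vector_derivative (cmap A i \<circ> \<gamma>) (at t within {a..b})) (at t within {a..b})"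
    if "t \<in> {a..b}" "\<gamma>' t \<in> cdom A i" for t
    by (rule has_vector_derivative_transform[OF that(1) _ C1_curve_onD(2)[OF C ab that(1)]]) (use eq that in auto)
  moreover have "{t \<in> {a..b}. \<gamma>' t \<in> cdom A i} = {t \<in> {a..b}. \<gamma> t \<in> cdom A i}" using eq by auto
  ultimately show "\<exists>D. continuous_on {t \<in> {a..b}. \<gamma>' t \<in> cdom A i} D \<and> (\<forall>t\<in>{a..b}. \<gamma>' t \<in> cdom A i \<longrightarrow>
      ((cmap A i \<circ> \<gamma>') has_vector_derivative D t) (at t within {a..b}))"
    using C1_curve_onD(3)[OF C ab, of i]
    by (intro exI[of _ "\<lambda>t. vector_derivative (cmap A i \<circ> \<gamma>) (at t within {a..b})"]) auto
qed

lemma C1_curve_in_chart: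
  assumes A: "smooth_manifold A" and ab: "a < b" and c: "\<And>t. t \<in> {a..b} \<Longrightarrow> c t \<in> cimg A i"
    and d: "\<And>t. t \<in> {a..b} \<Longrightarrow> (c has_vector_derivative D t) (at t within {a..b})" and D: "continuous_on {a..b} D"
  shows "C1_curve_on A a b (cinv A i \<circ> c)"
    and "t \<in> {a..b} \<Longrightarrow> ((cmap A i \<circ> (cinv A i \<circ> c)) has_vector_derivative D t) (at t within {a..b})"
proof -
  have cc: "continuous_on {a..b} c"
    using d by (meson continuous_on_eq_continuous_within has_vector_derivative_continuous)
  show d': "((cmap A i \<circ> (cinv A i \<circ> c)) has_vector_derivative D t) (at t within {a..b})" if "t \<in> {a..b}" for t
    by (rule has_vector_derivative_transform[OF that _ d[OF that]]) (simp add: c smooth_manifoldD(6)[OF A])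
  show "C1_curve_on A a b (cinv A i \<circ> c)"
  proof (rule C1_curve_onI[OF A ab])
    show "continuous_on {a..b} (cinv A i \<circ> c)"
      by (intro continuous_on_compose cc continuous_on_subset[OF smooth_manifoldD(4)[OF A, of i]]) (use c in auto)
    show "\<exists>i' D U. open U \<and> t \<in> U \<and> continuous_on ({a..b} \<inter> U) D \<and>
      (\<forall>s\<in>{a..b} \<inter> U. (cinv A i \<circ> c) s \<in> cdom A i' \<and>
        ((cmap A i' \<circ> (cinv A i \<circ> c)) has_vector_derivative D s) (at s within {a..b}))" for t
      using d' D c smooth_manifoldD(8)[OF A]
      by (intro exI[of _ i] exI[of _ D] exI[of _ UNIV]) auto
  qed
qed

lemma C1_curve_affine:
  assumes A: "smooth_manifold A" and C: "C1_curve_on A c d \<gamma>" and cd: "c < d" and ab: "a < b"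
    and im: "(\<lambda>t. m * t + k) ` {a..b} = {c..d}"
  shows "C1_curve_on A a b (\<lambda>t. \<gamma> (m * t + k))"
    and "t \<in> {a..b} \<Longrightarrow> \<gamma> (m * t + k) \<in> cdom A i \<Longrightarrow> ((cmap A i \<circ> (\<lambda>t. \<gamma> (m * t + k))) has_vector_derivative
      m *\<^sub>R vector_derivative (cmap A i \<circ> \<gamma>) (at (m * t + k) within {c..d})) (at t within {a..b})"
proof -
  let ?\<theta> = "\<lambda>t. m * t + k"
  have in': "?\<theta> t \<in> {c..d}" if "t \<in> {a..b}" for t using im that by blast
  have c\<theta>: "continuous_on {a..b} ?\<theta>" by (intro continuous_intros)
  have c\<gamma>: "continuous_on {a..b} (\<lambda>t. \<gamma> (?\<theta> t))"
    by (rule continuous_on_compose2[OF C1_curve_onD(1)[OF C cd] c\<theta>]) (use in' in auto)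
  show d: "((cmap A i \<circ> (\<lambda>t. \<gamma> (?\<theta> t))) has_vector_derivative
      m *\<^sub>R vector_derivative (cmap A i \<circ> \<gamma>) (at (?\<theta> t) within {c..d})) (at t within {a..b})"
    if t: "t \<in> {a..b}" "\<gamma> (?\<theta> t) \<in> cdom A i" for t i
  proof -
    have 1: "(?\<theta> has_vector_derivative m) (at t within {a..b})" by (auto intro!: derivative_eq_intros)
    have "((cmap A i \<circ> \<gamma> \<circ> ?\<theta>) has_vector_derivative
        m *\<^sub>R vector_derivative (cmap A i \<circ> \<gamma>) (at (?\<theta> t) within {c..d})) (at t within {a..b})"
      by (rule vector_diff_chain_within[OF 1]) (use C1_curve_onD(2)[OF C cd in'[OF t(1)] t(2)] im in simp)
    then show ?thesis by (simp add: o_def)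
  qed
  show "C1_curve_on A a b (\<lambda>t. \<gamma> (?\<theta> t))"
    unfolding C1_curve_on_def
  proof (intro conjI allI c\<gamma>)
    fix i
    have "continuous_on {t \<in> {a..b}. \<gamma> (?\<theta> t) \<in> cdom A i}
        (\<lambda>t. m *\<^sub>R vector_derivative (cmap A i \<circ> \<gamma>) (at (?\<theta> t) within {c..d}))"
      by (intro continuous_on_scaleR continuous_on_const
          continuous_on_compose2[OF C1_curve_onD(3)[OF C cd, of i] continuous_on_subset[OF c\<theta>]]) (use in' in auto)
    with d show "\<exists>D. continuous_on {t \<in> {a..b}. \<gamma> (?\<theta> t) \<in> cdom A i} D \<and> (\<forall>t\<in>{a..b}. \<gamma> (?\<theta> t) \<in> cdom A i \<longrightarrow>
        ((cmap A i \<circ> (\<lambda>t. \<gamma> (?\<theta> t))) has_vector_derivative D t) (at t within {a..b}))"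
      by blast
  qed
qed

section \<open>Length and distance\<close>

text \<open>
  The speed for an arbitrary parameter set \<open>X\<close>: with \<open>X = {0..1}\<close> it is \<open>curve_speed\<close>, and for the piece of a
  curve over \<open>{a..b}\<close> the choice \<open>X = {a..b}\<close> yields one-sided velocities at both ends, so that
  the speed of a \<open>C^1\<close> piece is continuous up to its ends.
\<close>

definition speed ::
  "('i, 'a, 'e::euclidean_space) atlas \<Rightarrow> ('i, 'e) metric \<Rightarrow> (real \<Rightarrow> 'a) \<Rightarrow> real set \<Rightarrow> real \<Rightarrow> real" where
  "speed A g \<gamma> X t =
     (let i = chart_at A (\<gamma> t);
          w = vector_derivative (cmap A i \<circ> \<gamma>) (at t within X)
      in sqrt (g i (cmap A i (\<gamma> t)) w w))"

lemma curve_speed_eq: "curve_speed A g \<gamma> = speed A g \<gamma> {0..1}"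
  by (simp add: fun_eq_iff curve_speed_def speed_def)

lemma speed_interior:
  assumes "t \<in> {a<..<b}" "{a..b} \<subseteq> {c..d}"
  shows "speed A g \<gamma> {c..d} t = speed A g \<gamma> {a..b} t"
proof -
  have "at t within {a..b} = at t" using assms by (intro at_within_Icc_at) auto
  moreover have "at t within {c..d} = at t" using assms by (intro at_within_Icc_at) auto
  ultimately show ?thesis by (simp add: speed_def)
qed

lemma metric_continuous_along:
  assumes g: "C1_metric_on S g" and "continuous_on T c" "continuous_on T V" "continuous_on T W" "c ` T \<subseteq> S"
  shows "continuous_on T (\<lambda>t. g (c t) (V t) (W t))"
proof -
  have "continuous_on S (\<lambda>z. g z e e')" for e e'
    using C1_metric_onD[OF g] by (auto intro!: continuous_at_imp_continuous_on differentiable_imp_continuous_within)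
  then have "continuous_on T (\<lambda>t. g (c t) e e')" for e e'
    using assms continuous_on_compose2[of S "\<lambda>z. g z e e'" T c] by auto
  then have "continuous_on T (\<lambda>t. \<Sum>e\<in>Basis. \<Sum>e'\<in>Basis. (V t \<bullet> e) * (W t \<bullet> e') * g (c t) e e')"
    using assms by (auto intro!: continuous_on_sum continuous_on_mult continuous_on_inner)
  moreover have "g (c t) (V t) (W t) = (\<Sum>e\<in>Basis. \<Sum>e'\<in>Basis. (V t \<bullet> e) * (W t \<bullet> e') * g (c t) e e')" if "t \<in> T" for t
    using assms that by (intro bilinear_expand C1_metric_onD(2)[OF g]) auto
  ultimately show ?thesis by (metis (no_types, lifting) continuous_on_cong)
qed

text \<open>
  A piecewise \<open>C^1\<close> curve on \<open>{a..b}\<close> with its length, as a concatenation of \<open>C^1\<close> pieces. Rule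
  induction reduces statements on lengths to a single piece.
\<close>

inductive curve_length ::
  "('i, 'a::topological_space, 'e::euclidean_space) atlas \<Rightarrow> ('i, 'e) metric \<Rightarrow> (real \<Rightarrow> 'a) \<Rightarrow> real \<Rightarrow> real \<Rightarrow> real \<Rightarrow> bool"
  for A g \<gamma> where
  C1: "a < b \<Longrightarrow> C1_curve_on A a b \<gamma> \<Longrightarrow> curve_length A g \<gamma> a b (integral {a..b} (speed A g \<gamma> {a..b}))"
| join: "curve_length A g \<gamma> a b L \<Longrightarrow> curve_length A g \<gamma> b c L' \<Longrightarrow> curve_length A g \<gamma> a c (L + L')"

lemma curve_length_less: "curve_length A g \<gamma> a b L \<Longrightarrow> a < b"
  by (induction rule: curve_length.induct) auto

definition lengths where
  "lengths A g p q = {L. \<exists>\<gamma> a b. curve_length A g \<gamma> a b L \<and> \<gamma> a = p \<and> \<gamma> b = q}"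

locale riemannian_manifold =
  fixes A :: "('i, 'a::{t2_space, second_countable_topology}, 'e::euclidean_space) atlas"
    and g :: "('i, 'e) metric"
  assumes connected: "connected_manifold A" and riemannian: "riemannian_metric A g"
begin

lemma smooth: "smooth_manifold A"
  using connected by (simp add: connected_manifold_def)

lemmas chart = smooth_manifoldD[OF smooth]

lemma C1_metric: "C1_metric_on (cimg A i) (g i)"
  using riemannian chart(2) unfolding riemannian_metric_def metric_tensor_def C1_metric_on_def
  by (auto simp: smooth_on_def simp del: Ck_on.simps)

lemma positive: "x \<in> cimg A i \<Longrightarrow> v \<noteq> 0 \<Longrightarrow> g i x v v > 0"
  using riemannian by (simp add: riemannian_metric_def)

lemma nonneg: "x \<in> cimg A i \<Longrightarrow> g i x v v \<ge> 0"
  using positive[of x i v] bilinear_lzero[OF C1_metric_onD(2)[OF C1_metric]] by (cases "v = 0") force+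

lemma tensor:
  "x \<in> local_dom A A id i j \<Longrightarrow> g i x v w =
    g j (local_map A A id i j x) (fd (local_map A A id i j) x v) (fd (local_map A A id i j) x w)"
  using riemannian by (simp add: riemannian_metric_def metric_tensor_def)

lemma speed_in_chart:
  assumes "continuous (at t within X) \<gamma>" "\<gamma> t \<in> cdom A i" "t \<in> X" "at t within X \<noteq> bot"
    "((cmap A i \<circ> \<gamma>) has_vector_derivative w) (at t within X)"
  shows "speed A g \<gamma> X t = sqrt (g i (cmap A i (\<gamma> t)) w w)"
proof -
  let ?j = "chart_at A (\<gamma> t)"
  have "vector_derivative (cmap A ?j \<circ> \<gamma>) (at t within X) = fd (local_map A A id i ?j) (cmap A i (\<gamma> t)) w"
    by (rule vector_derivative_within[OF assms(4) velocity_change_chart[OF smooth assms(1,2) chart(9) assms(5,3)]])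
  moreover have "cmap A i (\<gamma> t) \<in> local_dom A A id i ?j"
    using assms(2) chart by (auto simp: local_dom_iff[OF smooth])
  ultimately show ?thesis
    using assms(2) by (simp add: speed_def Let_def tensor[of _ i ?j] local_map_apply chart)
qed

lemma speed_C1:
  assumes "C1_curve_on A a b \<gamma>" "a < b" "t \<in> {a..b}" "\<gamma> t \<in> cdom A i"
  shows "speed A g \<gamma> {a..b} t = sqrt (g i (cmap A i (\<gamma> t))
     (vector_derivative (cmap A i \<circ> \<gamma>) (at t within {a..b})) (vector_derivative (cmap A i \<circ> \<gamma>) (at t within {a..b})))"
  using C1_curve_onD[OF assms(1,2)] assms at_within_Icc_neq_bot[OF assms(2,3)]
  by (intro speed_in_chart) (auto simp: continuous_on_eq_continuous_within)

lemma speed_nonneg: "speed A g \<gamma> X t \<ge> 0"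
  using nonneg[OF chart(7)[OF chart(9)]] by (simp add: speed_def Let_def)

lemma continuous_speed:
  assumes C: "C1_curve_on A a b \<gamma>" and ab: "a < b"
  shows "continuous_on {a..b} (speed A g \<gamma> {a..b})"
proof (rule continuous_on_locally)
  fix t assume t: "t \<in> {a..b}"
  let ?i = "chart_at A (\<gamma> t)"
  let ?D = "\<lambda>s. vector_derivative (cmap A ?i \<circ> \<gamma>) (at s within {a..b})"
  obtain U where U: "open U" "t \<in> U" "\<And>s. s \<in> {a..b} \<inter> U \<Longrightarrow> \<gamma> s \<in> cdom A ?i"
    "continuous_on ({a..b} \<inter> U) ?D" "continuous_on ({a..b} \<inter> U) (\<lambda>s. cmap A ?i (\<gamma> s))"
    by (rule C1_curve_on_local[OF smooth C ab t chart(9)], rule that)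
  have "continuous_on ({a..b} \<inter> U) (\<lambda>s. sqrt (g ?i (cmap A ?i (\<gamma> s)) (?D s) (?D s)))"
    by (intro continuous_on_real_sqrt metric_continuous_along[OF C1_metric] U) (use U(3) chart(7) in auto)
  then have "continuous_on ({a..b} \<inter> U) (speed A g \<gamma> {a..b})"
    using speed_C1[OF C ab _ U(3)] by (metis (no_types, lifting) IntD1 continuous_on_cong)
  with U show "\<exists>U. open U \<and> t \<in> U \<and> continuous_on ({a..b} \<inter> U) (speed A g \<gamma> {a..b})" by blast
qed

lemma speed_subset:
  assumes C: "C1_curve_on A a b \<gamma>" and "a \<le> c" "c < d" "d \<le> b" "t \<in> {c..d}"
  shows "speed A g \<gamma> {c..d} t = speed A g \<gamma> {a..b} t"
proof -
  have ab: "a < b" and sub: "{c..d} \<subseteq> {a..b}" using assms by auto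
  have t: "t \<in> {a..b}" using assms by auto
  note C' = C1_curve_on_subset[OF smooth C assms(2-4)]
  show ?thesis unfolding speed_C1[OF C ab t chart(9)]
    by (rule speed_in_chart[OF _ chart(9) assms(5) at_within_Icc_neq_bot[OF assms(3,5)]
          has_vector_derivative_within_subset[OF C1_curve_onD(2)[OF C ab t chart(9)] sub]])
      (use C1_curve_onD(1)[OF C' assms(3)] assms(5) in \<open>auto simp: continuous_on_eq_continuous_within\<close>)
qed

lemma integral_speed_subset:
  assumes "C1_curve_on A a b \<gamma>" "a \<le> c" "c < d" "d \<le> b"
  shows "integral {c..d} (speed A g \<gamma> {c..d}) = integral {c..d} (speed A g \<gamma> {a..b})"
  by (rule Henstock_Kurzweil_Integration.integral_cong) (rule speed_subset[OF assms])

lemma speed_integrable: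
  "C1_curve_on A a b \<gamma> \<Longrightarrow> a < b \<Longrightarrow> speed A g \<gamma> {a..b} integrable_on {a..b}"
  by (intro integrable_continuous_real continuous_speed)

lemma speed_cong:
  assumes C: "C1_curve_on A a b \<gamma>" and ab: "a < b" and eq: "\<And>t. t \<in> {a..b} \<Longrightarrow> \<gamma>' t = \<gamma> t" and t: "t \<in> {a..b}"
  shows "speed A g \<gamma>' {a..b} t = speed A g \<gamma> {a..b} t"
proof -
  let ?i = "chart_at A (\<gamma> t)"
  have "((cmap A ?i \<circ> \<gamma>') has_vector_derivative vector_derivative (cmap A ?i \<circ> \<gamma>) (at t within {a..b})) (at t within {a..b})"
    by (rule has_vector_derivative_transform[OF t _ C1_curve_onD(2)[OF C ab t chart(9)]]) (use eq in auto)
  from vector_derivative_within[OF at_within_Icc_neq_bot[OF ab t] this]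
  show ?thesis by (simp add: speed_def eq[OF t])
qed

lemma curve_length_nonneg: "curve_length A g \<gamma> a b L \<Longrightarrow> L \<ge> 0"
proof (induction rule: curve_length.induct)
  case (C1 a b)
  then show ?case by (intro Henstock_Kurzweil_Integration.integral_nonneg speed_integrable speed_nonneg)
qed auto

lemma curve_length_cong:
  "curve_length A g \<gamma> a b L \<Longrightarrow> (\<And>t. t \<in> {a..b} \<Longrightarrow> \<gamma>' t = \<gamma> t) \<Longrightarrow> curve_length A g \<gamma>' a b L"
proof (induction rule: curve_length.induct)
  case (C1 a b)
  have "integral {a..b} (speed A g \<gamma> {a..b}) = integral {a..b} (speed A g \<gamma>' {a..b})"
    by (rule Henstock_Kurzweil_Integration.integral_cong) (metis speed_cong C1)
  then show ?case
    using curve_length.C1[OF C1(1) C1_curve_on_cong[OF smooth C1(2,1,3)], of g] by metis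
next
  case (join a b L c L')
  then show ?case
    using curve_length_less[OF join(1)] curve_length_less[OF join(2)] by (intro curve_length.join) auto
qed

text \<open>
  Affine changes of the parameter serve to concatenate curves, to normalize them to \<open>{0..1}\<close> and, for
  \<open>m = -1\<close>, to reverse them. The factor \<open>\<bar>m\<bar>\<close> of the speed cancels the one of the substitution.
\<close>

lemma integral_speed_affine:
  assumes C: "C1_curve_on A c d \<gamma>" and cd: "c < d" and ab: "a < b" and m: "m \<noteq> 0"
    and im: "(\<lambda>t. m * t + k) ` {a..b} = {c..d}"
  shows "integral {a..b} (speed A g (\<lambda>t. \<gamma> (m * t + k)) {a..b}) = integral {c..d} (speed A g \<gamma> {c..d})"
proof -
  note C' = C1_curve_affine[OF smooth C cd ab im]
  have sp: "speed A g (\<lambda>t. \<gamma> (m * t + k)) {a..b} t = \<bar>m\<bar> * speed A g \<gamma> {c..d} (m * t + k)" if t: "t \<in> {a..b}" for t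
  proof -
    let ?i = "chart_at A (\<gamma> (m * t + k))"
    let ?w = "vector_derivative (cmap A ?i \<circ> \<gamma>) (at (m * t + k) within {c..d})"
    have b: "bilinear (g ?i (cmap A ?i (\<gamma> (m * t + k))))"
      by (rule C1_metric_onD(2)[OF C1_metric]) (simp add: chart(7,9))
    have in': "m * t + k \<in> {c..d}" using im t by blast
    have "speed A g (\<lambda>t. \<gamma> (m * t + k)) {a..b} t = sqrt (g ?i (cmap A ?i (\<gamma> (m * t + k))) (m *\<^sub>R ?w) (m *\<^sub>R ?w))"
      by (rule speed_in_chart[OF _ _ t at_within_Icc_neq_bot[OF ab t] C'(2)[OF t chart(9)]])
        (use C1_curve_onD(1)[OF C'(1) ab] t chart(9) in \<open>auto simp: continuous_on_eq_continuous_within\<close>)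
    also have "\<dots> = sqrt (m\<^sup>2 * g ?i (cmap A ?i (\<gamma> (m * t + k))) ?w ?w)"
      by (simp add: bilinear_lmul[OF b] bilinear_rmul[OF b] power2_eq_square mult.assoc)
    also have "\<dots> = \<bar>m\<bar> * speed A g \<gamma> {c..d} (m * t + k)"
      by (simp add: real_sqrt_mult speed_C1[OF C cd in' chart(9)])
    finally show ?thesis .
  qed
  have inv: "(\<lambda>x. (1 / m) *\<^sub>R x + - ((1 / m) *\<^sub>R k)) ` {c..d} = {a..b}"
    unfolding im[symmetric] image_image using m by (simp add: field_simps)
  have "(speed A g \<gamma> {c..d} has_integral integral {c..d} (speed A g \<gamma> {c..d})) (cbox c d)"
    using speed_integrable[OF C cd] by (simp add: integrable_integral)
  from has_integral_affinity[OF this m, of k]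
  have "((\<lambda>x. speed A g \<gamma> {c..d} (m * x + k)) has_integral (1 / \<bar>m\<bar>) * integral {c..d} (speed A g \<gamma> {c..d})) {a..b}"
    using inv by simp
  from has_integral_mult_right[OF this, of "\<bar>m\<bar>"]
  have "((\<lambda>x. \<bar>m\<bar> * speed A g \<gamma> {c..d} (m * x + k)) has_integral integral {c..d} (speed A g \<gamma> {c..d})) {a..b}"
    using m by simp
  then have "(speed A g (\<lambda>t. \<gamma> (m * t + k)) {a..b} has_integral integral {c..d} (speed A g \<gamma> {c..d})) {a..b}"
    by (rule has_integral_eq[rotated]) (simp add: sp)
  then show ?thesis by (rule integral_unique)
qed

lemma curve_length_affine:
  "curve_length A g \<gamma> c d L \<Longrightarrow> m > 0 \<Longrightarrow> curve_length A g (\<lambda>t. \<gamma> (m * t + k)) ((c - k) / m) ((d - k) / m) L"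
proof (induction rule: curve_length.induct)
  case (C1 c d)
  have ab: "(c - k) / m < (d - k) / m" using C1 by (simp add: divide_strict_right_mono)
  have im: "(\<lambda>t. m * t + k) ` {(c - k) / m..(d - k) / m} = {c..d}"
    using C1 by (simp add: image_affinity_atLeastAtMost divide_right_mono)
  show ?case
    using curve_length.C1[OF ab C1_curve_affine(1)[OF smooth C1(2,1) ab im], of g]
      integral_speed_affine[OF C1(2,1) ab _ im] C1(3) by simp
next
  case join
  then show ?case by (blast intro: curve_length.join)
qed

lemma curve_length_reverse:
  "curve_length A g \<gamma> c d L \<Longrightarrow> curve_length A g (\<lambda>t. \<gamma> (- t)) (- d) (- c) L"
proof (induction rule: curve_length.induct)
  case (C1 c d)
  have ab: "- d < - c" using C1 by simp
  have im: "(\<lambda>t. (- 1) * t + 0) ` {- d..- c} = {c..d}" by simp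
  show ?case
    using curve_length.C1[OF ab C1_curve_affine(1)[OF smooth C1(2,1) ab im], of g]
      integral_speed_affine[OF C1(2,1) ab _ im] by simp
next
  case (join a b L c L')
  then show ?case using curve_length.join by (metis add.commute)
qed

lemma lengths_nonneg: "L \<in> lengths A g p q \<Longrightarrow> L \<ge> 0"
  using curve_length_nonneg by (auto simp: lengths_def)

lemma lengths_sym: "L \<in> lengths A g p q \<Longrightarrow> L \<in> lengths A g q p"
  unfolding lengths_def using curve_length_reverse by fastforce

lemma lengths_join:
  assumes "L \<in> lengths A g p q" "L' \<in> lengths A g q r"
  shows "L + L' \<in> lengths A g p r"
proof -
  obtain \<gamma> a b where 1: "curve_length A g \<gamma> a b L" "\<gamma> a = p" "\<gamma> b = q"
    using assms by (auto simp: lengths_def)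
  obtain \<gamma>' c d where 2: "curve_length A g \<gamma>' c d L'" "\<gamma>' c = q" "\<gamma>' d = r"
    using assms by (auto simp: lengths_def)
  \<comment> \<open>\<open>\<gamma>'\<close> is shifted so as to start at the parameter \<open>b\<close>\<close>
  define \<eta> where "\<eta> t = (if t \<le> b then \<gamma> t else \<gamma>' (1 * t + (c - b)))" for t
  note l = curve_length_less[OF 1(1)] curve_length_less[OF 2(1)]
  have "curve_length A g \<eta> a b L" by (rule curve_length_cong[OF 1(1)]) (simp add: \<eta>_def)
  moreover have "curve_length A g \<eta> b (d - c + b) L'"
  proof (rule curve_length_cong)
    show "curve_length A g (\<lambda>t. \<gamma>' (1 * t + (c - b))) b (d - c + b) L'"
      using curve_length_affine[OF 2(1), of 1 "c - b"] by (simp add: algebra_simps)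
    show "\<eta> t = \<gamma>' (1 * t + (c - b))" if "t \<in> {b..d - c + b}" for t
      using that 1 2 by (cases "t = b") (auto simp: \<eta>_def)
  qed
  ultimately have "curve_length A g \<eta> a (d - c + b) (L + L')" by (rule curve_length.join)
  moreover have "\<eta> a = p" "\<eta> (d - c + b) = r" using 1 2 l by (auto simp: \<eta>_def)
  ultimately show ?thesis by (auto simp: lengths_def)
qed

lemma lengths_C1: "a < b \<Longrightarrow> C1_curve_on A a b \<gamma> \<Longrightarrow>
    integral {a..b} (speed A g \<gamma> {a..b}) \<in> lengths A g (\<gamma> a) (\<gamma> b)"
  unfolding lengths_def using curve_length.C1 by blast

lemma lengths_refl: "0 \<in> lengths A g p p"
proof -
  let ?i = "chart_at A p"
  have c: "cinv A ?i (cmap A ?i p) = p" by (simp add: chart(5,9))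
  have C: "C1_curve_on A 0 1 (cinv A ?i \<circ> (\<lambda>_::real. cmap A ?i p))"
    by (rule C1_curve_in_chart[OF smooth, where D="\<lambda>_. 0"]) (auto simp: chart(7,9))
  have "speed A g (\<lambda>_. p) {0..1} t = 0" if "t \<in> {0..1}" for t :: real
    using speed_in_chart[of t "{0..1}" "\<lambda>_. p" ?i 0] chart(9) that at_within_Icc_neq_bot[of 0 1 t]
      bilinear_lzero[OF C1_metric_onD(2)[OF C1_metric chart(7)[OF chart(9)]], of p 0]
    by (simp add: o_def)
  then have "integral {0..1} (speed A g (\<lambda>_. p) {0..1}) = 0"
    by (metis (no_types, lifting) integral_0 Henstock_Kurzweil_Integration.integral_cong)
  then show ?thesis using lengths_C1[OF _ C] c by (simp add: o_def)
qed

lemma curve_length_piecewise: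
  "curve_length A g \<gamma> a b L \<Longrightarrow> \<exists>S. finite S \<and>
    (\<forall>c d. a \<le> c \<and> c < d \<and> d \<le> b \<and> S \<inter> {c<..<d} = {} \<longrightarrow> C1_curve_on A c d \<gamma>)"
proof (induction rule: curve_length.induct)
  case (C1 a b)
  then show ?case using C1_curve_on_subset[OF smooth C1(2)] by blast
next
  case (join a b L c L')
  from join.IH(1) obtain S where S: "finite S"
    "\<forall>c d. a \<le> c \<and> c < d \<and> d \<le> b \<and> S \<inter> {c<..<d} = {} \<longrightarrow> C1_curve_on A c d \<gamma>" by (elim exE conjE)
  from join.IH(2) obtain T where T: "finite T"
    "\<forall>c' d. b \<le> c' \<and> c' < d \<and> d \<le> c \<and> T \<inter> {c'<..<d} = {} \<longrightarrow> C1_curve_on A c' d \<gamma>" by (elim exE conjE)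
  show ?case
  proof (intro exI[of _ "insert b (S \<union> T)"] conjI allI impI)
    fix x y assume H: "a \<le> x \<and> x < y \<and> y \<le> c \<and> insert b (S \<union> T) \<inter> {x<..<y} = {}"
    then have "y \<le> b \<or> b \<le> x" by force
    then show "C1_curve_on A x y \<gamma>"
    proof
      assume "y \<le> b" then show ?thesis using H by (intro S(2)[rule_format]) auto
    next
      assume "b \<le> x" then show ?thesis using H by (intro T(2)[rule_format]) auto
    qed
  qed (use S T in auto)
qed

lemma curve_length_integral:
  "curve_length A g \<gamma> a b L \<Longrightarrow> 0 \<le> a \<Longrightarrow> b \<le> 1 \<Longrightarrow> (speed A g \<gamma> {0..1} has_integral L) {a..b}"
proof (induction rule: curve_length.induct)
  case (C1 a b)
  have "(speed A g \<gamma> {a..b} has_integral integral {a..b} (speed A g \<gamma> {a..b})) (cbox a b)"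
    using speed_integrable[OF C1(2,1)] by (simp add: integrable_integral)
  then have "(speed A g \<gamma> {0..1} has_integral integral {a..b} (speed A g \<gamma> {a..b})) (cbox a b)"
    by (rule has_integral_spike_interior) (use C1 in \<open>auto intro!: speed_interior\<close>)
  then show ?case by simp
next
  case (join a b L c L')
  then show ?case
    using curve_length_less[OF join(1)] curve_length_less[OF join(2)]
    by (intro has_integral_combine[of a b c]) auto
qed

lemma piecewise_curve_length:
  assumes S: "finite S" "\<And>a b. 0 \<le> a \<Longrightarrow> a < b \<Longrightarrow> b \<le> 1 \<Longrightarrow> S \<inter> {a<..<b} = {} \<Longrightarrow> C1_curve_on A a b \<gamma>"
  shows "0 \<le> a \<Longrightarrow> a < b \<Longrightarrow> b \<le> 1 \<Longrightarrow> \<exists>L. curve_length A g \<gamma> a b L"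
proof (induction "card (S \<inter> {a<..<b})" arbitrary: a b rule: less_induct)
  case less
  show ?case
  proof (cases "S \<inter> {a<..<b} = {}")
    case True
    then show ?thesis using S(2)[OF less(2-4)] less curve_length.C1 by blast
  next
    case False
    then obtain s where s: "s \<in> S" "a < s" "s < b" by auto
    have "card (S \<inter> {a<..<s}) < card (S \<inter> {a<..<b})" "card (S \<inter> {s<..<b}) < card (S \<inter> {a<..<b})"
      using S(1) s by (auto intro!: psubset_card_mono)
    with less s show ?thesis by (meson curve_length.join less_imp_le order_trans)
  qed
qed

text \<open>
  The definition of the distance integrates the speed over \<open>{0..1}\<close> for curves with finitely many
  corners. Cutting at the corners decomposes such a curve into \<open>C^1\<close> pieces; the speeds of the pieces
  agree with that of the whole curve except at the corners, which do not contribute to the integral.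
\<close>

lemma riemannian_dist_eq: "riemannian_dist A g p q = Inf (lengths A g p q)"
proof -
  have "{integral {0..1} (curve_speed A g \<gamma>) | \<gamma>. piecewise_C1_curve A \<gamma> \<and> \<gamma> 0 = p \<and> \<gamma> 1 = q} = lengths A g p q"
    (is "?X = _")
  proof (intro set_eqI iffI)
    fix L assume "L \<in> ?X"
    then obtain \<gamma> where \<gamma>: "piecewise_C1_curve A \<gamma>" "\<gamma> 0 = p" "\<gamma> 1 = q" "L = integral {0..1} (curve_speed A g \<gamma>)"
      by blast
    from \<gamma>(1) obtain S where S: "finite S" "\<forall>a b. 0 \<le> a \<and> a < b \<and> b \<le> 1 \<and> S \<inter> {a<..<b} = {} \<longrightarrow> C1_curve_on A a b \<gamma>"
      unfolding piecewise_C1_curve_def by (elim exE conjE)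
    have "\<exists>L'. curve_length A g \<gamma> 0 1 L'"
      by (rule piecewise_curve_length[OF S(1)]) (use S(2) in auto)
    then obtain L' where L': "curve_length A g \<gamma> 0 1 L'" ..
    have "L' = L" using curve_length_integral[OF L'] \<gamma> by (simp add: curve_speed_eq integral_unique)
    then show "L \<in> lengths A g p q" using L' \<gamma> by (auto simp: lengths_def)
  next
    fix L assume "L \<in> lengths A g p q"
    then obtain \<gamma> a b where \<gamma>: "curve_length A g \<gamma> a b L" "\<gamma> a = p" "\<gamma> b = q" by (auto simp: lengths_def)
    note ab = curve_length_less[OF \<gamma>(1)]
    let ?\<eta> = "\<lambda>t. \<gamma> ((b - a) * t + a)"
    have \<eta>: "curve_length A g ?\<eta> 0 1 L" using curve_length_affine[OF \<gamma>(1), of "b - a" a] ab by simp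
    have "L = integral {0..1} (curve_speed A g ?\<eta>)"
      using curve_length_integral[OF \<eta>] by (simp add: curve_speed_eq integral_unique)
    moreover have "piecewise_C1_curve A ?\<eta>"
      unfolding piecewise_C1_curve_def using curve_length_piecewise[OF \<eta>] by simp
    moreover have "?\<eta> 0 = p" "?\<eta> 1 = q" using \<gamma> by auto
    ultimately show "L \<in> ?X" by blast
  qed
  then show ?thesis by (simp add: riemannian_dist_def)
qed

lemma nearby_lengths:
  "\<exists>N. open N \<and> q \<in> N \<and> (\<forall>q'\<in>N. lengths A g q q' \<noteq> {})"
proof -
  let ?i = "chart_at A q"
  let ?x = "cmap A ?i q"
  obtain r where r: "r > 0" "ball ?x r \<subseteq> cimg A ?i"
    using chart(2) chart(7)[OF chart(9)] open_contains_ball by blast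
  let ?N = "{p \<in> cdom A ?i. cmap A ?i p \<in> ball ?x r}"
  have "lengths A g q q' \<noteq> {}" if q': "q' \<in> ?N" for q'
  proof -
    let ?c = "\<lambda>t::real. ?x + t *\<^sub>R (cmap A ?i q' - ?x)"
    have "?c t \<in> ball ?x r" if "t \<in> {0..1}" for t
    proof -
      have "norm (t *\<^sub>R (cmap A ?i q' - ?x)) \<le> norm (cmap A ?i q' - ?x)"
        using that by (simp add: mult_left_le_one_le)
      also have "\<dots> < r" using q' by (simp add: dist_norm norm_minus_commute)
      finally show ?thesis by (simp add: dist_norm)
    qed
    then have "C1_curve_on A 0 1 (cinv A ?i \<circ> ?c)"
      using r by (intro C1_curve_in_chart[OF smooth, where D="\<lambda>_. cmap A ?i q' - ?x"])
        (auto intro!: derivative_eq_intros)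
    from lengths_C1[OF _ this] q' show ?thesis by (auto simp: chart(5,9))
  qed
  moreover have "q \<in> ?N" using r chart(9) by simp
  ultimately show ?thesis using open_chart_preimage[OF smooth, of "ball ?x r" ?i] by blast
qed

text \<open>
  The points that can be reached from \<open>p\<close> form an open set, and so do the others, since all points
  of a small ball in a chart are joined to its center by a segment.
\<close>

lemma lengths_nonempty: "lengths A g p q \<noteq> {}"
proof -
  let ?R = "{q. lengths A g p q \<noteq> {}}"
  have trans: "lengths A g p r \<noteq> {}" if "lengths A g p q \<noteq> {}" "lengths A g q r \<noteq> {}" for q r
    using that lengths_join by blast
  have sym: "lengths A g r q \<noteq> {}" if "lengths A g q r \<noteq> {}" for q r
    using that lengths_sym by blast
  have "open ?R"
  proof (subst open_subopen, intro ballI)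
    fix q assume q: "q \<in> ?R"
    obtain N where N: "open N" "q \<in> N" "\<And>q'. q' \<in> N \<Longrightarrow> lengths A g q q' \<noteq> {}" using nearby_lengths[of q] by blast
    have "N \<subseteq> ?R" using trans[OF _ N(3)] q by blast
    with N(1,2) show "\<exists>T. open T \<and> q \<in> T \<and> T \<subseteq> ?R" by blast
  qed
  moreover have "open (- ?R)"
  proof (subst open_subopen, intro ballI)
    fix q assume q: "q \<in> - ?R"
    obtain N where N: "open N" "q \<in> N" "\<And>q'. q' \<in> N \<Longrightarrow> lengths A g q q' \<noteq> {}" using nearby_lengths[of q] by blast
    have "N \<subseteq> - ?R" using trans[OF _ sym[OF N(3)]] q by blast
    with N(1,2) show "\<exists>T. open T \<and> q \<in> T \<and> T \<subseteq> - ?R" by blast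
  qed
  moreover have "p \<in> ?R" using lengths_refl by auto
  moreover have "connected (UNIV :: 'a set)" using connected by (simp add: connected_manifold_def)
  ultimately have "?R = UNIV" unfolding connected_def by blast
  then show ?thesis by blast
qed

lemma bdd_below_lengths: "bdd_below (lengths A g p q)"
  by (rule bdd_belowI[of _ 0]) (rule lengths_nonneg)

lemma dist_le: "L \<in> lengths A g p q \<Longrightarrow> riemannian_dist A g p q \<le> L"
  unfolding riemannian_dist_eq by (rule cInf_lower[OF _ bdd_below_lengths])

lemma dist_approx: "riemannian_dist A g p q < l \<Longrightarrow> \<exists>L\<in>lengths A g p q. L < l"
  unfolding riemannian_dist_eq by (rule cInf_lessD[OF lengths_nonempty])

lemma dist_ge: "(\<And>L. L \<in> lengths A g p q \<Longrightarrow> l \<le> L) \<Longrightarrow> l \<le> riemannian_dist A g p q"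
  unfolding riemannian_dist_eq by (rule cInf_greatest[OF lengths_nonempty])

text \<open>
  The square of \<open>\<kappa>\<close> is the minimum of the metric over the compact set of unit vectors at points of the ball.
\<close>

lemma metric_lower_bound:
  assumes "cball x r \<subseteq> cimg A i" "r > 0"
  obtains \<kappa> where "\<kappa> > 0" "\<And>z v. z \<in> cball x r \<Longrightarrow> \<kappa> * norm v \<le> sqrt (g i z v v)"
proof -
  let ?K = "cball x r \<times> sphere (0::'e) 1"
  obtain e :: 'e where "e \<in> Basis" using nonempty_Basis by blast
  then have ne: "?K \<noteq> {}" using assms(2) by (auto intro!: exI[of _ e] simp: norm_Basis)
  have cont: "continuous_on ?K (\<lambda>p. g i (fst p) (snd p) (snd p))"
    by (intro metric_continuous_along[OF C1_metric[of i]] continuous_intros) (use assms in auto)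
  obtain m where m: "m \<in> ?K" "\<And>p. p \<in> ?K \<Longrightarrow> g i (fst m) (snd m) (snd m) \<le> g i (fst p) (snd p) (snd p)"
    using continuous_attains_inf[OF compact_Times[OF compact_cball compact_sphere] ne cont] by blast
  define \<mu> where "\<mu> = g i (fst m) (snd m) (snd m)"
  have "fst m \<in> cimg A i" "snd m \<noteq> 0" using m(1) assms by auto
  then have \<mu>: "\<mu> > 0" unfolding \<mu>_def by (rule positive)
  have "sqrt \<mu> * norm v \<le> sqrt (g i z v v)" if z: "z \<in> cball x r" for z v
  proof (cases "v = 0")
    case True
    then show ?thesis using nonneg[of z i 0] z assms by auto
  next
    case False
    let ?u = "(1 / norm v) *\<^sub>R v"
    have b: "bilinear (g i z)" using z assms by (intro C1_metric_onD(2)[OF C1_metric]) auto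
    have "\<mu> \<le> g i z ?u ?u" using m(2)[of "(z, ?u)"] z False by (simp add: \<mu>_def)
    also have "\<dots> = g i z v v / (norm v)\<^sup>2"
      by (simp add: bilinear_lmul[OF b] bilinear_rmul[OF b] power2_eq_square)
    finally have "\<mu> * (norm v)\<^sup>2 \<le> g i z v v" using False by (simp add: pos_le_divide_eq)
    then have "sqrt (\<mu> * (norm v)\<^sup>2) \<le> sqrt (g i z v v)" by (rule real_sqrt_le_mono)
    then show ?thesis by (simp add: real_sqrt_mult)
  qed
  with \<mu> show thesis by (intro that[of "sqrt \<mu>"]) auto
qed

text \<open>
  The function \<open>max 0 (r - |x - z|)\<close> of the chart coordinate \<open>z\<close>, extended by \<open>0\<close>.
\<close>

definition bump :: "'i \<Rightarrow> 'e \<Rightarrow> real \<Rightarrow> 'a \<Rightarrow> real" where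
  "bump i x r p = (if p \<in> cdom A i \<and> dist x (cmap A i p) < r then r - dist x (cmap A i p) else 0)"

text \<open>
  Up to the factor \<open>\<kappa>\<close> a bump function is 1-Lipschitz for lengths, hence separates its center from all
  other points. As long as a curve stays in the ball, its Euclidean length there is at most
  \<open>1/\<kappa>\<close> times its length. A curve that leaves the ball has come arbitrarily close to the boundary,
  where the bump function is small.
\<close>

lemma bump_decrease:
  assumes r: "cball x r \<subseteq> cimg A i" "r > 0"
    and \<kappa>: "\<kappa> > 0" "\<And>z v. z \<in> cball x r \<Longrightarrow> \<kappa> * norm v \<le> sqrt (g i z v v)"
  shows "curve_length A g \<gamma> a b L \<Longrightarrow> \<kappa> * (bump i x r (\<gamma> a) - bump i x r (\<gamma> b)) \<le> L"
proof (induction rule: curve_length.induct)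
  case (C1 a b)
  note C = C1_curve_onD[OF C1(2,1)]
  let ?s = "speed A g \<gamma> {a..b}"
  let ?U = "{p \<in> cdom A i. cmap A i p \<in> ball x r}"
  have int: "?s integrable_on {a..b}" by (rule speed_integrable[OF C1(2,1)])
  have inside: "\<kappa> * (bump i x r (\<gamma> a) - bump i x r (\<gamma> t)) \<le> integral {a..b} ?s"
    if t: "a < t" "t \<le> b" "\<And>s. s \<in> {a..t} \<Longrightarrow> \<gamma> s \<in> ?U" for t
  proof -
    let ?c = "cmap A i \<circ> \<gamma>"
    let ?D = "\<lambda>s. vector_derivative ?c (at s within {a..b})"
    have "(?D has_integral ?c t - ?c a) {a..t}"
      using t by (intro fundamental_theorem_of_calculus has_vector_derivative_within_subset[OF C(2)]) auto
    moreover have i1: "(\<lambda>s. ?s s / \<kappa>) integrable_on {a..t}"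
      by (intro integrable_on_divide integrable_on_subinterval[OF int]) (use t in auto)
    moreover have "norm (?D s) \<le> ?s s / \<kappa>" if s: "s \<in> {a..t}" for s
    proof -
      have "\<kappa> * norm (?D s) \<le> sqrt (g i (cmap A i (\<gamma> s)) (?D s) (?D s))"
        by (rule \<kappa>(2)) (use t(3)[OF s] in auto)
      also have "\<dots> = ?s s" by (rule speed_C1[OF C1(2,1), symmetric]) (use t(1,2) t(3)[OF s] s in auto)
      finally show ?thesis using \<kappa>(1) by (simp add: pos_le_divide_eq mult.commute)
    qed
    ultimately have "norm (?c t - ?c a) \<le> integral {a..t} (\<lambda>s. ?s s / \<kappa>)"
      using Henstock_Kurzweil_Integration.integral_norm_bound_integral[of ?D "{a..t}" "\<lambda>s. ?s s / \<kappa>"]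
      by (simp add: integral_unique has_integral_integrable)
    also have "\<dots> \<le> integral {a..b} (\<lambda>s. ?s s / \<kappa>)"
      by (rule integral_subset_le[OF _ i1]) (use t \<kappa> int speed_nonneg in auto)
    finally have "\<kappa> * norm (?c t - ?c a) \<le> integral {a..b} ?s" using \<kappa>(1) by (simp add: field_simps)
    moreover have "bump i x r (\<gamma> a) - bump i x r (\<gamma> t) \<le> norm (?c t - ?c a)"
      using t(1) t(3)[of a] t(3)[of t] dist_triangle[of x "?c t" "?c a"]
      by (simp add: bump_def dist_norm norm_minus_commute)
    ultimately show ?thesis using \<kappa>(1) by (meson mult_left_mono order_trans less_imp_le)
  qed
  have bump_pos: "bump i x r p \<ge> 0" for p by (simp add: bump_def)
  have L: "integral {a..b} ?s \<ge> 0" by (intro Henstock_Kurzweil_Integration.integral_nonneg int speed_nonneg)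
  show ?case
  proof (rule ccontr)
    assume "\<not> ?thesis"
    then have neg: "integral {a..b} ?s < \<kappa> * (bump i x r (\<gamma> a) - bump i x r (\<gamma> b))" by simp
    \<comment> \<open>A curve that is too short keeps the bump function above \<open>\<delta>\<close> as long as it is in the ball: it then
      stays in a smaller closed ball, which is compact, so that there is no first exit time \<open>\<tau>\<close>.\<close>
    define \<delta> where "\<delta> = bump i x r (\<gamma> a) - integral {a..b} ?s / \<kappa>"
    have "integral {a..b} ?s < \<kappa> * bump i x r (\<gamma> a)"
      using neg \<kappa>(1) bump_pos[of "\<gamma> b"] by (smt (verit) mult_left_mono)
    then have \<delta>: "\<delta> > 0" using \<kappa>(1) by (simp add: \<delta>_def field_simps)
    have aU: "\<gamma> a \<in> ?U"
      using \<delta> L \<kappa>(1) by (auto simp: \<delta>_def bump_def split: if_splits) (smt (verit) divide_nonneg_pos)+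
    have stay: "bump i x r (\<gamma> t) \<ge> \<delta>" if "a < t" "t \<le> b" "\<And>s. s \<in> {a..t} \<Longrightarrow> \<gamma> s \<in> ?U" for t
      using inside[OF that] \<kappa>(1) by (simp add: \<delta>_def field_simps)
    let ?E = "{t \<in> {a..b}. \<gamma> t \<notin> ?U}"
    have "?E \<noteq> {}"
    proof
      assume "?E = {}"
      then show False using inside[of b] C1(1) neg by auto
    qed
    have "open ?U" by (rule open_chart_preimage[OF smooth]) simp
    then have "closed ({a..b} \<inter> \<gamma> -` (- ?U))"
      by (intro continuous_closed_preimage[OF C(1)]) auto
    then have "closed ?E" by (simp add: vimage_def Int_def)
    moreover have "bounded ?E" by (rule bounded_subset[of "{a..b}"]) auto
    ultimately have "compact ?E" by (simp add: compact_eq_bounded_closed)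
    then obtain \<tau> where \<tau>: "\<tau> \<in> ?E" "\<And>t. t \<in> ?E \<Longrightarrow> \<tau> \<le> t"
      using compact_attains_inf[of ?E] \<open>?E \<noteq> {}\<close> by blast
    have "a < \<tau>" using \<tau>(1) aU by (cases "a = \<tau>") auto
    have before: "\<gamma> t \<in> ?U" if "a \<le> t" "t < \<tau>" for t using \<tau> that by force
    let ?K = "cinv A i ` cball x (r - \<delta>)"
    have "compact ?K"
      by (intro compact_continuous_image continuous_on_subset[OF chart(4)]) (use r \<delta> in auto)
    then have "closed ({a..b} \<inter> \<gamma> -` ?K)"
      by (intro continuous_closed_preimage[OF C(1)] compact_imp_closed) auto
    moreover have "{a<..<\<tau>} \<subseteq> {a..b} \<inter> \<gamma> -` ?K"
    proof
      fix t assume t: "t \<in> {a<..<\<tau>}"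
      have "\<delta> \<le> bump i x r (\<gamma> t)" using t \<tau>(1) before by (intro stay) auto
      then have "dist x (cmap A i (\<gamma> t)) \<le> r - \<delta>" "\<gamma> t \<in> cdom A i"
        using before[of t] t by (auto simp: bump_def)
      then show "t \<in> {a..b} \<inter> \<gamma> -` ?K"
        using t \<tau>(1) by (auto intro!: image_eqI[of _ _ "cmap A i (\<gamma> t)"] simp: chart(5))
    qed
    ultimately have "closure {a<..<\<tau>} \<subseteq> {a..b} \<inter> \<gamma> -` ?K" by (rule closure_minimal[rotated])
    moreover have "\<tau> \<in> closure {a<..<\<tau>}" using \<open>a < \<tau>\<close> by simp
    ultimately have "\<gamma> \<tau> \<in> ?K" by blast
    then obtain y where y: "y \<in> cball x (r - \<delta>)" "\<gamma> \<tau> = cinv A i y" by auto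
    then have "y \<in> cimg A i" using r \<delta> by auto
    then have "\<gamma> \<tau> \<in> ?U" using y \<delta> by (auto simp: chart(6,8))
    then show False using \<tau>(1) by auto
  qed
next
  case (join a b L c L')
  then show ?case by (simp add: algebra_simps)
qed

lemma dist_pos:
  assumes "p \<noteq> q"
  shows "riemannian_dist A g p q > 0"
proof -
  let ?i = "chart_at A p"
  let ?x = "cmap A ?i p"
  obtain r where r: "r > 0" "cball ?x r \<subseteq> cimg A ?i"
    using chart(2) chart(7)[OF chart(9)] open_contains_cball by blast
  obtain \<kappa> where \<kappa>: "\<kappa> > 0" "\<And>z v. z \<in> cball ?x r \<Longrightarrow> \<kappa> * norm v \<le> sqrt (g ?i z v v)"
    using metric_lower_bound[OF r(2,1)] by blast
  have p: "bump ?i ?x r p = r" using r chart(9) by (simp add: bump_def)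
  have "?x \<noteq> cmap A ?i q" if "q \<in> cdom A ?i" using that assms chart(5,9) by metis
  then have q: "bump ?i ?x r q < r" using r by (auto simp: bump_def)
  have "\<kappa> * (bump ?i ?x r p - bump ?i ?x r q) \<le> riemannian_dist A g p q"
    by (rule dist_ge) (use bump_decrease[OF r(2,1) \<kappa>] in \<open>auto simp: lengths_def\<close>)
  moreover have "\<kappa> * (bump ?i ?x r p - bump ?i ?x r q) > 0" using p q \<kappa> by simp
  ultimately show ?thesis by linarith
qed

lemma Metric_space: "Metric_space UNIV (riemannian_dist A g)"
proof
  show nn: "0 \<le> riemannian_dist A g p q" for p q by (rule dist_ge) (rule lengths_nonneg)
  show "riemannian_dist A g p q = riemannian_dist A g q p" for p q
    unfolding riemannian_dist_eq using lengths_sym by (metis equalityI subsetI)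
  show "riemannian_dist A g p q = 0 \<longleftrightarrow> p = q" for p q
    using dist_pos[of p q] dist_le[OF lengths_refl, of q] nn[of p q] by force
  show "riemannian_dist A g p r \<le> riemannian_dist A g p q + riemannian_dist A g q r" for p q r
  proof (rule field_le_epsilon)
    fix e :: real assume "e > 0"
    then obtain L L' where "L \<in> lengths A g p q" "L < riemannian_dist A g p q + e / 2"
      "L' \<in> lengths A g q r" "L' < riemannian_dist A g q r + e / 2"
      using dist_approx[of p q "riemannian_dist A g p q + e / 2"] dist_approx[of q r "riemannian_dist A g q r + e / 2"]
      by auto
    with dist_le[OF lengths_join, of L p q L' r]
    show "riemannian_dist A g p r \<le> riemannian_dist A g p q + riemannian_dist A g q r + e" by linarith
  qed
qed

end

section \<open>Lifting along local isometries\<close>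

text \<open>
  A path \<open>\<gamma>\<close> whose increments are controlled by the increments of \<open>len\<close> is followed in the source by
  points \<open>q\<close> over \<open>\<gamma> t\<close>, such that the distance between two of them is at most the increment of \<open>len\<close>. The
  pairs \<open>(t, q)\<close>, ordered by this relation, satisfy the hypothesis of Zorn's lemma: along a chain the
  points \<open>q\<close> are Cauchy, and their limit lies over the limit of \<open>\<gamma>\<close>. A maximal pair has \<open>t = b\<close>,
  since otherwise it could be extended by \<open>step\<close>.
\<close>

lemma endpoint_lift:
  fixes dB :: "'b \<Rightarrow> 'b \<Rightarrow> real" and dA :: "'a \<Rightarrow> 'a \<Rightarrow> real" and \<gamma> :: "real \<Rightarrow> 'a"
  assumes MB: "Metric_space UNIV dB" and MA: "Metric_space UNIV dA"
    and complete: "Metric_space.mcomplete UNIV dB"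
    and lip: "\<And>p q. dA (\<phi> p) (\<phi> q) \<le> dB p q"
    and ab: "a \<le> b" and cont: "continuous_on {a..b} len"
    and mono: "\<And>s t. a \<le> s \<Longrightarrow> s \<le> t \<Longrightarrow> t \<le> b \<Longrightarrow> dA (\<gamma> s) (\<gamma> t) \<le> len t - len s"
    and step: "\<And>t q. a \<le> t \<Longrightarrow> t < b \<Longrightarrow> \<phi> q = \<gamma> t \<Longrightarrow> \<exists>t' q'. t < t' \<and> t' \<le> b \<and> \<phi> q' = \<gamma> t' \<and> dB q q' \<le> len t' - len t"
    and start: "\<phi> p = \<gamma> a"
  shows "\<exists>q. \<phi> q = \<gamma> b \<and> dB p q \<le> len b - len a"
proof -
  interpret MB: Metric_space UNIV dB by (rule MB)
  interpret MA: Metric_space UNIV dA by (rule MA)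
  have mono': "len s \<le> len t" if "a \<le> s" "s \<le> t" "t \<le> b" for s t
    using mono[OF that] MA.nonneg[of "\<gamma> s" "\<gamma> t"] by linarith
  define X where "X = {(t, q). a \<le> t \<and> t \<le> b \<and> \<phi> q = \<gamma> t \<and> dB p q \<le> len t - len a}"
  define P where "P = (\<lambda>(t, q) (t', q'). t \<le> t' \<and> dB q q' \<le> len t' - len t)"
  have po: "partial_order_on X (relation_of P X)"
  proof (rule partial_order_on_relation_ofI)
    show "P x x" for x by (auto simp: P_def split: prod.splits)
    show "P x z" if "P x y" "P y z" for x y z
      using that MB.triangle[of "snd x" "snd y" "snd z"] by (auto simp: P_def split: prod.splits)
    show "x = y" if "P x y" "P y x" for x y
      using that MB.zero[of "snd x" "snd y"] MB.nonneg[of "snd x" "snd y"]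
      by (auto simp: P_def simp del: MB.nonneg split: prod.splits)
  qed
  have "\<exists>m\<in>X. \<forall>x\<in>X. P m x \<longrightarrow> x = m"
  proof (rule predicate_Zorn[OF po])
    fix C assume C: "C \<in> Chains (relation_of P X)"
    have CX: "C \<subseteq> X" and Ct: "\<And>x y. x \<in> C \<Longrightarrow> y \<in> C \<Longrightarrow> P x y \<or> P y x"
      using C by (auto simp: Chains_def relation_of_def)
    show "\<exists>u\<in>X. \<forall>x\<in>C. P x u"
    proof (cases "C = {}")
      case True
      have "(a, p) \<in> X" using ab start by (simp add: X_def)
      with True show ?thesis by blast
    next
      case False
      define T where "T = Sup (fst ` C)"
      have le: "fst x \<le> b" "a \<le> fst x" if "x \<in> C" for x using CX that by (auto simp: X_def)
      have bdd: "bdd_above (fst ` C)" by (rule bdd_aboveI[of _ b]) (use le in auto)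
      have T_ge: "fst x \<le> T" if "x \<in> C" for x
        unfolding T_def using that by (intro cSup_upper bdd) auto
      have "T \<le> b" unfolding T_def using False le by (intro cSup_least) auto
      have "a \<le> T" using False le(2) T_ge by force
      \<comment> \<open>The absolute value covers both cases for the comparable pairs \<open>x\<close> and \<open>y\<close>.\<close>
      have comp: "dB (snd x) (snd y) \<le> \<bar>len (fst y) - len (fst x)\<bar>" if "x \<in> C" "y \<in> C" for x y
        using Ct[OF that] MB.commute[of "snd x" "snd y"] by (auto simp: P_def split: prod.splits)
      have "\<exists>x\<in>C. T - inverse (real (Suc n)) < fst x" for n
      proof -
        have "T - inverse (real (Suc n)) < Sup (fst ` C)" by (simp add: T_def)
        then show ?thesis using less_cSupE[of _ "fst ` C"] False by blast
      qed
      then obtain x where x: "\<And>n. x n \<in> C" "\<And>n. T - inverse (real (Suc n)) < fst (x n)" by metis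
      have tT: "(\<lambda>n. fst (x n)) \<longlonglongrightarrow> T"
      proof (rule real_tendsto_sandwich)
        show "(\<lambda>n. T - inverse (real (Suc n))) \<longlonglongrightarrow> T"
          using tendsto_diff[OF tendsto_const LIMSEQ_inverse_real_of_nat, of T] by simp
        show "(\<lambda>n. T) \<longlonglongrightarrow> T" by simp
        show "\<forall>\<^sub>F n in sequentially. T - inverse (real (Suc n)) \<le> fst (x n)"
          using x(2) by (intro always_eventually allI less_imp_le)
        show "\<forall>\<^sub>F n in sequentially. fst (x n) \<le> T"
          using T_ge[OF x(1)] by (intro always_eventually allI)
      qed
      have lT: "(\<lambda>n. len (fst (x n))) \<longlonglongrightarrow> len T"
        by (rule continuous_on_tendsto_compose[OF cont tT])
          (use x le \<open>a \<le> T\<close> \<open>T \<le> b\<close> in auto)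
      have "MB.MCauchy (\<lambda>n. snd (x n))"
        unfolding MB.MCauchy_def
      proof (intro conjI allI impI)
        fix e :: real assume e: "e > 0"
        have "Cauchy (\<lambda>n. len (fst (x n)))" using lT by (simp add: LIMSEQ_imp_Cauchy)
        then obtain N where N: "\<And>m n. m \<ge> N \<Longrightarrow> n \<ge> N \<Longrightarrow> dist (len (fst (x m))) (len (fst (x n))) < e"
          using e unfolding Cauchy_def by blast
        have "dB (snd (x n)) (snd (x n')) < e" if "N \<le> n" "N \<le> n'" for n n'
          using comp[OF x(1) x(1), of n n'] N[OF that(2,1)] by (simp add: dist_real_def)
        then show "\<exists>N. \<forall>n n'. N \<le> n \<longrightarrow> N \<le> n' \<longrightarrow> dB (snd (x n)) (snd (x n')) < e" by blast
      qed simp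
      then obtain q where q: "limitin MB.mtopology (\<lambda>n. snd (x n)) q sequentially"
        using complete unfolding MB.mcomplete_def by blast
      have dq: "(\<lambda>n. dB (snd (x n)) q) \<longlonglongrightarrow> 0"
        using q unfolding MB.limitin_metric tendsto_iff by simp
      have bound: "dB y q \<le> l" if "\<And>n. dB y (snd (x n)) \<le> f n" "f \<longlonglongrightarrow> l" for y f l
      proof (rule LIMSEQ_le_const)
        show "(\<lambda>n. f n + dB (snd (x n)) q) \<longlonglongrightarrow> l" using tendsto_add[OF that(2) dq] by simp
        have "dB y q \<le> f n + dB (snd (x n)) q" for n
          using MB.triangle[of y "snd (x n)" q] that(1)[of n] by simp
        then show "\<exists>N. \<forall>n\<ge>N. dB y q \<le> f n + dB (snd (x n)) q" by blast
      qed
      have \<phi>x: "\<phi> (snd (x n)) = \<gamma> (fst (x n))" "dB p (snd (x n)) \<le> len (fst (x n)) - len a" for n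
        using CX x(1)[of n] by (auto simp: X_def)
      have "dA (\<gamma> T) (\<phi> q) \<le> 0"
      proof (rule LIMSEQ_le_const)
        show "(\<lambda>n. (len T - len (fst (x n))) + dB (snd (x n)) q) \<longlonglongrightarrow> 0"
          using tendsto_add[OF tendsto_diff[OF tendsto_const[of "len T"] lT] dq] by simp
        have "dA (\<gamma> T) (\<phi> q) \<le> (len T - len (fst (x n))) + dB (snd (x n)) q" for n
          using MA.triangle[of "\<gamma> T" "\<gamma> (fst (x n))" "\<phi> q"] lip[of "snd (x n)" q] \<phi>x(1)[of n]
            mono[OF le(2)[OF x(1)] T_ge[OF x(1)] \<open>T \<le> b\<close>, of n] MA.commute[of "\<gamma> T" "\<gamma> (fst (x n))"] by simp
        then show "\<exists>N. \<forall>n\<ge>N. dA (\<gamma> T) (\<phi> q) \<le> (len T - len (fst (x n))) + dB (snd (x n)) q" by blast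
      qed
      then have "\<phi> q = \<gamma> T" using MA.zero[of "\<gamma> T" "\<phi> q"] MA.nonneg[of "\<gamma> T" "\<phi> q"] by auto
      moreover have "dB p q \<le> len T - len a"
        by (rule bound[OF \<phi>x(2)]) (intro tendsto_diff lT tendsto_const)
      ultimately have "(T, q) \<in> X" using \<open>a \<le> T\<close> \<open>T \<le> b\<close> by (simp add: X_def)
      moreover have "P y (T, q)" if y: "y \<in> C" for y
      proof -
        have "dB (snd y) q \<le> \<bar>len T - len (fst y)\<bar>"
          by (rule bound[OF comp[OF y x(1)]]) (intro tendsto_rabs tendsto_diff lT tendsto_const)
        moreover have "len (fst y) \<le> len T" using mono' le(2)[OF y] T_ge[OF y] \<open>T \<le> b\<close> by blast
        ultimately show ?thesis using T_ge[OF y] by (auto simp: P_def split: prod.splits)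
      qed
      ultimately show ?thesis by blast
    qed
  qed
  then obtain T q where m: "(T, q) \<in> X" "\<And>x. x \<in> X \<Longrightarrow> P (T, q) x \<Longrightarrow> x = (T, q)" by auto
  have "T = b"
  proof (rule ccontr)
    assume "T \<noteq> b"
    then obtain t' q' where t': "T < t'" "t' \<le> b" "\<phi> q' = \<gamma> t'" "dB q q' \<le> len t' - len T"
      using step[of T q] m(1) by (auto simp: X_def)
    have "(t', q') \<in> X" using t' m(1) MB.triangle[of p q q'] by (auto simp: X_def)
    then show False using m(2)[of "(t', q')"] t' by (simp add: P_def)
  qed
  then show ?thesis using m(1) by (auto simp: X_def)
qed

text \<open>
  A Cauchy sequence has a subsequence with summable distances between consecutive terms. It lifts term
  by term to a sequence with the same property, whose limit is mapped to a limit of the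
  subsequence.
\<close>

lemma mcomplete_of_lifting:
  assumes MB: "Metric_space UNIV dB" and MA: "Metric_space UNIV dA"
    and complete: "Metric_space.mcomplete UNIV dB"
    and lip: "\<And>p q. dA (\<phi> p) (\<phi> q) \<le> dB p q"
    and surj: "surj \<phi>"
    and lift: "\<And>p x e. dA (\<phi> p) x < e \<Longrightarrow> \<exists>q. \<phi> q = x \<and> dB p q < e"
  shows "Metric_space.mcomplete UNIV dA"
proof -
  interpret MB: Metric_space UNIV dB by (rule MB)
  interpret MA: Metric_space UNIV dA by (rule MA)
  show ?thesis
    unfolding MA.mcomplete_def
  proof (intro allI impI)
    fix \<sigma> assume \<sigma>: "MA.MCauchy \<sigma>"
    have "\<exists>N. \<forall>n n'. N \<le> n \<longrightarrow> N \<le> n' \<longrightarrow> dA (\<sigma> n) (\<sigma> n') < (1/2) ^ k" for k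
      using \<sigma> unfolding MA.MCauchy_def by simp
    then obtain N where N: "\<And>k n n'. N k \<le> n \<Longrightarrow> N k \<le> n' \<Longrightarrow> dA (\<sigma> n) (\<sigma> n') < (1/2) ^ k" by metis
    \<comment> \<open>strictly increasing, and \<open>r n\<close> is at least \<open>N n\<close>\<close>
    define r where "r n = n + (\<Sum>k\<le>n. N k)" for n
    have r: "strict_mono r" by (rule strict_monoI_Suc) (simp add: r_def)
    have rN: "N n \<le> r n" for n unfolding r_def by (rule trans_le_add2) (simp add: member_le_sum)
    have near: "dA (\<sigma> (r n)) (\<sigma> (r (Suc n))) < (1/2) ^ n" for n
      using N[of n] rN[of n] strict_mono_less_eq[OF r, of n "Suc n"] by (meson le_SucI le_refl order_trans)
    have "\<exists>p. \<forall>n. \<phi> (p n) = \<sigma> (r n) \<and> dB (p n) (p (Suc n)) < (1/2) ^ n"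
    proof (rule dependent_nat_choice)
      show "\<exists>p. \<phi> p = \<sigma> (r 0)" using surj by (metis surjD)
      show "\<exists>q. \<phi> q = \<sigma> (r (Suc n)) \<and> dB p q < (1/2) ^ n" if "\<phi> p = \<sigma> (r n)" for p n
        using lift near that by metis
    qed
    then obtain p where p: "\<And>n. \<phi> (p n) = \<sigma> (r n)" "\<And>n. dB (p n) (p (Suc n)) < (1/2) ^ n" by blast
    \<comment> \<open>the geometric series in a form that has no slack in the induction\<close>
    have geo: "dB (p m) (p (m + k)) \<le> 2 * (1/2) ^ m - 2 * (1/2) ^ (m + k)" for m k
    proof (induction k)
      case (Suc k)
      then show ?case using MB.triangle[of "p m" "p (m + k)" "p (Suc (m + k))"] p(2)[of "m + k"] by simp
    qed simp
    have geo': "dB (p m) (p n) \<le> 2 * (1/2) ^ m" if "m \<le> n" for m n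
    proof -
      have "dB (p m) (p n) \<le> 2 * (1/2) ^ m - 2 * (1/2) ^ n" using geo[of m "n - m"] that by simp
      moreover have "0 \<le> 2 * (1/2::real) ^ n" by simp
      ultimately show ?thesis by linarith
    qed
    have "MB.MCauchy p"
      unfolding MB.MCauchy_def
    proof (intro conjI allI impI)
      fix e :: real assume e: "e > 0"
      obtain K where K: "(1/2::real) ^ K < e / 2" using real_arch_pow_inv[of "e/2" "1/2"] e by auto
      have "dB (p m) (p n) < e" if "K \<le> m" "K \<le> n" for m n
      proof -
        have *: "dB (p m) (p n) < e" if "K \<le> m" "m \<le> n" for m n
        proof -
          have "(1/2::real) ^ m \<le> (1/2) ^ K" by (rule power_decreasing[OF that(1)]) auto
          then show ?thesis using geo'[OF that(2)] K by linarith
        qed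
        show ?thesis using *[of m n] *[of n m] that MB.commute[of "p m" "p n"] by (cases "m \<le> n") auto
      qed
      then show "\<exists>N. \<forall>n n'. N \<le> n \<longrightarrow> N \<le> n' \<longrightarrow> dB (p n) (p n') < e" by blast
    qed simp
    then obtain q where q: "limitin MB.mtopology p q sequentially"
      using complete unfolding MB.mcomplete_def by blast
    have "limitin MA.mtopology (\<sigma> \<circ> r) (\<phi> q) sequentially"
      unfolding MA.limitin_metric
    proof (intro conjI allI impI)
      fix e :: real assume "e > 0"
      then have "\<forall>\<^sub>F n in sequentially. dB (p n) q < e" using q unfolding MB.limitin_metric by simp
      then show "\<forall>\<^sub>F n in sequentially. (\<sigma> \<circ> r) n \<in> UNIV \<and> dA ((\<sigma> \<circ> r) n) (\<phi> q) < e"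
      proof eventually_elim
        case (elim n)
        then show ?case using lip[of "p n" q] p(1)[of n] by simp
      qed
    qed simp
    then show "\<exists>x. limitin MA.mtopology \<sigma> x sequentially"
      using MA.MCauchy_convergent_subsequence[OF \<sigma> r] by blast
  qed
qed

locale riemannian_local_isometry =
  src: riemannian_manifold B h + tgt: riemannian_manifold A k
  for B :: "('j, 'b::{t2_space, second_countable_topology}, real ^ 'n) atlas"
    and h :: "('j, real ^ 'n) metric"
    and A :: "('i, 'a::{t2_space, second_countable_topology}, real ^ 'n) atlas"
    and k :: "('i, real ^ 'n) metric" +
  fixes \<phi> :: "'b \<Rightarrow> 'a"
  assumes smooth_map: "smooth_map B A \<phi>"
    and isometric: "\<And>i j. isometric_on (local_dom B A \<phi> i j) (h i) (k j) (local_map B A \<phi> i j)"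
begin

abbreviation "F \<equiv> local_map B A \<phi>"
abbreviation "W \<equiv> local_dom B A \<phi>"
abbreviation "dB \<equiv> riemannian_dist B h"
abbreviation "dA \<equiv> riemannian_dist A k"

lemma cont: "continuous_on UNIV \<phi>"
  using smooth_map by (simp add: smooth_map_def)

lemma smooth_F: "Ck_on m (W i j) (F i j)"
  using smooth_map by (simp add: smooth_map_def smooth_on_def)

lemma W_iff: "y \<in> W i j \<longleftrightarrow> y \<in> cimg B i \<and> \<phi> (cinv B i y) \<in> cdom A j"
  by (rule local_dom_iff[OF src.smooth])

lemma open_W: "open (W i j)"
  by (rule open_local_dom[OF src.smooth cont tgt.chart(1)])

lemma F_diff: "y \<in> W i j \<Longrightarrow> F i j differentiable (at y)"
  using smooth_F[of "Suc 0"] by auto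

lemma F_image: "F i j ` W i j \<subseteq> cimg A j"
  by (auto simp: W_iff local_map_apply tgt.chart(7))

lemma C1_metric_W: "C1_metric_on (W i j) (h i)"
  using src.C1_metric[of i] open_W[of i j] unfolding C1_metric_on_def
  by (auto simp: W_iff simp del: Ck_on.simps intro: Ck_on_subset[where S="cimg B i"])

lemma F_bij:
  assumes "y \<in> W i j"
  shows "inj (fd (F i j) y)" "surj (fd (F i j) y)"
  using isometric_deriv_inj[OF C1_metric_W tgt.C1_metric assms _ F_diff[OF assms] isometric] F_image assms by blast+

text \<open>
  The velocity of the image is the image of the velocity under the derivative of \<open>\<phi>\<close> in charts, which is
  isometric.
\<close>

lemma image_curve:
  assumes C: "C1_curve_on B a b \<gamma>" and ab: "a < b"
  shows "C1_curve_on A a b (\<phi> \<circ> \<gamma>)"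
    and "t \<in> {a..b} \<Longrightarrow> speed A k (\<phi> \<circ> \<gamma>) {a..b} t = speed B h \<gamma> {a..b} t"
proof -
  note D = C1_curve_onD[OF C ab]
  let ?i = "\<lambda>t. chart_at B (\<gamma> t)" and ?j = "\<lambda>t. chart_at A (\<phi> (\<gamma> t))"
  have c\<phi>\<gamma>: "continuous_on {a..b} (\<phi> \<circ> \<gamma>)"
    by (intro continuous_on_compose D(1) continuous_on_subset[OF cont]) auto
  have inW: "cmap B i (\<gamma> s) \<in> W i j" if "\<gamma> s \<in> cdom B i" "\<phi> (\<gamma> s) \<in> cdom A j" for i j s
    using that src.chart by (simp add: W_iff)
  have vel: "((cmap A j \<circ> (\<phi> \<circ> \<gamma>)) has_vector_derivative
      fd (F i j) (cmap B i (\<gamma> s)) (vector_derivative (cmap B i \<circ> \<gamma>) (at s within {a..b}))) (at s within {a..b})"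
    if "s \<in> {a..b}" "\<gamma> s \<in> cdom B i" "\<phi> (\<gamma> s) \<in> cdom A j" for i j s
    by (rule velocity_image[OF src.smooth _ that(2) D(2)[OF that(1,2)] that(1) F_diff[OF inW[OF that(2,3)]]])
      (use D(1) that in \<open>simp add: continuous_on_eq_continuous_within\<close>)
  show C': "C1_curve_on A a b (\<phi> \<circ> \<gamma>)"
  proof (rule C1_curve_onI[OF tgt.smooth ab c\<phi>\<gamma>])
    fix t assume t: "t \<in> {a..b}"
    let ?D = "\<lambda>s. vector_derivative (cmap B (?i t) \<circ> \<gamma>) (at s within {a..b})"
    obtain U where U: "open U" "t \<in> U" "\<And>s. s \<in> {a..b} \<inter> U \<Longrightarrow> \<gamma> s \<in> cdom B (?i t)"
      "continuous_on ({a..b} \<inter> U) ?D" "continuous_on ({a..b} \<inter> U) (\<lambda>s. cmap B (?i t) (\<gamma> s))"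
      by (rule C1_curve_on_local[OF src.smooth C ab t src.chart(9)], rule that)
    obtain V where V: "open V" "V \<inter> {a..b} = (\<phi> \<circ> \<gamma>) -` cdom A (?j t) \<inter> {a..b}"
      using c\<phi>\<gamma> tgt.chart(1) unfolding continuous_on_open_invariant by blast
    have V': "\<phi> (\<gamma> s) \<in> cdom A (?j t)" if "s \<in> {a..b}" "s \<in> V" for s using V(2) that by auto
    have tV: "t \<in> V" using V(2) t tgt.chart(9)[of "\<phi> (\<gamma> t)"] by auto
    let ?E = "\<lambda>s. fd (F (?i t) (?j t)) (cmap B (?i t) (\<gamma> s)) (?D s)"
    have "continuous_on ({a..b} \<inter> (U \<inter> V)) ?E"
      by (rule continuous_on_fd_apply[OF smooth_F[of _ "?i t" "?j t"]])
        (use U V' inW in \<open>auto intro: continuous_on_subset\<close>)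
    moreover have "((cmap A (?j t) \<circ> (\<phi> \<circ> \<gamma>)) has_vector_derivative ?E s) (at s within {a..b})"
      if "s \<in> {a..b} \<inter> (U \<inter> V)" for s
      using that U(3) V' by (intro vel) auto
    ultimately show "\<exists>i D U. open U \<and> t \<in> U \<and> continuous_on ({a..b} \<inter> U) D \<and>
        (\<forall>s\<in>{a..b} \<inter> U. (\<phi> \<circ> \<gamma>) s \<in> cdom A i \<and> ((cmap A i \<circ> (\<phi> \<circ> \<gamma>)) has_vector_derivative D s) (at s within {a..b}))"
      using U(1,2) V(1) tV V'
      by (intro exI[of _ "?j t"] exI[of _ ?E] exI[of _ "U \<inter> V"]) auto
  qed
  show "speed A k (\<phi> \<circ> \<gamma>) {a..b} t = speed B h \<gamma> {a..b} t" if t: "t \<in> {a..b}"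
  proof -
    let ?w = "vector_derivative (cmap B (?i t) \<circ> \<gamma>) (at t within {a..b})"
    have ct: "continuous (at t within {a..b}) (\<phi> \<circ> \<gamma>)"
      using c\<phi>\<gamma> t unfolding continuous_on_eq_continuous_within by blast
    have "speed A k (\<phi> \<circ> \<gamma>) {a..b} t = sqrt (k (?j t) (cmap A (?j t) ((\<phi> \<circ> \<gamma>) t))
        (fd (F (?i t) (?j t)) (cmap B (?i t) (\<gamma> t)) ?w) (fd (F (?i t) (?j t)) (cmap B (?i t) (\<gamma> t)) ?w))"
      by (rule tgt.speed_in_chart[OF ct _ t at_within_Icc_neq_bot[OF ab t] vel[OF t src.chart(9) tgt.chart(9)]])
        (simp add: tgt.chart(9))
    also have "\<dots> = sqrt (h (?i t) (cmap B (?i t) (\<gamma> t)) ?w ?w)"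
      using isometric[of "?i t" "?j t"] inW[OF src.chart(9) tgt.chart(9)]
      by (simp add: isometric_on_def local_map_apply src.chart(5,9))
    also have "\<dots> = speed B h \<gamma> {a..b} t" by (rule src.speed_C1[OF C ab t src.chart(9), symmetric])
    finally show ?thesis .
  qed
qed

lemma curve_length_image: "curve_length B h \<gamma> a b L \<Longrightarrow> curve_length A k (\<phi> \<circ> \<gamma>) a b L"
proof (induction rule: curve_length.induct)
  case (C1 a b)
  have eq: "integral {a..b} (speed A k (\<phi> \<circ> \<gamma>) {a..b}) = integral {a..b} (speed B h \<gamma> {a..b})"
    by (rule Henstock_Kurzweil_Integration.integral_cong) (rule image_curve(2)[OF C1(2,1)])
  show ?case using curve_length.C1[OF C1(1) image_curve(1)[OF C1(2,1)], of k] unfolding eq .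
qed (rule curve_length.join)

lemma dist_image_le: "dA (\<phi> p) (\<phi> q) \<le> dB p q"
proof (rule src.dist_ge)
  fix L assume "L \<in> lengths B h p q"
  then have "L \<in> lengths A k (\<phi> p) (\<phi> q)"
    unfolding lengths_def using curve_length_image by fastforce
  then show "dA (\<phi> p) (\<phi> q) \<le> L" by (rule tgt.dist_le)
qed

text \<open>
  In charts, compose the curve with a local inverse of \<open>\<phi>\<close>. Its derivative is the solution of a linear
  system with the continuous coefficients \<open>D\<phi>\<close>, so the lifted curve is \<open>C^1\<close>; since \<open>\<phi>\<close> maps it back to the
  given curve, it has the same speed.
\<close>

lemma local_lift:
  assumes C: "C1_curve_on A a b \<gamma>" and ab: "a < b" and t: "a \<le> t" "t < b" and q: "\<phi> q = \<gamma> t"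
  shows "\<exists>t' q'. t < t' \<and> t' \<le> b \<and> \<phi> q' = \<gamma> t' \<and> dB q q' \<le> integral {t..t'} (speed A k \<gamma> {a..b})"
proof -
  let ?i = "chart_at B q" and ?j = "chart_at A (\<gamma> t)"
  let ?x = "cmap B ?i q"
  let ?f = "F ?i ?j" and ?W = "W ?i ?j"
  have xW: "?x \<in> ?W" using src.chart q by (auto simp: W_iff intro: tgt.chart(9))
  have fx: "?f ?x = cmap A ?j (\<gamma> t)" by (simp add: local_map_apply src.chart(5,9) q)
  have bl: "bounded_linear (fd ?f y)" if "y \<in> ?W" for y
    using F_diff[OF that] has_derivative_bounded_linear fd_works by blast
  have app: "blinfun_apply (Blinfun (fd ?f y)) = fd ?f y" if "y \<in> ?W" for y
    by (rule bounded_linear_Blinfun_apply[OF bl[OF that]])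
  have cf': "continuous_on ?W (\<lambda>y. Blinfun (fd ?f y))"
  proof (rule continuous_on_blinfun_componentwise)
    fix e :: "real ^ 'n"
    have "continuous_on ?W (\<lambda>y. fd ?f y e)" using smooth_F[of "Suc 0" ?i ?j] by simp
    then show "continuous_on ?W (\<lambda>y. blinfun_apply (Blinfun (fd ?f y)) e)"
      by (metis (no_types, lifting) app continuous_on_cong)
  qed
  have bij: "bij (fd ?f ?x)" using F_bij[OF xW] by (simp add: bij_def)
  have bl_inv: "bounded_linear (inv (fd ?f ?x))"
    using bij linear_fd[OF F_diff[OF xW]] by (simp add: inj_linear_imp_inv_linear bij_is_inj linear_conv_bounded_linear[symmetric] F_bij[OF xW])
  have inv: "Blinfun (inv (fd ?f ?x)) o\<^sub>L Blinfun (fd ?f ?x) = id_blinfun"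
    by (rule blinfun_eqI) (simp add: app[OF xW] bounded_linear_Blinfun_apply[OF bl_inv] bij_is_inj[OF bij])
  obtain U V G G' where UV: "open U" "U \<subseteq> ?W" "?x \<in> U" "open V" "?f ?x \<in> V" "homeomorphism U V ?f G"
    "\<And>y. y \<in> V \<Longrightarrow> (G has_derivative G' y) (at y)"
    "\<And>y. y \<in> V \<Longrightarrow> G' y = inv (blinfun_apply (Blinfun (fd ?f (G y))))"
    "\<And>y. y \<in> V \<Longrightarrow> bij (blinfun_apply (Blinfun (fd ?f (G y))))"
    by (rule inverse_function_theorem[OF open_W _ cf' xW inv, of ?f])
      (use app fd_works[OF F_diff] in auto)
  have GV: "G y \<in> U" "?f (G y) = y" if "y \<in> V" for y
    using UV(6) that by (auto simp: homeomorphism_def)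
  have Gx: "G (?f ?x) = ?x" using UV(3,6) by (auto simp: homeomorphism_def)
  have tab: "t \<in> {a..b}" using t by simp
  note D = C1_curve_onD[OF C ab]
  have "open {p \<in> cdom A ?j. cmap A ?j p \<in> V}" by (rule open_chart_preimage[OF tgt.smooth UV(4)])
  then obtain R where R: "open R" "R \<inter> {a..b} = \<gamma> -` {p \<in> cdom A ?j. cmap A ?j p \<in> V} \<inter> {a..b}"
    using D(1) unfolding continuous_on_open_invariant by blast
  have "\<gamma> t \<in> {p \<in> cdom A ?j. cmap A ?j p \<in> V}" using UV(5) tgt.chart(9)[of "\<gamma> t"] unfolding fx by simp
  then have tR: "t \<in> R" using R(2) tab by blast
  obtain e where e: "e > 0" "cball t e \<subseteq> R" using open_contains_cball R(1) tR by blast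
  define t' where "t' = min b (t + e)"
  have t': "t < t'" "t' \<le> b" using t e by (auto simp: t'_def)
  have sub: "{t..t'} \<subseteq> {a..b}" using t t' by auto
  have inV: "\<gamma> s \<in> cdom A ?j" "cmap A ?j (\<gamma> s) \<in> V" if "s \<in> {t..t'}" for s
  proof -
    have "s \<in> R" using that e(2) by (auto simp: t'_def dist_real_def)
    then have "s \<in> R \<inter> {a..b}" using that sub by blast
    then show "\<gamma> s \<in> cdom A ?j" "cmap A ?j (\<gamma> s) \<in> V" unfolding R(2) by auto
  qed
  note C' = C1_curve_on_subset[OF tgt.smooth C t(1) t'(1,2)]
  note D' = C1_curve_onD[OF C' t'(1)]
  let ?v = "\<lambda>s. vector_derivative (cmap A ?j \<circ> \<gamma>) (at s within {t..t'})"
  define c where "c s = G (cmap A ?j (\<gamma> s))" for s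
  define w where "w s = G' (cmap A ?j (\<gamma> s)) (?v s)" for s
  have cU: "c s \<in> U" if "s \<in> {t..t'}" for s unfolding c_def by (rule GV(1)[OF inV(2)[OF that]])
  have cW: "c s \<in> ?W" if "s \<in> {t..t'}" for s using cU[OF that] UV(2) by blast
  have dc: "(c has_vector_derivative w s) (at s within {t..t'})" if s: "s \<in> {t..t'}" for s
  proof -
    have "((\<lambda>s. G ((cmap A ?j \<circ> \<gamma>) s)) has_derivative (\<lambda>h. G' (cmap A ?j (\<gamma> s)) (h *\<^sub>R ?v s))) (at s within {t..t'})"
      by (rule has_derivative_compose[of "cmap A ?j \<circ> \<gamma>"])
        (use D'(2)[OF s inV(1)[OF s]] UV(7)[OF inV(2)[OF s]] in \<open>simp_all add: has_vector_derivative_def\<close>)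
    then show ?thesis
      using has_derivative_linear[OF UV(7)[OF inV(2)[OF s]]]
      by (simp add: has_vector_derivative_def c_def[abs_def] w_def linear_cmul o_def)
  qed
  have "continuous_on {t..t'} w"
  proof (rule linear_system_solution_continuous)
    fix s assume s: "s \<in> {t..t'}"
    show "linear (fd ?f (c s))" by (rule linear_fd[OF F_diff[OF cW[OF s]]])
    show "inj (fd ?f (c s))" by (rule F_bij(1)[OF cW[OF s]])
    show "fd ?f (c s) (w s) = ?v s"
      using UV(8)[OF inV(2)[OF s]] cW[OF s] F_bij(2)[OF cW[OF s]]
      by (simp add: w_def c_def app surj_f_inv_f)
  next
    have cc: "continuous_on {t..t'} c"
      using dc by (meson continuous_on_eq_continuous_within has_vector_derivative_continuous)
    show "continuous_on {t..t'} (\<lambda>s. fd ?f (c s) v)" for v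
      by (rule continuous_on_fd_apply[OF smooth_F[of "Suc 0" ?i ?j] cc]) (use cW in auto)
    have "{s \<in> {t..t'}. \<gamma> s \<in> cdom A ?j} = {t..t'}" using inV(1) by auto
    then show "continuous_on {t..t'} ?v" using D'(3)[of ?j] by simp
  qed
  moreover have c_img: "c s \<in> cimg B ?i" if "s \<in> {t..t'}" for s using cW[OF that] by (simp add: W_iff)
  ultimately have C\<eta>: "C1_curve_on B t t' (cinv B ?i \<circ> c)"
    using C1_curve_in_chart(1)[OF src.smooth t'(1) c_img dc] by blast
  let ?\<eta> = "cinv B ?i \<circ> c"
  have \<phi>\<eta>: "(\<phi> \<circ> ?\<eta>) s = \<gamma> s" if s: "s \<in> {t..t'}" for s
  proof -
    have "cmap A ?j (\<phi> (?\<eta> s)) = cmap A ?j (\<gamma> s)"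
      using GV(2)[OF inV(2)[OF s]] by (simp add: c_def local_map_apply)
    moreover have "\<phi> (?\<eta> s) \<in> cdom A ?j" using cW[OF s] by (simp add: W_iff)
    ultimately show ?thesis using inV(1)[OF s] by (metis comp_apply tgt.chart(5))
  qed
  have "?\<eta> t = q" by (simp add: c_def fx[symmetric] Gx src.chart(5,9))
  then have "dB q (?\<eta> t') \<le> integral {t..t'} (speed B h ?\<eta> {t..t'})"
    using src.dist_le[OF src.lengths_C1[OF t'(1) C\<eta>]] by simp
  also have "\<dots> = integral {t..t'} (speed A k \<gamma> {a..b})"
  proof (rule Henstock_Kurzweil_Integration.integral_cong)
    fix s assume s: "s \<in> {t..t'}"
    have "speed B h ?\<eta> {t..t'} s = speed A k (\<phi> \<circ> ?\<eta>) {t..t'} s"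
      by (rule image_curve(2)[OF C\<eta> t'(1) s, symmetric])
    also have "\<dots> = speed A k \<gamma> {t..t'} s" by (rule tgt.speed_cong[OF C' t'(1) \<phi>\<eta> s])
    also have "\<dots> = speed A k \<gamma> {a..b} s" by (rule tgt.speed_subset[OF C t(1) t' s])
    finally show "speed B h ?\<eta> {t..t'} s = speed A k \<gamma> {a..b} s" .
  qed
  finally have "dB q (?\<eta> t') \<le> integral {t..t'} (speed A k \<gamma> {a..b})" .
  moreover have "\<phi> (?\<eta> t') = \<gamma> t'" using \<phi>\<eta>[of t'] t'(1) by simp
  ultimately show ?thesis using t' by blast
qed

text \<open>
  On a \<open>C^1\<close> piece this is \<open>endpoint_lift\<close> for the arc length, with \<open>local_lift\<close> as the step.
\<close>

lemma curve_lift: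
  assumes complete: "complete_riemannian B h"
  shows "curve_length A k \<gamma> a b L \<Longrightarrow> \<phi> p = \<gamma> a \<Longrightarrow> \<exists>q. \<phi> q = \<gamma> b \<and> dB p q \<le> L"
proof (induction arbitrary: p rule: curve_length.induct)
  case (C1 a b)
  let ?s = "speed A k \<gamma> {a..b}"
  have int: "?s integrable_on {a..b}" by (rule tgt.speed_integrable[OF C1(2,1)])
  have diff: "integral {s..t} ?s = integral {a..t} ?s - integral {a..s} ?s" if "a \<le> s" "s \<le> t" "t \<le> b" for s t
  proof -
    have "?s integrable_on {a..t}" by (rule integrable_on_subinterval[OF int]) (use that in auto)
    from Henstock_Kurzweil_Integration.integral_combine[OF that(1,2) this] show ?thesis by simp
  qed
  have "\<exists>q. \<phi> q = \<gamma> b \<and> dB p q \<le> integral {a..b} ?s - integral {a..a} ?s"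
  proof (rule endpoint_lift[where dA=dA and dB=dB and a=a and \<gamma>=\<gamma> and \<phi>=\<phi> and len="\<lambda>t. integral {a..t} ?s"])
    show "Metric_space.mcomplete UNIV dB" using complete by (simp add: complete_riemannian_def)
    show "continuous_on {a..b} (\<lambda>t. integral {a..t} ?s)" by (rule indefinite_integral_continuous_1[OF int])
    show "dA (\<gamma> s) (\<gamma> t) \<le> integral {a..t} ?s - integral {a..s} ?s" if "a \<le> s" "s \<le> t" "t \<le> b" for s t
    proof (cases "s = t")
      case True
      then show ?thesis using tgt.dist_le[OF tgt.lengths_refl] by simp
    next
      case False
      then have st: "s < t" using that by simp
      have "dA (\<gamma> s) (\<gamma> t) \<le> integral {s..t} (speed A k \<gamma> {s..t})"
        by (rule tgt.dist_le[OF tgt.lengths_C1[OF st C1_curve_on_subset[OF tgt.smooth C1(2) that(1) st that(3)]]])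
      then show ?thesis using diff[OF that] tgt.integral_speed_subset[OF C1(2) that(1) st that(3)] by simp
    qed
    show "\<exists>t' q'. t < t' \<and> t' \<le> b \<and> \<phi> q' = \<gamma> t' \<and> dB q q' \<le> integral {a..t'} ?s - integral {a..t} ?s"
      if tq: "a \<le> t" "t < b" "\<phi> q = \<gamma> t" for t q
    proof -
      obtain t' q' where "t < t'" "t' \<le> b" "\<phi> q' = \<gamma> t'" "dB q q' \<le> integral {t..t'} ?s"
        using local_lift[OF C1(2,1) tq] by blast
      with diff[of t t'] tq(1) show ?thesis by (intro exI[of _ t'] exI[of _ q']) auto
    qed
  qed (use C1 dist_image_le src.Metric_space tgt.Metric_space in auto)
  then show ?case by simp
next
  case (join a b L c L')
  then obtain q where q: "\<phi> q = \<gamma> b" "dB p q \<le> L" by blast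
  with join obtain r where r: "\<phi> r = \<gamma> c" "dB q r \<le> L'" by blast
  interpret MB: Metric_space UNIV dB by (rule src.Metric_space)
  show ?case using q r MB.triangle[of p q r] by (intro exI[of _ r]) auto
qed

lemma dist_lift:
  assumes "complete_riemannian B h" "dA (\<phi> p) x < e"
  shows "\<exists>q. \<phi> q = x \<and> dB p q < e"
proof -
  obtain L where L: "L \<in> lengths A k (\<phi> p) x" "L < e" using tgt.dist_approx[OF assms(2)] by blast
  then obtain \<gamma> a b where "curve_length A k \<gamma> a b L" "\<gamma> a = \<phi> p" "\<gamma> b = x" by (auto simp: lengths_def)
  with curve_lift[OF assms(1), of \<gamma> a b L p] L(2) show ?thesis by force
qed

lemma surj:
  assumes "complete_riemannian B h"
  shows "surj \<phi>"
proof -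
  have "\<exists>q. x = \<phi> q" for x
    using dist_lift[OF assms, of undefined x "dA (\<phi> undefined) x + 1"] by force
  then show ?thesis by (simp add: surj_def)
qed

lemma complete_target:
  assumes "complete_riemannian B h"
  shows "complete_riemannian A k"
  unfolding complete_riemannian_def
  by (rule mcomplete_of_lifting[OF src.Metric_space tgt.Metric_space _ dist_image_le surj[OF assms] dist_lift[OF assms]])
    (use assms in \<open>simp_all add: complete_riemannian_def\<close>)

text \<open>
  The Laplacian commutes with \<open>\<phi>\<close>, because in charts \<open>\<phi>\<close> is isometric.
\<close>

lemma superharmonic_pullback:
  assumes "superharmonic A k f"
  shows "superharmonic B h (f \<circ> \<phi>)"
proof -
  have sm: "Ck_on m (cimg A j) (f \<circ> cinv A j)" and le: "\<And>x. x \<in> cimg A j \<Longrightarrow> laplacian (k j) (f \<circ> cinv A j) x \<le> 0" for m j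
    using assms by (auto simp: superharmonic_def smooth_fun_def smooth_on_def)
  have eq: "(f \<circ> \<phi> \<circ> cinv B i) y = (f \<circ> cinv A j) (F i j y)" if "y \<in> W i j" for i j y
    using that by (simp add: W_iff local_map_apply tgt.chart(5))
  have ex: "y \<in> W i (chart_at A (\<phi> (cinv B i y)))" if "y \<in> cimg B i" for i y
    using that tgt.chart(9) by (simp add: W_iff)
  have C: "Ck_on m (W i j) (\<lambda>y. (f \<circ> cinv A j) (F i j y))" for m i j
    by (rule Ck_on_compose[OF open_W tgt.chart(2) F_image smooth_F sm])
  have C': "Ck_on m (W i j) (f \<circ> \<phi> \<circ> cinv B i)" for m i j
    by (rule Ck_on_cong[OF open_W _ C]) (rule eq[symmetric])
  have "Ck_on m (cimg B i) (f \<circ> \<phi> \<circ> cinv B i)" for m i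
    by (rule Ck_on_local, intro exI conjI, rule open_W, erule ex, rule C')
  moreover have "laplacian (h i) (f \<circ> \<phi> \<circ> cinv B i) x \<le> 0" if x: "x \<in> cimg B i" for i x
  proof -
    let ?j = "chart_at A (\<phi> (cinv B i x))"
    note xW = ex[OF x]
    have "laplacian (h i) (f \<circ> \<phi> \<circ> cinv B i) x = laplacian (h i) (\<lambda>y. (f \<circ> cinv A ?j) (F i ?j y)) x"
      by (rule laplacian_cong_open[OF open_W xW eq])
    also have "\<dots> = laplacian (k ?j) (f \<circ> cinv A ?j) (F i ?j x)"
      by (rule laplacian_isometric[OF C1_metric_W tgt.C1_metric xW F_image smooth_F isometric sm])
    also have "\<dots> \<le> 0" using F_image xW by (intro le) blast
    finally show ?thesis .
  qed
  ultimately show ?thesis by (simp add: superharmonic_def smooth_fun_def smooth_on_def o_assoc)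
qed

theorem parabolic_target:
  assumes "parabolic B h"
  shows "surj \<phi>" "parabolic A k"
proof -
  have c: "complete_riemannian B h" using assms by (simp add: parabolic_def)
  show s: "surj \<phi>" by (rule surj[OF c])
  have "\<exists>c. \<forall>p. f p = c" if f: "superharmonic A k f" "bdd_below (range f)" for f
  proof -
    have "bdd_below (range (f \<circ> \<phi>))" using f(2) by (rule bdd_below_mono) auto
    then obtain c where "\<And>p. (f \<circ> \<phi>) p = c"
      using assms superharmonic_pullback[OF f(1)] unfolding parabolic_def by blast
    then show ?thesis using s by (metis comp_apply surjD)
  qed
  then show "parabolic A k" using complete_target[OF c] by (simp add: parabolic_def)
qed

end

section \<open>Plane fronted waves\<close>

lemma cdom_pfw: "cdom (pfw_atlas A) i = UNIV \<times> UNIV \<times> cdom A i"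
  by (simp add: cdom_def pfw_atlas_def)

lemma cmap_pfw: "cmap (pfw_atlas A) i p = (fst p, fst (snd p), cmap A i (snd (snd p)))"
  by (simp add: cmap_def pfw_atlas_def split: prod.split)

lemma cimg_pfw: "cimg (pfw_atlas A) i = UNIV \<times> UNIV \<times> cimg A i"
  by (force simp: cimg_def cdom_pfw cmap_pfw)

lemma cinv_pfw:
  assumes "smooth_manifold A" "y \<in> cimg A i"
  shows "cinv (pfw_atlas A) i (a, b, y) = (a, b, cinv A i y)"
proof -
  note c = smooth_manifoldD[OF assms(1)]
  have "inj_on (cmap (pfw_atlas A) i) (cdom (pfw_atlas A) i)"
    by (rule inj_onI) (auto simp: cdom_pfw cmap_pfw prod_eq_iff, metis c(5))
  then show ?thesis
    unfolding cinv_def[of "pfw_atlas A"]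
    by (rule inv_into_f_eq) (use assms(2) c in \<open>auto simp: cdom_pfw cmap_pfw\<close>)
qed

lemma pfw_metric_apply:
  "pfw_metric A g H i p X Y = H (fst p) (cinv A i (snd (snd p))) * fst X * fst Y + fst X * fst (snd Y) +
     fst (snd X) * fst Y + g i (snd (snd p)) (snd (snd X)) (snd (snd Y))"
  by (simp add: pfw_metric_def split: prod.split)

lemma local_dom_pfw: "local_dom B (pfw_atlas A) \<psi> i j = local_dom B A (\<lambda>p. snd (snd (\<psi> p))) i j"
  by (auto simp: local_dom_def cdom_pfw mem_Times_iff)

lemma local_map_pfw: "local_map B (pfw_atlas A) \<psi> i j = (\<lambda>y. (fst (\<psi> (cinv B i y)), fst (snd (\<psi> (cinv B i y))),
    local_map B A (\<lambda>p. snd (snd (\<psi> p))) i j y))"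
  by (simp add: local_map_def cmap_pfw fun_eq_iff)

lemma bounded_linear_components:
  "bounded_linear (fst :: real \<times> real \<times> 'a::real_normed_vector \<Rightarrow> real)"
  "bounded_linear (\<lambda>p :: real \<times> real \<times> 'a. fst (snd p))"
  "bounded_linear (\<lambda>p :: real \<times> real \<times> 'a. snd (snd p))"
  by (auto intro: bounded_linear_fst bounded_linear_snd bounded_linear_compose[OF bounded_linear_fst bounded_linear_snd]
      bounded_linear_compose[OF bounded_linear_snd bounded_linear_snd])

locale wave_spacetime =
  fixes A :: "('i, 'm::{t2_space, second_countable_topology}, real ^ 'n) atlas"
    and g :: "('i, real ^ 'n) metric" and H :: "real \<Rightarrow> 'm \<Rightarrow> real"
  assumes wave: "plane_fronted_wave A g H"
begin

abbreviation "P \<equiv> pfw_atlas A"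
abbreviation "gP \<equiv> pfw_metric A g H"

sublocale riemannian_manifold A g
  using wave by unfold_locales (auto simp: plane_fronted_wave_def)

lemma open_cimg_pfw: "open (cimg P j)"
  unfolding cimg_pfw by (intro open_Times open_UNIV chart(2))

lemma C1_metric_pfw: "C1_metric_on (cimg P j) (gP j)"
  unfolding C1_metric_on_def
proof (intro conjI ballI allI open_cimg_pfw)
  fix p assume "p \<in> cimg P j"
  then have z: "snd (snd p) \<in> cimg A j" by (auto simp: cimg_pfw)
  note b = C1_metric_onD(2)[OF C1_metric z]
  show "bilinear (gP j p)"
    unfolding bilinear_def
    by (intro conjI allI linearI)
      (simp_all add: pfw_metric_apply bilinear_ladd[OF b] bilinear_radd[OF b] bilinear_lmul[OF b] bilinear_rmul[OF b] algebra_simps)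
  show "gP j p v w = gP j p w v" for v w
    by (simp add: pfw_metric_apply C1_metric_onD(3)[OF C1_metric z, of "snd (snd v)"] algebra_simps)
  show "nondegenerate (gP j p)"
    unfolding nondegenerate_def
  proof (intro allI impI)
    fix X assume X: "\<forall>w. gP j p X w = 0"
    have z0: "g j (snd (snd p)) (snd (snd X)) 0 = 0" by (rule bilinear_rzero[OF b])
    have 1: "fst X = 0" using X[rule_format, of "(0, 1, 0)"] by (simp add: pfw_metric_apply z0)
    then have 2: "fst (snd X) = 0" using X[rule_format, of "(1, 0, 0)"] by (simp add: pfw_metric_apply z0)
    have "g j (snd (snd p)) (snd (snd X)) w = 0" for w
      using X[rule_format, of "(0, 0, w)"] 1 2 by (simp add: pfw_metric_apply)
    then have "snd (snd X) = 0" using C1_metric_onD(4)[OF C1_metric z] by (simp add: nondegenerate_def)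
    with 1 2 show "X = 0" by (simp add: prod_eq_iff)
  qed
next
  fix X Y :: "real \<times> real \<times> (real ^ 'n)"
  note o = open_cimg_pfw[of j]
  have "Ck_on (Suc 0) (cimg P j) ((\<lambda>(u, v, x). H u x) \<circ> cinv P j)"
    using wave by (auto simp: plane_fronted_wave_def smooth_fun_def smooth_on_def simp del: Ck_on.simps)
  then have 1: "Ck_on (Suc 0) (cimg P j) (\<lambda>p. H (fst p) (cinv A j (snd (snd p))))"
    by (rule Ck_on_cong[OF o, rotated]) (auto simp: cimg_pfw cinv_pfw[OF smooth])
  have 2: "Ck_on (Suc 0) (cimg P j) (\<lambda>p. g j (snd (snd p)) (snd (snd X)) (snd (snd Y)))"
  proof (rule Ck_on_compose[OF o chart(2)[of j]])
    show "(\<lambda>p. snd (snd p)) ` cimg P j \<subseteq> cimg A j" by (auto simp: cimg_pfw)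
    have "Ck_on (Suc 0) (cimg P j) (\<lambda>p. p)"
      by (auto simp: frechet_derivative_ident)
    then show "Ck_on (Suc 0) (cimg P j) (\<lambda>p. snd (snd p))"
      by (rule Ck_on_linear_compose[OF o bounded_linear_components(3)])
    show "Ck_on (Suc 0) (cimg A j) (\<lambda>z. g j z (snd (snd X)) (snd (snd Y)))"
      using C1_metric[of j] by (simp add: C1_metric_on_def del: Ck_on.simps)
  qed
  have "Ck_on (Suc 0) (cimg P j) (\<lambda>p. H (fst p) (cinv A j (snd (snd p))) *\<^sub>R (fst X * fst Y) +
      (fst X * fst (snd Y) + fst (snd X) * fst Y) + g j (snd (snd p)) (snd (snd X)) (snd (snd Y)))"
    by (intro Ck_on_add Ck_on_scaleR o 1 2 Ck_on_const)
  then show "Ck_on (Suc 0) (cimg P j) (\<lambda>p. gP j p X Y)"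
    by (rule Ck_on_cong[OF o, rotated]) (simp add: pfw_metric_apply)
qed

context
  fixes j p assumes p: "p \<in> cimg P j"
begin

lemma snd_p: "snd (snd p) \<in> cimg A j"
  using p by (auto simp: cimg_pfw)

lemma pfw_diff: "(\<lambda>y. gP j y X Y) differentiable (at p)"
  by (rule C1_metric_onD(5)[OF C1_metric_pfw p])

lemma fd_pfw_const:
  assumes "\<And>y. y \<in> cimg P j \<Longrightarrow> gP j y X Y = c"
  shows "fd (\<lambda>y. gP j y X Y) p Z = 0"
proof -
  have "fd (\<lambda>y. gP j y X Y) p = fd (\<lambda>y. c) p" by (rule fd_cong_open[OF open_cimg_pfw p assms])
  then show ?thesis by simp
qed

lemma g_right_zero: "y \<in> cimg P j \<Longrightarrow> g j (snd (snd y)) x 0 = 0"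
  by (rule bilinear_rzero[OF C1_metric_onD(2)[OF C1_metric]]) (auto simp: cimg_pfw)

text \<open>
  The Koszul formula with \<open>\<partial>\<^sub>v = (0, 1, 0)\<close>: the metric does not depend on \<open>v\<close>, and its product with
  \<open>\<partial>\<^sub>v\<close> is the constant form \<open>du\<close>.
\<close>

lemma christoffel_u: "fst (christoffel (gP j) p X Y) = 0"
proof -
  have c: "gP j y V (0, 1, 0) = fst V" if "y \<in> cimg P j" for y V
    using g_right_zero[OF that] by (simp add: pfw_metric_apply)
  have "fd (\<lambda>y. gP j y X Y) p (0, 1, 0) = 0"
    by (rule fd_zero_direction[OF pfw_diff]) (simp add: pfw_metric_apply)
  then show ?thesis
    using koszul_formula[OF C1_metric_pfw p, of X Y "(0, 1, 0)"] fd_pfw_const[of X "(0, 1, 0)" "fst X" Y]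
      fd_pfw_const[of Y "(0, 1, 0)" "fst Y" X] c p by simp
qed

text \<open>
  The Koszul formula with \<open>\<partial>\<^sub>u = (1, 0, 0)\<close>: on vectors without \<open>\<partial>\<^sub>u\<close>-component the function \<open>H\<close>
  disappears from the metric, which then depends on neither \<open>u\<close> nor \<open>v\<close>.
\<close>

lemma christoffel_v:
  assumes "fst X = 0" "fst Y = 0"
  shows "fst (snd (christoffel (gP j) p X Y)) = 0"
proof -
  have c: "gP j y V (1, 0, 0) = fst (snd V)" if "fst V = 0" "y \<in> cimg P j" for y V
    using that g_right_zero[OF that(2)] by (simp add: pfw_metric_apply)
  have "fd (\<lambda>y. gP j y X Y) p (1, 0, 0) = 0"
    by (rule fd_zero_direction[OF pfw_diff]) (simp add: pfw_metric_apply assms)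
  then have "gP j p (christoffel (gP j) p X Y) (1, 0, 0) = 0"
    using koszul_formula[OF C1_metric_pfw p, of X Y "(1, 0, 0)"] fd_pfw_const[of X "(1, 0, 0)" "fst (snd X)" Y]
      fd_pfw_const[of Y "(1, 0, 0)" "fst (snd Y)" X] c assms by simp
  then show ?thesis using c[OF christoffel_u p] by simp
qed

text \<open>
  The Koszul formulas of the wave and of \<open>M\<close> agree on vectors tangent to the wavefronts.
\<close>

lemma christoffel_vertical:
  "christoffel (gP j) p (0, 0, x) (0, 0, y) = (0, 0, christoffel (g j) (snd (snd p)) x y)"
proof -
  let ?z = "snd (snd p)"
  let ?G = "christoffel (gP j) p (0, 0, x) (0, 0, y)"
  have d: "fd (\<lambda>q. gP j q (0, 0, a) (0, 0, b)) p (0, 0, c) = fd (\<lambda>z. g j z a b) ?z c" for a b c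
  proof -
    have "((\<lambda>q::real \<times> real \<times> (real ^ 'n). snd (snd q)) has_derivative (\<lambda>q. snd (snd q))) (at p)"
      by (rule bounded_linear_imp_has_derivative[OF bounded_linear_components(3)])
    from has_derivative_compose[OF this fd_works[OF C1_metric_onD(5)[OF C1_metric snd_p, of a b]]]
    show ?thesis using fd_eqI by (fastforce simp: pfw_metric_apply)
  qed
  have "snd (snd ?G) = christoffel (g j) ?z x y"
  proof (rule nondegenerate_eqI[OF C1_metric_onD(2,4)[OF C1_metric snd_p]])
    fix w
    have "2 * g j ?z (snd (snd ?G)) w = 2 * gP j p ?G (0, 0, w)"
      by (simp add: pfw_metric_apply christoffel_u)
    also have "\<dots> = 2 * g j ?z (christoffel (g j) ?z x y) w"
      unfolding koszul_formula[OF C1_metric_pfw p] koszul_formula[OF C1_metric snd_p] d ..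
    finally show "g j ?z (snd (snd ?G)) w = g j ?z (christoffel (g j) ?z x y) w" by simp
  qed
  then show ?thesis by (simp add: prod_eq_iff christoffel_u christoffel_v)
qed

end

end

section \<open>Submanifolds of plane fronted waves\<close>

text \<open>
  A chart of the wave is a chart of \<open>M\<close> with the coordinates \<open>u\<close> and \<open>v\<close> added. So the expression \<open>\<Psi>\<close> of
  \<open>\<psi>\<close> in charts has as its last component the expression \<open>F\<close> of the projection \<open>\<phi>\<close> to \<open>M\<close>, and \<open>\<Psi>\<close> and \<open>F\<close> have
  the same domains \<open>W\<close>.
\<close>

locale map_into_wave = wave_spacetime A g H
  for A :: "('i, 'm::{t2_space, second_countable_topology}, real ^ 'n) atlas"
    and g :: "('i, real ^ 'n) metric" and H :: "real \<Rightarrow> 'm \<Rightarrow> real" +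
  fixes B :: "('j, 's::{t2_space, second_countable_topology}, real ^ 'n) atlas"
    and \<psi> :: "'s \<Rightarrow> real \<times> real \<times> 'm"
  assumes manifold_B: "smooth_manifold B" and smooth_psi: "smooth_map B (pfw_atlas A) \<psi>"
begin

abbreviation "h \<equiv> induced_metric B P gP \<psi>"
abbreviation "\<phi> \<equiv> \<lambda>p. snd (snd (\<psi> p))"
abbreviation "\<Psi> \<equiv> local_map B P \<psi>"
abbreviation "W \<equiv> local_dom B P \<psi>"
abbreviation "F \<equiv> local_map B A \<phi>"

lemma cont_psi: "continuous_on UNIV \<psi>"
  using smooth_psi by (simp add: smooth_map_def)

lemma smooth_Psi: "Ck_on m (W i j) (\<Psi> i j)"
  using smooth_psi by (simp add: smooth_map_def smooth_on_def)

lemma W_iff: "y \<in> W i j \<longleftrightarrow> y \<in> cimg B i \<and> \<phi> (cinv B i y) \<in> cdom A j"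
  unfolding local_dom_pfw by (rule local_dom_iff[OF manifold_B])

lemma open_W: "open (W i j)"
proof -
  have "open (cdom P j)" unfolding cdom_pfw by (intro open_Times open_UNIV chart(1))
  then show ?thesis by (rule open_local_dom[OF manifold_B cont_psi])
qed

lemma exists_W: "y \<in> cimg B i \<Longrightarrow> y \<in> W i (chart_at A (\<phi> (cinv B i y)))"
  by (simp add: W_iff chart(9))

lemma Psi_image: "\<Psi> i j ` W i j \<subseteq> cimg P j"
  by (auto simp: local_map_pfw cimg_pfw W_iff local_map_apply chart(7))

lemma Psi_components:
  "fst (\<Psi> i j y) = u_coord (\<psi> (cinv B i y))" "fst (snd (\<Psi> i j y)) = v_coord (\<psi> (cinv B i y))"
  "snd (snd (\<Psi> i j y)) = F i j y"
  by (simp_all add: local_map_pfw u_coord_def v_coord_def split_def)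

lemma smooth_F: "Ck_on m (W i j) (F i j)"
  using Ck_on_linear_compose[OF open_W bounded_linear_components(3) smooth_Psi] by (simp add: Psi_components)

lemma smooth_map_phi: "smooth_map B A \<phi>"
  unfolding smooth_map_def smooth_on_def
proof (intro conjI allI)
  show "continuous_on UNIV \<phi>" by (intro continuous_intros cont_psi)
  show "Ck_on m (local_dom B A \<phi> i j) (F i j)" for m i j using smooth_F[of m i j] by (simp add: local_dom_pfw)
qed

lemma Psi_diff: "y \<in> W i j \<Longrightarrow> \<Psi> i j differentiable (at y)"
  using smooth_Psi[of "Suc 0" i j] by auto

lemma fd_component:
  assumes "y \<in> W i j" "bounded_linear l"
  shows "fd (\<lambda>y. l (\<Psi> i j y)) y v = l (fd (\<Psi> i j) y v)"
  using fd_eqI[OF bounded_linear.has_derivative[OF assms(2) fd_works[OF Psi_diff[OF assms(1)]]]] by simp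

lemma fd_F: "y \<in> W i j \<Longrightarrow> snd (snd (fd (\<Psi> i j) y v)) = fd (F i j) y v"
  using fd_component[OF _ bounded_linear_components(3), of y i j v] by (simp add: Psi_components)

lemma fd_uv:
  assumes "y \<in> W i j" "y \<in> W i j'"
  shows "fst (fd (\<Psi> i j) y v) = fst (fd (\<Psi> i j') y v)" "fst (snd (fd (\<Psi> i j) y v)) = fst (snd (fd (\<Psi> i j') y v))"
  using fd_component[OF assms(1) bounded_linear_components(1), of v] fd_component[OF assms(1) bounded_linear_components(2), of v]
    fd_component[OF assms(2) bounded_linear_components(1), of v] fd_component[OF assms(2) bounded_linear_components(2), of v]
  by (simp_all add: Psi_components)

text \<open>
  The induced metric is defined with one chosen chart of the wave. A change of that chart affects only the
  last component of \<open>\<Psi>\<close>, through a transition map of \<open>M\<close>, and \<open>g\<close> is a tensor.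
\<close>

lemma induced_metric_in_chart:
  assumes y: "y \<in> W i j"
  shows "h i y v w = gP j (\<Psi> i j y) (fd (\<Psi> i j) y v) (fd (\<Psi> i j) y w)"
proof -
  define j' where "j' = chart_at P (\<psi> (cinv B i y))"
  have "\<exists>j. \<psi> (cinv B i y) \<in> cdom P j" using y by (auto simp: W_iff cdom_pfw mem_Times_iff)
  then have "\<psi> (cinv B i y) \<in> cdom P j'" unfolding j'_def chart_at_def by (rule someI_ex)
  then have y': "y \<in> W i j'" using y by (auto simp: W_iff cdom_pfw)
  let ?T = "local_map A A id j' j"
  have FT: "F i j x = ?T (F i j' x)" if "x \<in> W i j \<inter> W i j'" for x
    using that by (simp add: local_map_apply W_iff chart(5))
  have dom: "F i j' y \<in> local_dom A A id j' j"
    using y y' by (simp add: local_dom_iff[OF smooth] local_map_apply W_iff chart(5,7))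
  have dT: "?T differentiable (at (F i j' y))" by (rule smooth_on_differentiable[OF chart(10) dom])
  have dF: "F i j' differentiable (at y)" using smooth_F[of "Suc 0" i j'] y' by auto
  have "fd (F i j) y = fd (\<lambda>x. ?T (F i j' x)) y"
    by (rule fd_cong_open[of "W i j \<inter> W i j'"]) (use open_W y y' FT in auto)
  then have fdF: "fd (F i j) y x = fd ?T (F i j' y) (fd (F i j') y x)" for x
    using fd_eqI[OF has_derivative_compose[OF fd_works[OF dF] fd_works[OF dT]]] by simp
  have "h i y v w = gP j' (\<Psi> i j' y) (fd (\<Psi> i j') y v) (fd (\<Psi> i j') y w)"
    by (simp add: induced_metric_def j'_def Let_def)
  also have "\<dots> = gP j (\<Psi> i j y) (fd (\<Psi> i j) y v) (fd (\<Psi> i j) y w)"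
  proof -
    have "cinv A j' (F i j' y) = cinv A j (F i j y)"
      using y y' by (simp add: local_map_apply W_iff chart(5))
    moreover have "g j' (F i j' y) (fd (F i j') y v) (fd (F i j') y w) = g j (F i j y) (fd (F i j) y v) (fd (F i j) y w)"
      unfolding tensor[OF dom] fdF using FT[of y] y y' by simp
    ultimately show ?thesis
      by (simp add: pfw_metric_apply Psi_components fd_F[OF y] fd_F[OF y'] fd_uv[OF y y'])
  qed
  finally show ?thesis .
qed

end

locale extremal_in_wave = map_into_wave A g H B \<psi> + src: riemannian_manifold B "induced_metric B (pfw_atlas A) (pfw_metric A g H) \<psi>"
  for A :: "('i, 'm::{t2_space, second_countable_topology}, real ^ 'n) atlas"
    and g :: "('i, real ^ 'n) metric" and H :: "real \<Rightarrow> 'm \<Rightarrow> real"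
    and B :: "('j, 's::{t2_space, second_countable_topology}, real ^ 'n) atlas"
    and \<psi> :: "'s \<Rightarrow> real \<times> real \<times> 'm" +
  assumes extremal: "extremal B (pfw_atlas A) (pfw_metric A g H) \<psi>"
begin

lemma C1_metric_W: "C1_metric_on (W i j) (h i)"
  by (rule C1_metric_on_subset[OF src.C1_metric open_W]) (auto simp: W_iff)

text \<open>
  The hypothesis on \<open>l\<close> says that the Hessian of the coordinate \<open>l\<close> of the wave vanishes on the tangent
  vectors of the submanifold. Then extremality makes \<open>f\<close> harmonic.
\<close>

lemma superharmonic_coordinate:
  assumes l: "bounded_linear l" and f: "\<And>i j y. y \<in> W i j \<Longrightarrow> (f \<circ> cinv B i) y = l (\<Psi> i j y)"
    and c: "\<And>i j y v w. y \<in> W i j \<Longrightarrow> l (christoffel (gP j) (\<Psi> i j y) (fd (\<Psi> i j) y v) (fd (\<Psi> i j) y w)) = 0"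
  shows "superharmonic B h f"
proof -
  have C: "Ck_on m (W i j) (f \<circ> cinv B i)" for m i j
    by (rule Ck_on_cong[OF open_W _ Ck_on_linear_compose[OF open_W l smooth_Psi]]) (rule f[symmetric])
  have "Ck_on m (cimg B i) (f \<circ> cinv B i)" for m i
    by (rule Ck_on_local, intro exI conjI, rule open_W, erule exists_W, rule C)
  moreover have "laplacian (h i) (f \<circ> cinv B i) x \<le> 0" if x: "x \<in> cimg B i" for i x
  proof -
    let ?j = "chart_at A (\<phi> (cinv B i x))"
    note xW = exists_W[OF x]
    have "mean_curvature (h i) (gP ?j) (\<Psi> i ?j) x = 0"
      using extremal xW by (simp add: extremal_def)
    then have tr: "metric_trace (h i x) (\<lambda>v w. second_ff (h i) (gP ?j) (\<Psi> i ?j) (\<lambda>_. v) (\<lambda>_. w) x) = 0"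
      by (simp add: mean_curvature_def)
    have "laplacian (h i) (f \<circ> cinv B i) x = laplacian (h i) (\<lambda>y. l (\<Psi> i ?j y)) x"
      by (rule laplacian_cong_open[OF open_W xW f])
    also have "\<dots> = 0"
      unfolding laplacian_linear_of_map[OF C1_metric_W xW smooth_Psi l, of "gP ?j"] tr
      by (simp add: c[OF xW] metric_trace_def linear_0[OF bounded_linear.linear[OF l]])
    finally show ?thesis by simp
  qed
  ultimately show ?thesis by (simp add: superharmonic_def smooth_fun_def smooth_on_def)
qed

text \<open>
  If \<open>f\<close> is bounded from above, apply parabolicity to \<open>- f\<close>, which is the coordinate \<open>- l\<close>.
\<close>

lemma constant_coordinate:
  assumes par: "parabolic B h" and bd: "bounded_above_or_below f"
    and l: "bounded_linear l" and f: "\<And>i j y. y \<in> W i j \<Longrightarrow> (f \<circ> cinv B i) y = l (\<Psi> i j y)"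
    and c: "\<And>i j y v w. y \<in> W i j \<Longrightarrow> l (christoffel (gP j) (\<Psi> i j y) (fd (\<Psi> i j) y v) (fd (\<Psi> i j) y w)) = 0"
  shows "\<exists>c. \<forall>p. f p = c"
  using bd unfolding bounded_above_or_below_def
proof
  assume "bdd_below (range f)"
  then show ?thesis using par superharmonic_coordinate[OF l f c] unfolding parabolic_def by blast
next
  assume "bdd_above (range f)"
  then have "bdd_below (range (\<lambda>p. - f p))" by (auto simp: bdd_above_def bdd_below_def) (metis neg_le_iff_le)
  moreover have "superharmonic B h (\<lambda>p. - f p)"
    by (rule superharmonic_coordinate[OF bounded_linear_minus[OF l]]) (use f c in auto)
  ultimately obtain c where "\<And>p. - f p = c" using par unfolding parabolic_def by blast
  then show ?thesis by (metis minus_minus)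
qed

text \<open>
  First \<open>u\<close>, whose Hessian vanishes on all vectors; then the submanifold is tangent to the vectors
  on which the Hessian of \<open>v\<close> vanishes.
\<close>

theorem contained_in_wavefront:
  assumes par: "parabolic B h" and "bounded_above_or_below (u_coord \<circ> \<psi>)" "bounded_above_or_below (v_coord \<circ> \<psi>)"
  obtains u0 v0 where "\<And>p. \<psi> p = (u0, v0, \<phi> p)"
proof -
  have "\<exists>c. \<forall>p. (u_coord \<circ> \<psi>) p = c"
    by (rule constant_coordinate[OF par assms(2) bounded_linear_components(1)])
      (use christoffel_u Psi_image in \<open>auto simp: Psi_components image_subset_iff\<close>)
  then obtain u0 where u0: "\<And>p. u_coord (\<psi> p) = u0" by auto
  have du: "fst (fd (\<Psi> i j) y v) = 0" if "y \<in> W i j" for i j y v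
    using fd_component[OF that bounded_linear_components(1), of v] by (simp add: Psi_components u0)
  have "\<exists>c. \<forall>p. (v_coord \<circ> \<psi>) p = c"
    by (rule constant_coordinate[OF par assms(3) bounded_linear_components(2)])
      (use christoffel_v du Psi_image in \<open>auto simp: Psi_components image_subset_iff\<close>)
  then obtain v0 where v0: "\<And>p. v_coord (\<psi> p) = v0" by auto
  have "\<psi> p = (u0, v0, \<phi> p)" for p
    using u0[of p] v0[of p] by (simp add: u_coord_def v_coord_def split_def prod_eq_iff)
  then show thesis by (rule that)
qed

end

section \<open>Wavefronts\<close>

context wave_spacetime
begin

context
  fixes u0 v0 :: real
begin

abbreviation "incl \<equiv> wavefront_incl u0 v0 :: 'm \<Rightarrow> _"
abbreviation "kW \<equiv> induced_metric A P gP incl"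

lemma incl_local_map: "local_map A P incl i j = (\<lambda>y. (u0, v0, local_map A A id i j y))"
  by (simp add: local_map_pfw wavefront_incl_def id_def)

lemma incl_local_dom: "local_dom A P incl i j = local_dom A A id i j"
  by (simp add: local_dom_pfw wavefront_incl_def id_def)

lemma open_transition: "open (local_dom A A id i j)"
  by (rule open_local_dom[OF smooth _ chart(1)]) (simp add: id_def)

lemma smooth_incl: "smooth_map A P incl"
  unfolding smooth_map_def incl_local_dom incl_local_map smooth_on_def
proof (intro conjI allI)
  show "continuous_on UNIV incl" unfolding wavefront_incl_def by (intro continuous_intros)
  fix i j m
  have "bounded_linear (\<lambda>z :: real ^ 'n. (0::real, 0::real, z))"
    by (intro bounded_linear_Pair bounded_linear_zero bounded_linear_ident)
  from Ck_on_add[OF open_transition Ck_on_const[of m _ "(u0, v0, 0)"]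
      Ck_on_linear_compose[OF open_transition this smooth_onD[OF chart(10)]]]
  show "Ck_on m (local_dom A A id i j) (\<lambda>y. (u0, v0, local_map A A id i j y))" by simp
qed

interpretation wavefront: map_into_wave A g H A incl
  by unfold_locales (rule smooth, rule smooth_incl)

lemma fd_incl:
  assumes "y \<in> local_dom A A id i j"
  shows "fd (local_map A P incl i j) y v = (0, 0, fd (local_map A A id i j) y v)"
proof -
  have "((\<lambda>y. (u0, v0, local_map A A id i j y)) has_derivative (\<lambda>v. (0, 0, fd (local_map A A id i j) y v))) (at y)"
    by (intro has_derivative_Pair has_derivative_const fd_works smooth_on_differentiable[OF chart(10) assms])
  then show ?thesis unfolding incl_local_map using fd_eqI by fastforce
qed

text \<open>
  The tangent vectors of a wavefront have vanishing \<open>u\<close>- and \<open>v\<close>-components, on which only \<open>g\<close>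
  remains.
\<close>

lemma wavefront_metric:
  assumes "y \<in> cimg A i"
  shows "kW i y = g i y"
proof (intro ext)
  fix v w
  have y: "y \<in> local_dom A A id i i" using assms chart(8) by (simp add: local_dom_iff[OF smooth])
  show "kW i y v w = g i y v w"
    using wavefront.induced_metric_in_chart[of y i i v w] y tensor[OF y, of v w]
    by (simp add: incl_local_dom fd_incl pfw_metric_apply) (simp add: incl_local_map)
qed

lemma transition_image: "local_map A A id i j ` local_dom A A id i j \<subseteq> cimg A j"
  by (auto simp: local_dom_iff[OF smooth] local_map_apply chart(7))

lemma transition_dom: "local_dom A A id i j \<subseteq> cimg A i"
  by (auto simp: local_dom_iff[OF smooth])

lemma riemannian_wavefront: "riemannian_metric A kW"
  unfolding riemannian_metric_def metric_tensor_def
proof (intro conjI allI ballI impI)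
  fix i x assume "x \<in> cimg A i"
  note e = wavefront_metric[OF this] and m = C1_metric_onD(2,3,4)[OF C1_metric this]
  show "bilinear (kW i x)" "nondegenerate (kW i x)" "kW i x v w = kW i x w v" for v w unfolding e by (rule m)+
  show "kW i x v v > 0" if "v \<noteq> 0" for v unfolding e by (rule positive) fact+
next
  fix i v w
  have s: "smooth_on (cimg A i) (\<lambda>x. g i x v w)"
    using riemannian by (simp add: riemannian_metric_def metric_tensor_def)
  have "Ck_on m (cimg A i) (\<lambda>x. kW i x v w)" for m
    by (rule Ck_on_cong[OF chart(2) _ smooth_onD[OF s]]) (rule fun_cong[OF fun_cong[OF wavefront_metric[symmetric]]])
  then show "smooth_on (cimg A i) (\<lambda>x. kW i x v w)" unfolding smooth_on_def by (rule allI)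
next
  fix i j x v w assume x: "x \<in> local_dom A A id i j"
  then have "x \<in> cimg A i" "local_map A A id i j x \<in> cimg A j" using transition_image transition_dom by blast+
  then show "kW i x v w = kW j (local_map A A id i j x) (fd (local_map A A id i j) x v) (fd (local_map A A id i j) x w)"
    using tensor[OF x] by (simp add: wavefront_metric)
qed

interpretation wavefront: riemannian_manifold A kW
  by unfold_locales (rule connected, rule riemannian_wavefront)

lemma C1_wavefront_metric_on_transition: "C1_metric_on (local_dom A A id i j) (kW i)"
  by (rule C1_metric_on_subset[OF wavefront.C1_metric open_transition transition_dom])

lemma isometric_transition: "isometric_on (local_dom A A id i j) (kW i) (g j) (local_map A A id i j)"
  unfolding isometric_on_def
proof (intro ballI allI)
  fix y v w assume y: "y \<in> local_dom A A id i j"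
  then have "y \<in> cimg A i" using transition_dom by blast
  then show "kW i y v w = g j (local_map A A id i j y) (fd (local_map A A id i j) y v) (fd (local_map A A id i j) y w)"
    using tensor[OF y] by (simp add: wavefront_metric)
qed

lemma spacelike_wavefront: "spacelike_submanifold A P gP incl"
  unfolding spacelike_submanifold_def immersion_def
proof (intro conjI allI ballI connected riemannian_wavefront smooth_incl)
  fix i j y assume "y \<in> local_dom A P incl i j"
  then have y: "y \<in> local_dom A A id i j" by (simp add: incl_local_dom)
  have "inj (fd (local_map A A id i j) y)"
    by (rule isometric_deriv_inj(1)[OF C1_wavefront_metric_on_transition C1_metric y _ smooth_on_differentiable[OF chart(10) y] isometric_transition])
      (use transition_image y in blast)
  then show "inj (fd (local_map A P incl i j) y)"
    by (simp add: inj_def fd_incl[OF y])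
qed

text \<open>
  By \<open>christoffel_vertical\<close> the second fundamental form of the inclusion is that of a transition map of \<open>M\<close>.
  The latter is isometric, hence totally geodesic.
\<close>

lemma extremal_wavefront: "extremal A P gP incl"
  unfolding extremal_def
proof (intro allI ballI)
  fix i j x assume "x \<in> local_dom A P incl i j"
  then have x: "x \<in> local_dom A A id i j" by (simp add: incl_local_dom)
  let ?T = "local_map A A id i j" and ?I = "local_map A P incl i j"
  have Ix: "?I x \<in> cimg P j" using transition_image x by (auto simp: incl_local_map cimg_pfw)
  have "second_ff (kW i) (gP j) ?I (\<lambda>_. v) (\<lambda>_. w) x = 0" for v w
  proof -
    have 0: "second_ff (kW i) (g j) ?T (\<lambda>_. v) (\<lambda>_. w) x = 0"
      by (rule isometric_second_ff_zero[OF C1_wavefront_metric_on_transition C1_metric x transition_image smooth_onD[OF chart(10)] isometric_transition])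
    have dd: "(\<lambda>y. fd ?T y w) differentiable (at x)" using smooth_onD[OF chart(10), of "Suc (Suc 0)" i j] x by auto
    have "((\<lambda>y. (0::real, 0::real, fd ?T y w)) has_derivative (\<lambda>v. (0, 0, fd (\<lambda>y. fd ?T y w) x v))) (at x)"
      by (intro has_derivative_Pair has_derivative_const fd_works dd)
    moreover have "fd (\<lambda>y. fd ?I y w) x = fd (\<lambda>y. (0::real, 0::real, fd ?T y w)) x"
      by (rule fd_cong_open[OF open_transition x]) (rule fd_incl)
    ultimately have "fd (\<lambda>y. fd ?I y w) x v = (0, 0, fd (\<lambda>y. fd ?T y w) x v)" using fd_eqI by fastforce
    then show ?thesis
      using 0 unfolding second_ff_constant fd_incl[OF x] christoffel_vertical[OF Ix]
      by (simp add: incl_local_map zero_prod_def)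
  qed
  then show "mean_curvature (kW i) (gP j) ?I x = 0"
    by (simp add: mean_curvature_def metric_trace_def)
qed

lemma range_incl: "range incl = wavefront u0 v0"
  by (auto simp: wavefront_incl_def wavefront_def u_coord_def v_coord_def)

text \<open>
  The projection to \<open>M\<close> is a local isometry for the induced metric, as the constant components of
  \<open>\<psi>\<close> contribute nothing to it.
\<close>

lemma wavefront_covered:
  fixes B :: "('j, 's::{t2_space, second_countable_topology}, real ^ 'n) atlas" and \<psi> :: "'s \<Rightarrow> real \<times> real \<times> 'm"
  assumes B: "riemannian_manifold B (induced_metric B P gP \<psi>)" and psi: "smooth_map B P \<psi>"
    and eq: "\<And>p. \<psi> p = (u0, v0, snd (snd (\<psi> p)))" and par: "parabolic B (induced_metric B P gP \<psi>)"
  shows "range \<psi> = wavefront u0 v0" "parabolic A kW"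
proof -
  interpret src: riemannian_manifold B "induced_metric B P gP \<psi>" by (rule B)
  interpret map_into_wave A g H B \<psi>
    by unfold_locales (rule src.smooth, rule psi)
  interpret iso: riemannian_local_isometry B "induced_metric B P gP \<psi>" A kW "\<lambda>p. snd (snd (\<psi> p))"
  proof (unfold_locales, rule smooth_map_phi, unfold isometric_on_def local_dom_pfw[symmetric], intro ballI allI)
    fix i j y v w assume y: "y \<in> W i j"
    have c: "fst (\<psi> p) = u0" "fst (snd (\<psi> p)) = v0" for p using eq[of p] by (metis fst_conv snd_conv)+
    have "fst (fd (\<Psi> i j) y x) = 0" "fst (snd (fd (\<Psi> i j) y x)) = 0" for x
      using fd_component[OF y bounded_linear_components(1), of x] fd_component[OF y bounded_linear_components(2), of x]
      by (simp_all add: local_map_pfw c)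
    moreover have "F i j y \<in> cimg A j" using Psi_image y by (auto simp: cimg_pfw local_map_pfw)
    ultimately show "h i y v w = kW j (F i j y) (fd (F i j) y v) (fd (F i j) y w)"
      unfolding induced_metric_in_chart[OF y]
      by (simp add: pfw_metric_apply fd_F[OF y] Psi_components wavefront_metric)
  qed
  have "surj (\<lambda>p. snd (snd (\<psi> p)))" by (rule iso.parabolic_target(1)[OF par])
  then have "\<exists>p. snd (snd (\<psi> p)) = x" for x by (metis surjD)
  then have "\<exists>p. \<psi> p = incl x" for x using eq by (metis wavefront_incl_def)
  moreover have "\<psi> p \<in> range incl" for p using eq[of p] by (metis rangeI wavefront_incl_def)
  ultimately show "range \<psi> = wavefront u0 v0" unfolding range_incl[symmetric] by (metis (no_types, lifting) image_subset_iff rangeE rangeI subsetI subset_antisym)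
  show "parabolic A kW" by (rule iso.parabolic_target(2)[OF par])
qed

end

end

section \<open>The parabolic extremal submanifolds of codimension two\<close>

theorem theorem15:
  fixes A :: "('i, 'm::{t2_space, second_countable_topology}, real ^ 'n) atlas"
    and g :: "('i, real ^ 'n) metric"
    and H :: "real \<Rightarrow> 'm \<Rightarrow> real"
    and B :: "('j, 's::{t2_space, second_countable_topology}, real ^ 'n) atlas"
    and \<psi> :: "'s \<Rightarrow> real \<times> real \<times> 'm"
  assumes "plane_fronted_wave A g H"
  shows
    "(spacelike_submanifold B (pfw_atlas A) (pfw_metric A g H) \<psi> \<and>
      extremal B (pfw_atlas A) (pfw_metric A g H) \<psi> \<and>
      parabolic B (induced_metric B (pfw_atlas A) (pfw_metric A g H) \<psi>) \<and>
      bounded_above_or_below (u_coord \<circ> \<psi>) \<and>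
      bounded_above_or_below (v_coord \<circ> \<psi>) \<longrightarrow>
      (\<exists>u\<^sub>0 v\<^sub>0. range \<psi> = wavefront u\<^sub>0 v\<^sub>0 \<and>
         parabolic A (induced_metric A (pfw_atlas A) (pfw_metric A g H) (wavefront_incl u\<^sub>0 v\<^sub>0)))) \<and>
     (\<forall>u\<^sub>0 v\<^sub>0.
        parabolic A (induced_metric A (pfw_atlas A) (pfw_metric A g H) (wavefront_incl u\<^sub>0 v\<^sub>0)) \<longrightarrow>
        range (wavefront_incl u\<^sub>0 v\<^sub>0) = (wavefront u\<^sub>0 v\<^sub>0 :: (real \<times> real \<times> 'm) set) \<and>
        spacelike_submanifold A (pfw_atlas A) (pfw_metric A g H) (wavefront_incl u\<^sub>0 v\<^sub>0) \<and>
        extremal A (pfw_atlas A) (pfw_metric A g H) (wavefront_incl u\<^sub>0 v\<^sub>0) \<and>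
        bounded_above_or_below (u_coord \<circ> (wavefront_incl u\<^sub>0 v\<^sub>0 :: 'm \<Rightarrow> _)) \<and>
        bounded_above_or_below (v_coord \<circ> (wavefront_incl u\<^sub>0 v\<^sub>0 :: 'm \<Rightarrow> _)))"
proof (intro conjI impI allI)
  interpret wave_spacetime A g H by unfold_locales (rule assms)
  {
    assume hyps: "spacelike_submanifold B P gP \<psi> \<and> extremal B P gP \<psi> \<and>
      parabolic B (induced_metric B P gP \<psi>) \<and>
      bounded_above_or_below (u_coord \<circ> \<psi>) \<and> bounded_above_or_below (v_coord \<circ> \<psi>)"
    then have R: "riemannian_manifold B (induced_metric B P gP \<psi>)" and S: "smooth_map B P \<psi>"
      by (auto simp: spacelike_submanifold_def immersion_def riemannian_manifold_def)
    interpret src: riemannian_manifold B "induced_metric B P gP \<psi>" by (rule R)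
    interpret extremal_in_wave A g H B \<psi>
      by unfold_locales (use hyps S src.smooth in auto)
    obtain u0 v0 where "\<And>p. \<psi> p = (u0, v0, snd (snd (\<psi> p)))"
      using contained_in_wavefront hyps by metis
    from wavefront_covered[OF R S this] hyps
    show "\<exists>u\<^sub>0 v\<^sub>0. range \<psi> = wavefront u\<^sub>0 v\<^sub>0 \<and> parabolic A (induced_metric A P gP (wavefront_incl u\<^sub>0 v\<^sub>0))"
      by blast
  }
  fix u\<^sub>0 v\<^sub>0 :: real
  show "range (wavefront_incl u\<^sub>0 v\<^sub>0) = (wavefront u\<^sub>0 v\<^sub>0 :: (real \<times> real \<times> 'm) set)" by (rule range_incl)
  show "spacelike_submanifold A P gP (wavefront_incl u\<^sub>0 v\<^sub>0)" by (rule spacelike_wavefront)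
  show "extremal A P gP (wavefront_incl u\<^sub>0 v\<^sub>0)" by (rule extremal_wavefront)
  show "bounded_above_or_below (u_coord \<circ> (wavefront_incl u\<^sub>0 v\<^sub>0 :: 'm \<Rightarrow> _))"
    "bounded_above_or_below (v_coord \<circ> (wavefront_incl u\<^sub>0 v\<^sub>0 :: 'm \<Rightarrow> _))"
    by (simp_all add: bounded_above_or_below_def o_def u_coord_def v_coord_def wavefront_incl_def)
qed

end
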